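(* Let $C|R$ be a quadratic (possibly inseparable) field extension and let $(U,\mathcal{B})$ be a finite subunital of the generalized hermitian unital $\mathcal{H}(C|R)$. Then $(U,\mathcal{B})$ is a hermitian unital: it is isomorphic to $\mathcal{H}(E|F)$ for some quadratic extension $E|F$ of finite fields. Moreover, the embedding of $(U,\mathcal{B})\cong\mathcal{H}(E|F)$ into $\mathcal{H}(C|R)$ is standard, coming from an embedding of field extensions from $E|F$ into $C|R$. Furthermore, the extension $C|R$ is separable, and $\mathcal{H}(C|R)$ is a hermitian unital.
   Context: Generalized hermitian unitals. Let $C|R$ be any quadratic (possibly inseparable) extension of fields, and write $C=R+\varepsilon R$ with $\varepsilon\in C\setminus R$. There are $t,d\in R$ with $\varepsilon^2-t\varepsilon+d=0$. The map $\sigma\colon C\to C$, $x+\varepsilon y\mapsto (x+ty)-\varepsilon y$ (for $x,y\in R$), is a field automorphism generating $\mathrm{Aut}_R C$ (of order $2$ if $C|R$ is separable, the identity if $C|R$ is inseparable). Let $\mathrm{PG}(2,C)$ be the projective plane of the vector space $C^3$, with points $[X,Y,Z]:=(X,Y,Z)C$. The generalized hermitian unital $\mathcal{H}(C|R)$ is the incidence structure $(H,\mathcal{M})$ with point set $H=\{[X,Y,Z] \mid X^\sigma Y+Z^\sigma Z\in\varepsilon R\}$, whose set $\mathcal{M}$ of blocks consists of the intersections of $H$ with secant lines, i.e. lines of $\mathrm{PG}(2,C)$ containing more than one point of $H$. It is called a hermitian unital if $C|R$ is separable; in that case $H$ is the set of absolute points of a unitary polarity of $\mathrm{PG}(2,C)$.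 A (finite) unital of order $q$ ($q\ge 2$ an integer) is a $2$-$(q^3+1,q+1,1)$-design. Embeddings. A linear space is a point-block incidence structure in which any two distinct points are on a unique block (and every block has at least two points). An embedding of a linear space $(X,\mathcal{B})$ into a linear space $(Y,\mathcal{D})$ is a pair of injective maps $\alpha\colon X\to Y$, $\beta\colon\mathcal{B}\to\mathcal{D}$ such that $x\in X$ and $B\in\mathcal{B}$ are incident in $(X,\mathcal{B})$ if and only if $x^\alpha$ and $B^\beta$ are incident in $(Y,\mathcal{D})$. A unital $(X,\mathcal{B})$ is a subunital of $(Y,\mathcal{D})$ if the pair of inclusion (identity) maps is an embedding of $(X,\mathcal{B})$ into $(Y,\mathcal{D})$; concretely, $X\subseteq Y$ and each block of $\mathcal{B}$ is identified with a block of $\mathcal{D}$, incidence in $(X,\mathcal{B})$ being the one induced from $(Y,\mathcal{D})$. Standard embeddings. An embedding of field extensions from $E|F$ into $C|R$ is a field monomorphism $\eta\colon E\to C$ with $F^\eta\subseteq R$. An embedding $(\alpha,\beta)$ of $\mathcal{H}(E|F)$ into $\mathcal{H}(C|R)$ is called standard if there is an embedding $\eta$ of field extensions from $E|F$ into $C|R$ such that, up to some projective transformation of $\mathrm{PG}(2,C)$, $\bigl((x,y,z)E\bigr)^\alpha=(x^\eta,y^\eta,z^\eta)C$ holds for each point $(x,y,z)E$ of $\mathcal{H}(E|F)$. *)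

theory Defs
  imports "HOL-Analysis.Cartesian_Space" "HOL-Computational_Algebra.Polynomial"
begin

text \<open>
  All fields are subfields of an ambient field type, so that the same definitions apply to
  \<open>C|R\<close> (where \<open>C\<close> may be the whole type) and to \<open>E|F\<close>.
\<close>

definition is_subfield :: "'a::field set \<Rightarrow> bool" where
  "is_subfield K \<longleftrightarrow> 0 \<in> K \<and> 1 \<in> K \<and>
     (\<forall>x\<in>K. \<forall>y\<in>K. x + y \<in> K \<and> x * y \<in> K) \<and>
     (\<forall>x\<in>K. - x \<in> K \<and> inverse x \<in> K)"

text \<open>Degree two: \<open>K\<close> has a basis of two elements as a vector space over \<open>F\<close>.\<close>

definition quadratic_extension :: "'a::field set \<Rightarrow> 'a set \<Rightarrow> bool" where
  "quadratic_extension K F \<longleftrightarrow> is_subfield K \<and> is_subfield F \<and> F \<subseteq> K \<and>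
     (\<exists>a\<in>K. \<exists>b\<in>K. \<forall>z\<in>K. \<exists>!c. c \<in> F \<times> F \<and> z = fst c * a + snd c * b)"

text \<open>
  An element is separable over \<open>F\<close> if it is a root of a separable polynomial over \<open>F\<close>, i.e. one
  coprime to its formal derivative. Coprimality is taken over the ambient field, which makes no
  difference because greatest common divisors do not change under field extension.
\<close>

definition separable_extension :: "'a::field set \<Rightarrow> 'a set \<Rightarrow> bool" where
  "separable_extension K F \<longleftrightarrow>
     (\<forall>a\<in>K. \<exists>p. (\<forall>i. coeff p i \<in> F) \<and> poly p a = 0 \<and> coprime p (pderiv p))"

definition field_ext_embedding ::
  "'e::field set \<Rightarrow> 'e set \<Rightarrow> 'c::field set \<Rightarrow> 'c set \<Rightarrow> ('e \<Rightarrow> 'c) \<Rightarrow> bool" where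
  "field_ext_embedding E F C R \<eta> \<longleftrightarrow>
     \<eta> ` E \<subseteq> C \<and> inj_on \<eta> E \<and> \<eta> 1 = 1 \<and>
     (\<forall>x\<in>E. \<forall>y\<in>E. \<eta> (x + y) = \<eta> x + \<eta> y \<and> \<eta> (x * y) = \<eta> x * \<eta> y) \<and>
     \<eta> ` F \<subseteq> R"

text \<open>
  For \<open>K = F + \<epsilon>F\<close>: the element \<open>t\<close> of \<open>F\<close> with \<open>\<epsilon>\<^sup>2 - t\<epsilon> + d = 0\<close> for some \<open>d \<in> F\<close>, which is
  unique as \<open>\<epsilon> \<notin> F\<close>, and the map \<open>\<sigma> : x + \<epsilon>y \<mapsto> (x + ty) - \<epsilon>y\<close>.
\<close>

definition ext_t :: "'a::field set \<Rightarrow> 'a \<Rightarrow> 'a" where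
  "ext_t F \<epsilon> = (THE t. t \<in> F \<and> (\<exists>d\<in>F. \<epsilon>^2 - t * \<epsilon> + d = 0))"

definition ext_conj :: "'a::field set \<Rightarrow> 'a \<Rightarrow> 'a \<Rightarrow> 'a" where
  "ext_conj F \<epsilon> z =
     (THE w. \<exists>x\<in>F. \<exists>y\<in>F. z = x + \<epsilon> * y \<and> w = (x + ext_t F \<epsilon> * y) - \<epsilon> * y)"

text \<open>
  The projective plane of \<open>K\<^sup>3\<close>: a point is a one-dimensional subspace (a set of vectors), a line is
  the set of all points contained in a given two-dimensional subspace.
\<close>

definition vecs3 :: "'a::field set \<Rightarrow> ('a^3) set" where
  "vecs3 K = {v. \<forall>i. v $ i \<in> K}"

definition proj_point :: "'a::field set \<Rightarrow> 'a^3 \<Rightarrow> ('a^3) set" where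
  "proj_point K v = {k *s v | k. k \<in> K}"

definition proj_points :: "'a::field set \<Rightarrow> ('a^3) set set" where
  "proj_points K = {proj_point K v | v. v \<in> vecs3 K \<and> v \<noteq> 0}"

definition lin_indep2 :: "'a::field set \<Rightarrow> 'a^3 \<Rightarrow> 'a^3 \<Rightarrow> bool" where
  "lin_indep2 K u w \<longleftrightarrow> (\<forall>a\<in>K. \<forall>b\<in>K. a *s u + b *s w = 0 \<longrightarrow> a = 0 \<and> b = 0)"

definition proj_lines :: "'a::field set \<Rightarrow> ('a^3) set set set" where
  "proj_lines K =
     {{P \<in> proj_points K. P \<subseteq> {a *s u + b *s w | a b. a \<in> K \<and> b \<in> K}} | u w.
        u \<in> vecs3 K \<and> w \<in> vecs3 K \<and> lin_indep2 K u w}"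

record ('p, 'b) incidence_structure =
  inc_points :: "'p set"
  inc_blocks :: "'b set"
  incident :: "'p \<Rightarrow> 'b \<Rightarrow> bool"

definition two_design :: "nat \<Rightarrow> nat \<Rightarrow> nat \<Rightarrow> ('p, 'b) incidence_structure \<Rightarrow> bool" where
  "two_design v k l S \<longleftrightarrow>
     finite (inc_points S) \<and> card (inc_points S) = v \<and>
     finite (inc_blocks S) \<and>
     (\<forall>b\<in>inc_blocks S. card {x \<in> inc_points S. incident S x b} = k) \<and>
     (\<forall>x\<in>inc_points S. \<forall>y\<in>inc_points S. x \<noteq> y \<longrightarrow>
        card {b \<in> inc_blocks S. incident S x b \<and> incident S y b} = l)"

definition unital_of_order :: "nat \<Rightarrow> ('p, 'b) incidence_structure \<Rightarrow> bool" where
  "unital_of_order q S \<longleftrightarrow> q \<ge> 2 \<and> two_design (q^3 + 1) (q + 1) 1 S"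

definition finite_unital :: "('p, 'b) incidence_structure \<Rightarrow> bool" where
  "finite_unital S \<longleftrightarrow> (\<exists>q. unital_of_order q S)"

definition inc_embedding ::
  "('p \<Rightarrow> 'r) \<Rightarrow> ('b \<Rightarrow> 'd) \<Rightarrow> ('p, 'b) incidence_structure \<Rightarrow> ('r, 'd) incidence_structure \<Rightarrow> bool"
where
  "inc_embedding \<alpha> \<beta> S T \<longleftrightarrow>
     inj_on \<alpha> (inc_points S) \<and> \<alpha> ` inc_points S \<subseteq> inc_points T \<and>
     inj_on \<beta> (inc_blocks S) \<and> \<beta> ` inc_blocks S \<subseteq> inc_blocks T \<and>
     (\<forall>x\<in>inc_points S. \<forall>b\<in>inc_blocks S. incident S x b \<longleftrightarrow> incident T (\<alpha> x) (\<beta> b))"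

definition inc_isomorphism ::
  "('p \<Rightarrow> 'r) \<Rightarrow> ('b \<Rightarrow> 'd) \<Rightarrow> ('p, 'b) incidence_structure \<Rightarrow> ('r, 'd) incidence_structure \<Rightarrow> bool"
where
  "inc_isomorphism \<alpha> \<beta> S T \<longleftrightarrow>
     bij_betw \<alpha> (inc_points S) (inc_points T) \<and>
     bij_betw \<beta> (inc_blocks S) (inc_blocks T) \<and>
     (\<forall>x\<in>inc_points S. \<forall>b\<in>inc_blocks S. incident S x b \<longleftrightarrow> incident T (\<alpha> x) (\<beta> b))"

definition subunital :: "('p, 'b) incidence_structure \<Rightarrow> ('p, 'b) incidence_structure \<Rightarrow> bool" where
  "subunital S T \<longleftrightarrow> inc_embedding id id S T"

text \<open>
  The generalized hermitian unital \<open>\<H>(K|F)\<close>, written with respect to \<open>K = F + \<epsilon>F\<close>. A different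
  choice of \<open>\<epsilon> \<in> K - F\<close> changes the point set only by a projective transformation.
\<close>

definition herm_points :: "'a::field set \<Rightarrow> 'a set \<Rightarrow> 'a \<Rightarrow> ('a^3) set set" where
  "herm_points K F \<epsilon> =
     {proj_point K v | v. v \<in> vecs3 K \<and> v \<noteq> 0 \<and>
        ext_conj F \<epsilon> (v $ 1) * v $ 2 + ext_conj F \<epsilon> (v $ 3) * v $ 3 \<in> {\<epsilon> * r | r. r \<in> F}}"

definition gen_hermitian_unital ::
  "'a::field set \<Rightarrow> 'a set \<Rightarrow> 'a \<Rightarrow> (('a^3) set, ('a^3) set set) incidence_structure" where
  "gen_hermitian_unital K F \<epsilon> =
     \<lparr> inc_points = herm_points K F \<epsilon>,
       inc_blocks = {herm_points K F \<epsilon> \<inter> L | L. L \<in> proj_lines K \<and>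
         (\<exists>P Q. P \<in> herm_points K F \<epsilon> \<inter> L \<and> Q \<in> herm_points K F \<epsilon> \<inter> L \<and> P \<noteq> Q)},
       incident = (\<in>) \<rparr>"

text \<open>
  Being a hermitian unital is understood up to isomorphism; \<open>K|F\<close> is passed explicitly so that the
  separability requirement refers to that extension.
\<close>

definition hermitian_unital ::
  "'a::field set \<Rightarrow> 'a set \<Rightarrow> 'a \<Rightarrow> ('p, 'b) incidence_structure \<Rightarrow> bool" where
  "hermitian_unital K F \<epsilon> S \<longleftrightarrow>
     quadratic_extension K F \<and> \<epsilon> \<in> K - F \<and> separable_extension K F \<and>
     (\<exists>\<alpha> \<beta>. inc_isomorphism \<alpha> \<beta> (gen_hermitian_unital K F \<epsilon>) S)"

text \<open>
  A projective transformation is one induced by an invertible linear map. The matrix has entries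
  in \<open>C\<close>; as \<open>C\<close> is a field, so does its inverse.
\<close>

definition standard_embedding ::
  "'e::field set \<Rightarrow> 'e set \<Rightarrow> 'e \<Rightarrow> 'c::field set \<Rightarrow> 'c set \<Rightarrow> 'c \<Rightarrow>
    (('e^3) set \<Rightarrow> ('c^3) set) \<Rightarrow> (('e^3) set set \<Rightarrow> ('c^3) set set) \<Rightarrow> bool" where
  "standard_embedding E F e C R \<epsilon> \<alpha> \<beta> \<longleftrightarrow>
     inc_embedding \<alpha> \<beta> (gen_hermitian_unital E F e) (gen_hermitian_unital C R \<epsilon>) \<and>
     (\<exists>\<eta> (A :: 'c^3^3). field_ext_embedding E F C R \<eta> \<and>
        invertible A \<and> (\<forall>i j. A $ i $ j \<in> C) \<and>
        (\<forall>v. v \<in> vecs3 E \<and> v \<noteq> 0 \<and> proj_point E v \<in> inc_points (gen_hermitian_unital E F e) \<longrightarrow>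
           \<alpha> (proj_point E v) = (\<lambda>w. A *v w) ` proj_point C (\<chi> i. \<eta> (v $ i))))"

end

theory Submission
  imports Defs "HOL-Analysis.Determinants"
begin

text \<open>
  Write \<open>N(z) = z z\<^sup>\<sigma>\<close>. After dividing \<open>Y\<close> by \<open>\<epsilon>\<close>, the unital consists of \<open>\<infinity> = [0,1,0]\<close> and the points
  \<open>[1,y,z]\<close> with \<open>y \<in> \<mu> N(z) + R\<close>, where \<open>\<mu> \<notin> R\<close>. The blocks through \<open>\<infinity>\<close> are the fibres
  \<open>z = const\<close>. The quadratic map \<open>N\<close> is anisotropic, and this makes lines rigid: a line is determined,
  up to a translation \<open>y \<mapsto> y + r\<close>, by any three of the fibres that it meets (\<open>slope_rigid\<close>).

  Let \<open>U\<close> be a finite subunital of order \<open>q\<close> containing \<open>\<infinity>\<close>. Rigidity and a count of fibres show that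
  the differences of heights between two fibres of \<open>U\<close> take at most \<open>q\<close> values. As each fibre has
  \<open>q\<close> elements, all fibres are cosets of one additive group, so \<open>U\<close> is invariant under \<open>q\<close>
  translations with centre \<open>\<infinity>\<close> (\<open>translate\<close>). The same holds at every point of \<open>U\<close>, because the
  group of the big unital moves any two points to \<open>\<infinity>\<close> and \<open>[1,0,0]\<close> (\<open>normal_position\<close>).

  Normalize a third point of \<open>U\<close> on \<open>Z = 0\<close> to \<open>[1,1,0]\<close> and one more point to \<open>[1,u,1]\<close>. Translation
  invariance at \<open>\<infinity>\<close> and at \<open>[1,0,0]\<close> says that the set \<open>F\<close> of all \<open>f\<close> with \<open>[1,f,0] \<in> U\<close> is an
  additive group whose inverses form an additive group, and Hua's identity turns it into a subfield
  of \<open>R\<close> with \<open>q\<close> elements (\<open>subfield_F\<close>). The translations at the two points generate \<open>SL\<^sub>2(F)\<close>, and the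
  remaining points of \<open>U\<close> form the orbit of \<open>[1,u,1]\<close> (\<open>orbit_complete\<close>). The line through \<open>[1,u,1]\<close>
  and \<open>[u,u-1,1]\<close> contains a third point of the orbit, and this collinearity is a quadratic equation
  for \<open>u\<close> over \<open>F\<close> (\<open>quadratic_witness\<close>). So \<open>E = F + Fu\<close> is a finite field, and computing the orbit
  gives \<open>U = {\<infinity>} \<union> {[1,y,z] | z \<in> E, y - u N(z) \<in> F}\<close> (\<open>affine_iff\<close>), which is \<open>\<H>(E|F)\<close> up to a
  factor of \<open>Y\<close>. Finite fields are perfect, hence \<open>u \<noteq> u\<^sup>\<sigma>\<close>, which makes \<open>E|F\<close> and \<open>C|R\<close> separable.

  Every isomorphism between two such sets is induced by a field embedding. By rigidity it conjugates
  translations to translations (\<open>translation_conjugate\<close>). On the block \<open>Z = 0\<close> it is therefore an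
  additive map compatible with inversion in Hua's sense, that is, an isomorphism \<open>\<psi>\<close> of the fields
  \<open>F\<close> (\<open>hua_multiplicative\<close>); on the orbit it is determined by \<open>\<psi>\<close> and the image of \<open>[1,u,1]\<close>. The
  collinear triple above is preserved, so the quadratic equations of the two elements \<open>u\<close> correspond
  under \<open>\<psi>\<close>, and \<open>\<psi>\<close> extends to \<open>E\<close> (\<open>\<theta>_semilinear\<close>). Hence every isomorphism from \<open>\<H>(E|F)\<close> is
  standard.
\<close>

section \<open>Subfields and conjugations\<close>

lemma subfield_closed:
  assumes "is_subfield K"
  shows "0 \<in> K" "1 \<in> K"
    and "\<And>x y. x \<in> K \<Longrightarrow> y \<in> K \<Longrightarrow> x + y \<in> K"
    and "\<And>x y. x \<in> K \<Longrightarrow> y \<in> K \<Longrightarrow> x * y \<in> K"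
    and "\<And>x. x \<in> K \<Longrightarrow> - x \<in> K"
    and "\<And>x y. x \<in> K \<Longrightarrow> y \<in> K \<Longrightarrow> x - y \<in> K"
    and "\<And>x. x \<in> K \<Longrightarrow> inverse x \<in> K"
    and "\<And>x y. x \<in> K \<Longrightarrow> y \<in> K \<Longrightarrow> x / y \<in> K"
proof -
  show "x - y \<in> K" if "x \<in> K" "y \<in> K" for x y
    using that assms unfolding is_subfield_def by (metis diff_conv_add_uminus)
  show "x / y \<in> K" if "x \<in> K" "y \<in> K" for x y
    using that assms unfolding is_subfield_def by (metis divide_inverse)
qed (use assms in \<open>auto simp: is_subfield_def\<close>)

text \<open>
  Dividing by \<open>a\<close> would express \<open>\<mu>\<close> in \<open>K\<close>. This is how linear independence of \<open>1\<close> and \<open>\<mu>\<close> over \<open>K\<close> is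
  used throughout.
\<close>

lemma subfield_multiple_outside:
  assumes "is_subfield K" "\<mu> \<notin> K" "a \<in> K" "\<mu> * a \<in> K"
  shows "a = 0"
proof (rule ccontr)
  assume "a \<noteq> 0"
  then have "\<mu> = (\<mu> * a) / a" by simp
  then show False using subfield_closed(8)[OF assms(1,4,3)] assms(2) by simp
qed

text \<open>
  The conjugation of a quadratic extension \<open>C|R\<close>, kept abstract so that the separable and the
  inseparable case (where it is the identity) are treated at once.
\<close>

locale field_conj =
  fixes R :: "'c::field set" and \<sigma> :: "'c \<Rightarrow> 'c"
  assumes R: "is_subfield R"
    and conj_add: "\<sigma> (x + y) = \<sigma> x + \<sigma> y"
    and conj_mult: "\<sigma> (x * y) = \<sigma> x * \<sigma> y"
    and conj_conj [simp]: "\<sigma> (\<sigma> x) = x"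
    and conj_fix: "r \<in> R \<Longrightarrow> \<sigma> r = r"
    and trace_in: "x + \<sigma> x \<in> R"
    and norm_in: "x * \<sigma> x \<in> R"
begin

lemmas R_closed = subfield_closed[OF R]

abbreviation N :: "'c \<Rightarrow> 'c" where "N z \<equiv> z * \<sigma> z"

lemma conj_0 [simp]: "\<sigma> 0 = 0" and conj_1 [simp]: "\<sigma> 1 = 1"
  using conj_fix R_closed by auto

lemma conj_minus: "\<sigma> (- x) = - \<sigma> x"
  using conj_add[of x "- x"] by (simp add: add_eq_0_iff)

lemma conj_diff: "\<sigma> (x - y) = \<sigma> x - \<sigma> y"
  using conj_add[of x "- y"] by (simp add: conj_minus)

lemma conj_eq_0_iff [simp]: "\<sigma> x = 0 \<longleftrightarrow> x = 0"
  by (metis conj_0 conj_conj)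

lemma conj_divide: "\<sigma> (x / y) = \<sigma> x / \<sigma> y"
proof (cases "y = 0")
  case False
  then have "\<sigma> (x / y) * \<sigma> y = \<sigma> x" by (metis conj_mult nonzero_divide_eq_eq)
  then show ?thesis using False by (simp add: nonzero_eq_divide_eq)
qed simp

lemma conj_in_R_iff: "\<sigma> x \<in> R \<longleftrightarrow> x \<in> R"
  by (metis conj_conj conj_fix)

lemma norm_line:
  assumes "k \<in> R"
  shows "N (z + k * w) = N z + k * (z * \<sigma> w + w * \<sigma> z) + k^2 * N w"
  using conj_fix[OF assms] by (simp add: conj_add conj_mult algebra_simps power2_eq_square)

text \<open>
  Three points of the affine unital \<open>y \<in> \<mu> N(z) + R\<close> over three given values of \<open>z\<close> that lie on a
  line determine its slope: two different slopes would force \<open>z\<^sub>1, z\<^sub>2, z\<^sub>3\<close> onto an affine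
  \<open>R\<close>-line, and on such a line the anisotropic quadratic function \<open>N\<close> cannot agree with an
  \<open>R\<close>-affine function at three points.
\<close>

lemma slope_rigid:
  assumes \<mu>: "\<mu> \<notin> R"
    and h: "y1 - \<mu> * N z1 \<in> R" "y2 - \<mu> * N z2 \<in> R" "y3 - \<mu> * N z3 \<in> R"
    and h': "y1' - \<mu> * N z1 \<in> R" "y2' - \<mu> * N z2 \<in> R" "y3' - \<mu> * N z3 \<in> R"
    and ne: "z1 \<noteq> z2" "z1 \<noteq> z3" "z2 \<noteq> z3"
    and col: "(y3 - y1) * (z2 - z1) = (y2 - y1) * (z3 - z1)"
    and col': "(y3' - y1') * (z2 - z1) = (y2' - y1') * (z3 - z1)"
  shows "y2' - y1' = y2 - y1"
proof (rule ccontr)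
  assume neq: "y2' - y1' \<noteq> y2 - y1"
  define d2 where "d2 = (y2 - y1) - (y2' - y1')"
  define d3 where "d3 = (y3 - y1) - (y3' - y1')"
  have "d2 = ((y2 - \<mu> * N z2) - (y1 - \<mu> * N z1)) - ((y2' - \<mu> * N z2) - (y1' - \<mu> * N z1))"
    by (simp add: d2_def)
  then have d2: "d2 \<in> R" by (simp only:) (intro R_closed(6) h h')
  have "d3 = ((y3 - \<mu> * N z3) - (y1 - \<mu> * N z1)) - ((y3' - \<mu> * N z3) - (y1' - \<mu> * N z1))"
    by (simp add: d3_def)
  then have d3: "d3 \<in> R" by (simp only:) (intro R_closed(6) h h')
  have d20: "d2 \<noteq> 0" using neq by (simp add: d2_def)
  have e: "d3 * (z2 - z1) = d2 * (z3 - z1)"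
    using col col' unfolding d2_def d3_def by (metis left_diff_distrib)
  define k where "k = d3 / d2"
  have k: "k \<in> R" using R_closed(8) d2 d3 by (simp add: k_def)
  define w where "w = z2 - z1"
  have w: "w \<noteq> 0" using ne by (simp add: w_def)
  have kw: "z3 - z1 = k * w" using e d20 by (simp add: k_def w_def field_simps)
  have "(y3 - y1) * w = (y2 - y1) * (k * w)" using col kw by (simp add: w_def)
  \<comment> \<open>the height along the line is an \<open>R\<close>-affine function of \<open>k\<close>, whereas \<open>N\<close> is quadratic in \<open>k\<close>\<close>
  then have ky: "y3 - y1 = k * (y2 - y1)" using w by simp
  let ?n = "(N z3 - N z1) - k * (N z2 - N z1)"
  have e1: "\<mu> * ?n = k * ((y2 - \<mu> * N z2) - (y1 - \<mu> * N z1)) - ((y3 - \<mu> * N z3) - (y1 - \<mu> * N z1))"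
    using ky by (simp add: algebra_simps)
  have e2: "k * ((y2 - \<mu> * N z2) - (y1 - \<mu> * N z1)) - ((y3 - \<mu> * N z3) - (y1 - \<mu> * N z1)) \<in> R"
    using h k R_closed(4,6) by simp
  have e3: "?n \<in> R" using k norm_in R_closed(4,6) by simp
  have n0: "?n = 0"
    by (rule subfield_multiple_outside[OF R \<mu> e3]) (simp only: e1 e2)
  have z3: "z3 = z1 + k * w" using kw by (simp add: algebra_simps)
  have z2: "z2 = z1 + 1 * w" by (simp add: w_def)
  have N3: "N z3 = N z1 + k * (z1 * \<sigma> w + w * \<sigma> z1) + k^2 * N w"
    using norm_line[OF k] by (simp only: z3)
  have N2: "N z2 = N z1 + 1 * (z1 * \<sigma> w + w * \<sigma> z1) + 1^2 * N w"
    using norm_line[OF R_closed(2)] by (simp only: z2)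
  have "?n = k * (k - 1) * N w" unfolding N3 N2 by (simp add: algebra_simps power2_eq_square)
  then have "k = 0 \<or> k = 1" using n0 w by simp
  then show False using kw ne z2 z3 by auto
qed

end

section \<open>The blocks through a point of a finite subunital\<close>

text \<open>
  The points of a subunital outside one of its points \<open>\<infinity> = [0,1,0]\<close>, where \<open>(y,z)\<close> stands for
  \<open>[1,y,z]\<close>; the blocks through \<open>\<infinity>\<close> are the fibres \<open>z = const\<close>.
\<close>

locale affine_unital = field_conj +
  fixes q :: nat and \<mu> :: 'a and A :: "('a \<times> 'a) set"
  assumes q: "q \<ge> 2" and \<mu>: "\<mu> \<notin> R"
    and finite_A: "finite A" and card_A: "card A = q ^ 3"
    and on_unital: "(y, z) \<in> A \<Longrightarrow> y - \<mu> * (z * \<sigma> z) \<in> R"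
    and card_fibre: "(y, z) \<in> A \<Longrightarrow> card {y'. (y', z) \<in> A} = q"
    and card_line: "(y1, z1) \<in> A \<Longrightarrow> (y2, z2) \<in> A \<Longrightarrow> z1 \<noteq> z2 \<Longrightarrow>
      card {p \<in> A. (fst p - y1) * (z2 - z1) = (y2 - y1) * (snd p - z1)} = q + 1"
begin

definition fibre :: "'a \<Rightarrow> 'a set" where "fibre z = {y. (y, z) \<in> A}"

lemma finite_fibre [simp]: "finite (fibre z)"
  by (rule finite_subset[of _ "fst ` A"]) (use finite_A in \<open>force simp: fibre_def\<close>)+

lemma card_fibre': "z \<in> snd ` A \<Longrightarrow> card (fibre z) = q"
  using card_fibre by (auto simp: fibre_def)

lemma card_fibres: "card (snd ` A) = q^2"
proof -
  have "A = prod.swap ` (SIGMA z:snd ` A. fibre z)"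
    by (force simp: fibre_def)
  then have "card A = card (SIGMA z:snd ` A. fibre z)"
    by (metis card_image inj_swap)
  also have "\<dots> = card (snd ` A) * q"
    using finite_A card_fibre' by (simp add: card_SigmaI)
  finally have "card (snd ` A) * q = q^3" using card_A by (simp only:)
  then have "card (snd ` A) * q = q^2 * q" by (simp only: power3_eq_cube power2_eq_square)
  then have "card (snd ` A) = q^2 \<or> q = 0" by (simp only: mult_cancel2)
  then show ?thesis using q by simp
qed

lemma other_fibre: "\<exists>y' z'. (y', z') \<in> A \<and> z' \<noteq> z"
proof (rule ccontr)
  assume "\<not> ?thesis"
  then have "snd ` A \<subseteq> {z}" by force
  then have "card (snd ` A) \<le> card {z}" by (intro card_mono) auto
  moreover have "q * 1 < q * q" using q by (intro mult_strict_left_mono) auto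
  ultimately show False using card_fibres q by (simp add: power2_eq_square)
qed

lemma line_inj:
  assumes "z1 \<noteq> z2"
  shows "inj_on snd {p \<in> A. (fst p - y1) * (z2 - z1) = (y2 - y1) * (snd p - z1)}"
proof (rule inj_onI)
  fix p p' assume p: "p \<in> {p \<in> A. (fst p - y1) * (z2 - z1) = (y2 - y1) * (snd p - z1)}"
    and p': "p' \<in> {p \<in> A. (fst p - y1) * (z2 - z1) = (y2 - y1) * (snd p - z1)}"
    and s: "snd p = snd p'"
  then have "(fst p - y1) * (z2 - z1) = (fst p' - y1) * (z2 - z1)" by simp
  then have "fst p = fst p'" using assms by simp
  with s show "p = p'" by (simp add: prod_eq_iff)
qed

text \<open>
  Each difference \<open>y' - y\<close> of heights in two fibres is the slope (up to a constant) of lines which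
  meet \<open>q - 1\<close> further fibres, and by \<open>slope_rigid\<close> different differences use disjoint sets of
  further fibres. As only \<open>q\<^sup>2 - 2\<close> fibres are left, there are at most \<open>q\<close> differences.
\<close>

lemma card_differences:
  assumes "z1 \<in> snd ` A" "z2 \<in> snd ` A" "z1 \<noteq> z2"
  shows "card {y2 - y1 | y1 y2. y1 \<in> fibre z1 \<and> y2 \<in> fibre z2} \<le> q"
proof -
  let ?D = "{y2 - y1 | y1 y2. y1 \<in> fibre z1 \<and> y2 \<in> fibre z2}"
  have "?D = (\<lambda>(y1, y2). y2 - y1) ` (fibre z1 \<times> fibre z2)" by auto
  then have finD: "finite ?D" by simp
  define P where "P \<delta> = (SOME p. fst p \<in> fibre z1 \<and> snd p \<in> fibre z2 \<and> \<delta> = snd p - fst p)" for \<delta>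
  have P: "fst (P \<delta>) \<in> fibre z1" "snd (P \<delta>) \<in> fibre z2" "snd (P \<delta>) - fst (P \<delta>) = \<delta>" if "\<delta> \<in> ?D" for \<delta>
  proof -
    from that have "\<exists>p. fst p \<in> fibre z1 \<and> snd p \<in> fibre z2 \<and> \<delta> = snd p - fst p" by auto
    from someI_ex[OF this] show "fst (P \<delta>) \<in> fibre z1" "snd (P \<delta>) \<in> fibre z2" "snd (P \<delta>) - fst (P \<delta>) = \<delta>"
      unfolding P_def by auto
  qed
  define L where "L \<delta> = {p \<in> A. (fst p - fst (P \<delta>)) * (z2 - z1) = (snd (P \<delta>) - fst (P \<delta>)) * (snd p - z1)}" for \<delta>
  define M where "M \<delta> = snd ` L \<delta> - {z1, z2}" for \<delta>
  have card_M: "card (M \<delta>) = q - 1" if "\<delta> \<in> ?D" for \<delta>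
  proof -
    have a: "(fst (P \<delta>), z1) \<in> A" "(snd (P \<delta>), z2) \<in> A" using P[OF that] by (auto simp: fibre_def)
    have "card (L \<delta>) = q + 1" unfolding L_def using card_line[OF a assms(3)] .
    moreover have "inj_on snd (L \<delta>)" unfolding L_def by (rule line_inj[OF assms(3)])
    ultimately have c: "card (snd ` L \<delta>) = q + 1" by (simp add: card_image)
    have "(fst (P \<delta>), z1) \<in> L \<delta>" "(snd (P \<delta>), z2) \<in> L \<delta>" using a by (auto simp: L_def)
    then have "{z1, z2} \<subseteq> snd ` L \<delta>" by force
    then have "card (M \<delta>) = q + 1 - card {z1, z2}"
      unfolding M_def using c by (subst card_Diff_subset) auto
    then show ?thesis using assms(3) by simp
  qed
  have fin_M: "finite (M \<delta>)" for \<delta> using finite_A by (simp add: M_def L_def)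
  have disj: "M \<delta> \<inter> M \<delta>' = {}" if \<delta>: "\<delta> \<in> ?D" "\<delta>' \<in> ?D" "\<delta> \<noteq> \<delta>'" for \<delta> \<delta>'
  proof (rule ccontr)
    assume "M \<delta> \<inter> M \<delta>' \<noteq> {}"
    then obtain y3 y3' z3 where z3: "z3 \<noteq> z1" "z3 \<noteq> z2" "(y3, z3) \<in> L \<delta>" "(y3', z3) \<in> L \<delta>'"
      by (auto simp: M_def)
    have "snd (P \<delta>') - fst (P \<delta>') = snd (P \<delta>) - fst (P \<delta>)"
      by (rule slope_rigid[OF \<mu>, of _ z1 _ z2 y3 z3 _ _ y3'])
        (use z3 P[OF \<delta>(1)] P[OF \<delta>(2)] assms(3) on_unital in \<open>auto simp: L_def fibre_def\<close>)
    then show False using P(3)[OF \<delta>(1)] P(3)[OF \<delta>(2)] \<delta>(3) by simp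
  qed
  have "card ?D * (q - 1) = (\<Sum>\<delta>\<in>?D. card (M \<delta>))" using card_M by simp
  also have "\<dots> = card (\<Union>\<delta>\<in>?D. M \<delta>)"
    by (rule card_UN_disjoint[symmetric]) (use finD fin_M disj in auto)
  also have "\<dots> \<le> card (snd ` A - {z1, z2})"
    by (rule card_mono) (use finite_A in \<open>auto simp: M_def L_def\<close>)
  also have "\<dots> = q^2 - 2"
    using assms card_fibres by (subst card_Diff_subset) auto
  finally have le: "card ?D * (q - 1) \<le> q^2 - 2" .
  show ?thesis
  proof (rule ccontr)
    assume "\<not> ?thesis"
    \<comment> \<open>\<open>q + 1\<close> differences would use up \<open>q\<^sup>2 - 1\<close> fibres\<close>
    then have "(q + 1) * (q - 1) \<le> card ?D * (q - 1)" by (intro mult_right_mono) auto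
    moreover have "(q + 1) * (q - 1) = q^2 - 1"
      using q by (cases q) (auto simp: power2_eq_square)
    moreover have "q^2 \<ge> 4" using power_mono[of 2 q 2] q by simp
    ultimately show False using le by linarith
  qed
qed

text \<open>
  As \<open>Y - X\<close> has only \<open>q\<close> elements for the sets \<open>X\<close>, \<open>Y\<close> of heights in two fibres, it equals \<open>Y - x\<close>
  for every \<open>x\<close> in \<open>X\<close>; hence differences of elements of \<open>X\<close> act on \<open>Y\<close> by translation.
\<close>

lemma translate_other_fibre:
  assumes "(y, z) \<in> A" "(y', z) \<in> A" "(w, x) \<in> A" "x \<noteq> z"
  shows "(w + (y' - y), x) \<in> A"
proof -
  let ?D = "{y2 - y1 | y1 y2. y1 \<in> fibre z \<and> y2 \<in> fibre x}"
  have zx: "z \<in> snd ` A" "x \<in> snd ` A" using assms by force+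
  have "?D = (\<lambda>(y1, y2). y2 - y1) ` (fibre z \<times> fibre x)" by auto
  then have finD: "finite ?D" by simp
  have "(\<lambda>w. w - y') ` fibre x = ?D"
  proof (rule card_seteq[OF finD])
    show "(\<lambda>w. w - y') ` fibre x \<subseteq> ?D" using assms by (auto simp: fibre_def)
    have "card ((\<lambda>w. w - y') ` fibre x) = q"
      using card_fibre'[OF zx(2)] by (subst card_image) auto
    then show "card ?D \<le> card ((\<lambda>w. w - y') ` fibre x)"
      using card_differences[OF zx] assms(4) by simp
  qed
  moreover have "w - y \<in> ?D" using assms by (auto simp: fibre_def)
  ultimately obtain w' where "w' \<in> fibre x" "w - y = w' - y'" by auto
  then have "w' = w + (y' - y)" by (simp add: algebra_simps)
  then show ?thesis using \<open>w' \<in> fibre x\<close> by (simp add: fibre_def)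
qed

text \<open>
  For two points of the same fibre the difference is first carried to a different fibre and from there
  back, so that \<open>translate_other_fibre\<close> applies twice.
\<close>

lemma translate:
  assumes "(y, z) \<in> A" "(y', z) \<in> A" "(w, x) \<in> A"
  shows "(w + (y' - y), x) \<in> A"
proof (cases "x = z")
  case True
  obtain v t where vt: "(v, t) \<in> A" "t \<noteq> z" using other_fibre by blast
  have "(v + (y' - y), t) \<in> A" by (rule translate_other_fibre) (use assms vt in auto)
  from translate_other_fibre[OF vt(1) this assms(3)] show ?thesis using True vt by auto
qed (use assms translate_other_fibre in blast)

lemma third_on_line:
  assumes "(y1, z1) \<in> A" "(y2, z2) \<in> A" "z1 \<noteq> z2"
  shows "\<exists>y3 z3. (y3, z3) \<in> A \<and> z3 \<noteq> z1 \<and> z3 \<noteq> z2 \<and> (y3 - y1) * (z2 - z1) = (y2 - y1) * (z3 - z1)"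
proof (rule ccontr)
  assume no: "\<not> ?thesis"
  let ?L = "{p \<in> A. (fst p - y1) * (z2 - z1) = (y2 - y1) * (snd p - z1)}"
  have "snd ` ?L \<subseteq> {z1, z2}" using no by force
  then have "card (snd ` ?L) \<le> card {z1, z2}" by (intro card_mono) auto
  also have "\<dots> = 2" using assms(3) by simp
  finally show False using card_line[OF assms] card_image[OF line_inj[OF assms(3)], of y1 y2] q
    by simp
qed

end

text \<open>
  Translations are intrinsic: if an isomorphism \<open>\<phi>\<close> fixes the centre \<open>\<infinity>\<close>, then \<open>\<phi>\<close> conjugates a
  translation to a map that preserves the fibres and maps lines to lines, and \<open>slope_rigid\<close> shows
  that it moves any two points in different fibres by the same amount.
\<close>

lemma translation_conjugate:
  fixes \<phi> :: "'a::field \<times> 'a \<Rightarrow> 'a \<times> 'a"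
  assumes A1: "affine_unital R \<sigma> q1 \<mu>1 A1" and A2: "affine_unital R \<sigma> q2 \<mu>2 A2"
    and \<phi>: "\<And>p. p \<in> A1 \<Longrightarrow> \<phi> p \<in> A2"
    and fib: "\<And>p p'. p \<in> A1 \<Longrightarrow> p' \<in> A1 \<Longrightarrow> snd (\<phi> p) = snd (\<phi> p') \<longleftrightarrow> snd p = snd p'"
    and col: "\<And>p1 p2 p3. p1 \<in> A1 \<Longrightarrow> p2 \<in> A1 \<Longrightarrow> p3 \<in> A1 \<Longrightarrow>
      (fst p3 - fst p1) * (snd p2 - snd p1) = (fst p2 - fst p1) * (snd p3 - snd p1) \<Longrightarrow>
      (fst (\<phi> p3) - fst (\<phi> p1)) * (snd (\<phi> p2) - snd (\<phi> p1)) =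
      (fst (\<phi> p2) - fst (\<phi> p1)) * (snd (\<phi> p3) - snd (\<phi> p1))"
    and yz: "(y, z) \<in> A1" "(y', z) \<in> A1"
  shows "\<exists>g. \<forall>w x. (w, x) \<in> A1 \<longrightarrow>
    \<phi> (w + (y' - y), x) = (fst (\<phi> (w, x)) + g, snd (\<phi> (w, x)))"
proof -
  interpret A1: affine_unital R \<sigma> q1 \<mu>1 A1 by fact
  interpret A2: affine_unital R \<sigma> q2 \<mu>2 A2 by fact
  let ?s = "\<lambda>p. (fst p + (y' - y), snd p)"
  define c where "c p = fst (\<phi> (?s p)) - fst (\<phi> p)" for p
  have s: "?s p \<in> A1" if "p \<in> A1" for p
    using A1.translate[OF yz, of "fst p" "snd p"] that by simp
  have snd_s: "snd (\<phi> (?s p)) = snd (\<phi> p)" if "p \<in> A1" for p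
    using fib[OF s[OF that] that] by simp
  have on2: "fst (\<phi> p) - \<mu>2 * (snd (\<phi> p) * \<sigma> (snd (\<phi> p))) \<in> R" if "p \<in> A1" for p
    using A2.on_unital[of "fst (\<phi> p)" "snd (\<phi> p)"] \<phi>[OF that] by simp
  have const: "c p1 = c p2" if p: "p1 \<in> A1" "p2 \<in> A1" "snd p1 \<noteq> snd p2" for p1 p2
  proof -
    obtain y3 z3 where 3: "(y3, z3) \<in> A1" "z3 \<noteq> snd p1" "z3 \<noteq> snd p2"
      "(y3 - fst p1) * (snd p2 - snd p1) = (fst p2 - fst p1) * (z3 - snd p1)"
      using A1.third_on_line[of "fst p1" "snd p1" "fst p2" "snd p2"] p by auto
    define p3 where "p3 = (y3, z3)"
    have p3: "p3 \<in> A1" "snd p3 \<noteq> snd p1" "snd p3 \<noteq> snd p2"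
      "(fst p3 - fst p1) * (snd p2 - snd p1) = (fst p2 - fst p1) * (snd p3 - snd p1)"
      using 3 by (simp_all add: p3_def)
    have on2': "fst (\<phi> (?s p)) - \<mu>2 * (snd (\<phi> p) * \<sigma> (snd (\<phi> p))) \<in> R" if "p \<in> A1" for p
      using on2[OF s[OF that]] snd_s[OF that] by simp
    have "fst (\<phi> (?s p2)) - fst (\<phi> (?s p1)) = fst (\<phi> p2) - fst (\<phi> p1)"
    proof (rule A1.slope_rigid[OF A2.\<mu> on2[OF p(1)] on2[OF p(2)] on2[OF p3(1)]
          on2'[OF p(1)] on2'[OF p(2)] on2'[OF p3(1)]])
      show "snd (\<phi> p1) \<noteq> snd (\<phi> p2)" "snd (\<phi> p1) \<noteq> snd (\<phi> p3)" "snd (\<phi> p2) \<noteq> snd (\<phi> p3)"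
        using fib[OF p(1,2)] fib[OF p(1) p3(1)] fib[OF p(2) p3(1)] p(3) p3(2,3) by auto
      show "(fst (\<phi> p3) - fst (\<phi> p1)) * (snd (\<phi> p2) - snd (\<phi> p1)) =
        (fst (\<phi> p2) - fst (\<phi> p1)) * (snd (\<phi> p3) - snd (\<phi> p1))"
        using col[OF p(1,2) p3(1,4)] .
      show "(fst (\<phi> (?s p3)) - fst (\<phi> (?s p1))) * (snd (\<phi> p2) - snd (\<phi> p1)) =
        (fst (\<phi> (?s p2)) - fst (\<phi> (?s p1))) * (snd (\<phi> p3) - snd (\<phi> p1))"
        using col[OF s[OF p(1)] s[OF p(2)] s[OF p3(1)]] p3(4)
        by (simp add: snd_s p p3)
    qed
    then show ?thesis by (simp add: c_def algebra_simps)
  qed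
  have "c p = c (y, z)" if "p \<in> A1" for p
  proof (cases "snd p = z")
    case True
    obtain v t where vt: "(v, t) \<in> A1" "t \<noteq> z" using A1.other_fibre by blast
    have "c p = c (v, t)" using const[OF that vt(1)] vt True by simp
    also have "\<dots> = c (y, z)" using const[OF vt(1) yz(1)] vt by simp
    finally show ?thesis .
  next
    case False
    then show ?thesis using const[OF that yz(1)] by simp
  qed
  then have "\<phi> (w + (y' - y), x) = (fst (\<phi> (w, x)) + c (y, z), snd (\<phi> (w, x)))"
    if "(w, x) \<in> A1" for w x
    using that snd_s[OF that] by (auto simp: prod_eq_iff c_def diff_eq_eq add.commute)
  then show ?thesis by blast
qed

section \<open>Points and collinearity in the projective plane\<close>

abbreviation pt :: "'c::field \<Rightarrow> 'c \<Rightarrow> 'c \<Rightarrow> ('c^3) set" where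
  "pt x y z \<equiv> proj_point UNIV (vector [x, y, z])"

definition det3 :: "'c::field^3 \<Rightarrow> 'c^3 \<Rightarrow> 'c^3 \<Rightarrow> 'c" where
  "det3 u v w = u$1 * (v$2 * w$3 - v$3 * w$2) - u$2 * (v$1 * w$3 - v$3 * w$1)
    + u$3 * (v$1 * w$2 - v$2 * w$1)"

text \<open>
  Stated for all representing vectors, so that it applies to points of the plane over any subfield.
\<close>

definition col :: "('c::field^3) set \<Rightarrow> ('c^3) set \<Rightarrow> ('c^3) set \<Rightarrow> bool" where
  "col P Q S \<longleftrightarrow> (\<forall>u\<in>P. \<forall>v\<in>Q. \<forall>w\<in>S. det3 u v w = 0)"

lemma vec3_eq_iff: "u = v \<longleftrightarrow> u$1 = v$1 \<and> u$2 = v$2 \<and> u$3 = (v$3 :: 'c)" for u v :: "'c^3"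
  by (simp add: vec_eq_iff forall_3)

lemma vector3_eta: "v = vector [v$1, v$2, v$3]" for v :: "'c::zero^3"
  by (simp add: vec3_eq_iff)

lemma vector3_eq_0_iff: "vector [x, y, z] = (0 :: 'c::zero^3) \<longleftrightarrow> x = 0 \<and> y = 0 \<and> z = 0"
  by (simp add: vec3_eq_iff)

lemma smult_vector3: "k *s (vector [x, y, z] :: 'c::field^3) = vector [k * x, k * y, k * z]"
  by (simp add: vec3_eq_iff)

lemma det3_smult: "det3 (a *s u) (b *s v) (c *s w) = a * b * c * det3 u v w"
  by (simp add: det3_def algebra_simps)

lemma col_proj_point:
  assumes "is_subfield K"
  shows "col (proj_point K u) (proj_point K v) (proj_point K w) \<longleftrightarrow> det3 u v w = 0"
proof
  assume c: "col (proj_point K u) (proj_point K v) (proj_point K w)"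
  have "x \<in> proj_point K x" for x :: "'a^3"
    unfolding proj_point_def using subfield_closed(2)[OF assms] by (force intro: exI[of _ 1])
  then show "det3 u v w = 0" using c unfolding col_def by blast
qed (auto simp: col_def proj_point_def det3_smult)

lemma subfield_UNIV [simp]: "is_subfield UNIV"
  by (simp add: is_subfield_def)

lemma col_pt: "col (pt a b c) (pt d e f) (pt g h i) \<longleftrightarrow>
    a * (e * i - f * h) - b * (d * i - f * g) + c * (d * h - e * g) = 0"
  by (simp add: col_proj_point det3_def)

lemma proj_point_scale:
  assumes "is_subfield K" "k \<in> K" "k \<noteq> 0"
  shows "proj_point K (k *s v) = proj_point K v"
proof -
  have "l *s v = (l / k) *s (k *s v)" for l using assms by (simp add: vector_smult_assoc)
  then have "proj_point K v \<subseteq> proj_point K (k *s v)"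
    unfolding proj_point_def using subfield_closed(8)[OF assms(1) _ assms(2)] by blast
  moreover have "proj_point K (k *s v) \<subseteq> proj_point K v"
    unfolding proj_point_def using subfield_closed(4)[OF assms(1) _ assms(2)]
    by (auto simp: vector_smult_assoc)
  ultimately show ?thesis by simp
qed

lemma proj_point_eqD:
  assumes "is_subfield K" "proj_point K v = proj_point K w"
  shows "\<exists>k\<in>K. v = k *s w"
proof -
  have "v \<in> proj_point K v"
    unfolding proj_point_def using subfield_closed(2)[OF assms(1)] by (force intro: exI[of _ 1])
  then show ?thesis using assms(2) by (auto simp: proj_point_def)
qed

lemma pt_scale: "k \<noteq> 0 \<Longrightarrow> pt (k * x) (k * y) (k * z) = pt x y z"
  using proj_point_scale[OF subfield_UNIV, of k "vector [x, y, z]"] by (simp add: smult_vector3)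

lemma pt_eqD: "pt x y z = pt x' y' z' \<Longrightarrow> \<exists>k. x = k * x' \<and> y = k * y' \<and> z = k * z'"
  using proj_point_eqD[OF subfield_UNIV, of "vector [x, y, z]" "vector [x', y', z']"]
  by (auto simp: smult_vector3 vec3_eq_iff)

lemma pt_affine: "x \<noteq> 0 \<Longrightarrow> pt x y z = pt 1 (y / x) (z / x)"
  using pt_scale[of x 1 "y / x" "z / x"] by simp

lemma pt_1_eq_iff [simp]: "pt 1 y z = pt 1 y' z' \<longleftrightarrow> y = y' \<and> z = z'"
  by (auto dest: pt_eqD)

lemma pt_1_neq_inf [simp]: "pt 1 y z \<noteq> pt 0 1 0" "pt 0 1 0 \<noteq> pt 1 y z"
  by (auto dest: pt_eqD)

lemma col_affine:
  "col (pt 1 y1 z1) (pt 1 y2 z2) (pt 1 y z) \<longleftrightarrow> (y - y1) * (z2 - z1) = (y2 - y1) * (z - z1)"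
proof -
  have "1 * (y2 * z - z2 * y) - y1 * (1 * z - z2 * 1) + z1 * (1 * y - y2 * 1)
      = (y2 - y1) * (z - z1) - (y - y1) * (z2 - z1)"
    by (simp add: algebra_simps)
  then show ?thesis unfolding col_pt by auto
qed

lemma col_affine_inf: "col (pt 1 y1 z1) (pt 1 y2 z2) (pt 0 1 0) \<longleftrightarrow> z1 = z2"
  by (auto simp: col_pt)

lemma col_inf_affine: "col (pt 0 1 0) (pt 1 y z) (pt 1 y' z') \<longleftrightarrow> z' = z"
  by (auto simp: col_pt)

lemma col_refl: "col (proj_point K u) (proj_point K v) (proj_point K u)"
  by (auto simp: col_def proj_point_def det3_smult) (simp add: det3_def algebra_simps)

lemma proj_pointsE:
  assumes "P \<in> proj_points UNIV"
  obtains x y z where "P = pt x y z" "x \<noteq> 0 \<or> y \<noteq> 0 \<or> z \<noteq> 0"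
proof -
  obtain v where v: "P = proj_point UNIV v" "v \<noteq> 0" using assms by (auto simp: proj_points_def)
  show ?thesis
  proof (rule that)
    show "P = pt (v$1) (v$2) (v$3)" using v(1) vector3_eta[of v] by simp
    show "v$1 \<noteq> 0 \<or> v$2 \<noteq> 0 \<or> v$3 \<noteq> 0" using v(2) by (simp add: vec3_eq_iff)
  qed
qed

definition act :: "'c::field^3^3 \<Rightarrow> ('c^3) set \<Rightarrow> ('c^3) set" where
  "act M P = (\<lambda>w. M *v w) ` P"

lemma act_proj_point: "act M (proj_point K v) = proj_point K (M *v v)"
  by (simp add: act_def proj_point_def Setcompr_eq_image image_image vector_scalar_commute)

lemma act_act: "act M (act M' P) = act (M ** M') P"
  by (auto simp: act_def image_image matrix_vector_mul_assoc)

lemma act_mat_1 [simp]: "act (mat 1) P = P"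
  by (simp add: act_def)

text \<open>
  The library's product rule for determinants, applied to the matrix whose rows are the images.
\<close>

lemma det3_matrix: "det3 (M *v u) (M *v v) (M *v w) = det M * det3 u v w"
proof -
  have det3: "det3 a b c = det (vector [a, b, c] :: 'a^3^3)" for a b c :: "'a^3"
    by (simp add: det3_def det_3 algebra_simps)
  have "(vector [M *v u, M *v v, M *v w] :: 'a^3^3) = vector [u, v, w] ** transpose M"
    by (simp add: vec_eq_iff forall_3 matrix_matrix_mult_def matrix_vector_mult_def transpose_def sum_3 mult.commute)
  then show ?thesis by (simp add: det3 det_mul det_transpose mult.commute)
qed

lemma act_col:
  assumes "invertible M"
  shows "col (act M P) (act M Q) (act M S) \<longleftrightarrow> col P Q S"
  using assms by (simp add: col_def act_def det3_matrix invertible_det_nz)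

lemma invertible_matrix_inv:
  assumes "invertible (M :: 'c::field^3^3)"
  shows "invertible (matrix_inv M)" "M ** matrix_inv M = mat 1" "matrix_inv M ** M = mat 1"
proof -
  show "M ** matrix_inv M = mat 1" "matrix_inv M ** M = mat 1"
    using someI_ex[of "\<lambda>A'. M ** A' = mat 1 \<and> A' ** M = mat 1"] assms
    unfolding invertible_def matrix_inv_def by auto
  then show "invertible (matrix_inv M)" unfolding invertible_def by blast
qed

lemma act_inv:
  assumes "invertible M"
  shows "act M (act (matrix_inv M) P) = P" "act (matrix_inv M) (act M P) = P"
  using invertible_matrix_inv[OF assms] by (simp_all add: act_act)

lemma inj_act: "invertible M \<Longrightarrow> inj (act M)"
  by (metis act_inv(2) injI)

definition mat3 :: "'c::field \<Rightarrow> 'c \<Rightarrow> 'c \<Rightarrow> 'c \<Rightarrow> 'c \<Rightarrow> 'c \<Rightarrow> 'c \<Rightarrow> 'c \<Rightarrow> 'c \<Rightarrow> 'c^3^3" where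
  "mat3 a b c d e f g h i = vector [vector [a, b, c], vector [d, e, f], vector [g, h, i]]"

lemma mat3_mult_vec:
  "mat3 a b c d e f g h i *v v = vector
    [a * v$1 + b * v$2 + c * v$3, d * v$1 + e * v$2 + f * v$3, g * v$1 + h * v$2 + i * v$3]"
  by (simp add: vec3_eq_iff mat3_def matrix_vector_mult_def sum_3)

lemma act_mat3: "act (mat3 a b c d e f g h i) (pt x y z) =
    pt (a * x + b * y + c * z) (d * x + e * y + f * z) (g * x + h * y + i * z)"
  by (simp add: act_proj_point mat3_mult_vec)

lemma invertible_mat3:
  "invertible (mat3 a b c d e f g h i) \<longleftrightarrow>
    a * (e * i - f * h) - b * (d * i - f * g) + c * (d * h - e * g) \<noteq> 0"
  by (simp add: invertible_det_nz det_3 mat3_def algebra_simps)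

lemma act_proj_points:
  assumes "invertible M" "P \<in> proj_points UNIV"
  shows "act M P \<in> proj_points UNIV"
proof -
  obtain v where v: "P = proj_point UNIV v" "v \<noteq> 0" using assms(2) by (auto simp: proj_points_def)
  have "M *v v \<noteq> 0"
  proof
    assume 0: "M *v v = 0"
    have "v = matrix_inv M *v (M *v v)"
      by (simp add: matrix_vector_mul_assoc invertible_matrix_inv(3)[OF assms(1)])
    then show False using 0 v(2) by simp
  qed
  then show ?thesis using v by (auto simp: proj_points_def act_proj_point vecs3_def)
qed

section \<open>Unitals in the projective plane\<close>

text \<open>
  A unital given by its points alone: the blocks are the intersections with lines.
\<close>

definition unital_set :: "nat \<Rightarrow> ('c::field^3) set set \<Rightarrow> bool" where
  "unital_set q U \<longleftrightarrow> q \<ge> 2 \<and> U \<subseteq> proj_points UNIV \<and> finite U \<and> card U = q^3 + 1 \<and>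
    (\<forall>P\<in>U. \<forall>Q\<in>U. P \<noteq> Q \<longrightarrow> card {S \<in> U. col P Q S} = q + 1)"

definition col_iso :: "(('c::field^3) set \<Rightarrow> ('d::field^3) set) \<Rightarrow> ('c^3) set set \<Rightarrow> ('d^3) set set \<Rightarrow> bool" where
  "col_iso \<theta> U U' \<longleftrightarrow> bij_betw \<theta> U U' \<and>
    (\<forall>P\<in>U. \<forall>Q\<in>U. \<forall>S\<in>U. col (\<theta> P) (\<theta> Q) (\<theta> S) \<longleftrightarrow> col P Q S)"

lemma col_iso_act: "invertible M \<Longrightarrow> col_iso (act M) U (act M ` U)"
  unfolding col_iso_def
  by (simp add: act_col) (rule inj_on_imp_bij_betw[OF inj_on_subset[OF inj_act]], simp_all)

lemma col_iso_comp: "col_iso \<theta> U U' \<Longrightarrow> col_iso \<theta>' U' U'' \<Longrightarrow> col_iso (\<theta>' \<circ> \<theta>) U U''"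
  unfolding col_iso_def by (simp add: bij_betw_trans[of \<theta> U U' \<theta>'] bij_betw_apply[of \<theta> U U'])

lemma col_iso_unital_set:
  assumes "col_iso \<theta> U U'" "unital_set q U" "U' \<subseteq> proj_points UNIV"
  shows "unital_set q U'"
proof -
  have bij: "bij_betw \<theta> U U'" using assms(1) by (simp add: col_iso_def)
  have "card {S' \<in> U'. col P' Q' S'} = q + 1" if P': "P' \<in> U'" "Q' \<in> U'" "P' \<noteq> Q'" for P' Q'
  proof -
    have surj: "\<theta> ` U = U'" by (rule bij_betw_imp_surj_on[OF bij])
    obtain P where P: "P \<in> U" "P' = \<theta> P" using P'(1) surj by blast
    obtain Q where Q: "Q \<in> U" "Q' = \<theta> Q" using P'(2) surj by blast
    have "col P' Q' (\<theta> S) \<longleftrightarrow> col P Q S" if "S \<in> U" for S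
      using assms(1) P Q that by (simp add: col_iso_def)
    then have "{S' \<in> U'. col P' Q' S'} = \<theta> ` {S \<in> U. col P Q S}"
      unfolding surj[symmetric] by blast
    moreover have "inj_on \<theta> {S \<in> U. col P Q S}"
      by (rule inj_on_subset[OF bij_betw_imp_inj_on[OF bij]]) blast
    ultimately have "card {S' \<in> U'. col P' Q' S'} = card {S \<in> U. col P Q S}"
      by (simp add: card_image)
    then show ?thesis using assms(2) P Q P'(3) by (auto simp: unital_set_def)
  qed
  moreover have "q \<ge> 2 \<and> finite U' \<and> card U' = q^3 + 1"
    using assms(2) bij_betw_same_card[OF bij] bij_betw_finite[OF bij] by (simp add: unital_set_def)
  ultimately show ?thesis using assms(3) by (simp add: unital_set_def)
qed

lemma unital_set_act:
  assumes "invertible M" "unital_set q U"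
  shows "unital_set q (act M ` U)"
  by (rule col_iso_unital_set[OF col_iso_act assms(2)])
    (use assms act_proj_points[OF assms(1)] in \<open>auto simp: unital_set_def image_subset_iff\<close>)

context field_conj
begin

text \<open>
  For \<open>\<mu> = -1/\<epsilon>\<close> this is the image of the generalized hermitian unital under division of \<open>Y\<close> by \<open>\<epsilon>\<close>.
  The parameter \<open>\<mu>\<close> is kept free because changes of coordinates alter it: interchanging \<open>X\<close> and
  \<open>Y\<close> replaces \<open>\<mu>\<close> by \<open>\<mu>\<^sup>\<sigma>\<close>, and a diagonal matrix multiplies it by an element of \<open>R\<close>.
\<close>

definition Hm :: "'c \<Rightarrow> ('c^3) set set" where
  "Hm \<mu> = {pt x y z | x y z. (x \<noteq> 0 \<or> y \<noteq> 0 \<or> z \<noteq> 0) \<and> \<sigma> x * y - \<mu> * N z \<in> R}"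

lemma pt_in_HmI: "x \<noteq> 0 \<or> y \<noteq> 0 \<or> z \<noteq> 0 \<Longrightarrow> \<sigma> x * y - \<mu> * N z \<in> R \<Longrightarrow> pt x y z \<in> Hm \<mu>"
  by (auto simp: Hm_def)

lemma pt_in_HmD:
  assumes "pt x y z \<in> Hm \<mu>"
  shows "\<sigma> x * y - \<mu> * N z \<in> R"
proof -
  obtain x' y' z' where e: "pt x y z = pt x' y' z'" "\<sigma> x' * y' - \<mu> * N z' \<in> R"
    using assms by (auto simp: Hm_def)
  obtain k where "x = k * x'" "y = k * y'" "z = k * z'" using pt_eqD[OF e(1)] by auto
  then have "\<sigma> x * y - \<mu> * N z = N k * (\<sigma> x' * y' - \<mu> * N z')"
    by (simp add: conj_mult algebra_simps)
  then show ?thesis using e(2) norm_in[of k] R_closed(4) by simp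
qed

text \<open>
  If \<open>X = 0\<close>, then \<open>\<mu> N(Z) \<in> R\<close> with \<open>N(Z) \<in> R\<close>, which forces \<open>Z = 0\<close>.
\<close>

lemma Hm_cases:
  assumes "\<mu> \<notin> R" "P \<in> Hm \<mu>"
  obtains "P = pt 0 1 0" | y z where "P = pt 1 y z" "y - \<mu> * N z \<in> R"
proof -
  obtain x y z where P: "P = pt x y z" "x \<noteq> 0 \<or> y \<noteq> 0 \<or> z \<noteq> 0" "\<sigma> x * y - \<mu> * N z \<in> R"
    using assms by (auto simp: Hm_def)
  show thesis
  proof (cases "x = 0")
    case True
    then have "\<mu> * - N z \<in> R" using P by simp
    then have "z = 0"
      using subfield_multiple_outside[OF R assms(1), of "- N z"] norm_in R_closed(5) by auto
    then have "P = pt 0 1 0" using pt_scale[of y 0 1 0] P True by simp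
    then show thesis by (rule that(1))
  next
    case False
    then have "P = pt 1 (y / x) (z / x)" using P pt_affine by simp
    moreover from this have "\<sigma> 1 * (y / x) - \<mu> * N (z / x) \<in> R"
      using assms(2) pt_in_HmD by blast
    ultimately show thesis using that(2) by simp
  qed
qed

end

locale pointed_unital = field_conj +
  fixes q :: nat and \<mu> :: 'a and U :: "('a^3) set set"
  assumes unital: "unital_set q U" and sub_Hm: "U \<subseteq> Hm \<mu>" and \<mu>: "\<mu> \<notin> R"
    and inf_in: "pt 0 1 0 \<in> U"
begin

definition affine :: "('a \<times> 'a) set" where "affine = {(y, z). pt 1 y z \<in> U}"

lemma point_cases:
  assumes "P \<in> U"
  obtains "P = pt 0 1 0" | y z where "P = pt 1 y z" "(y, z) \<in> affine"
proof -
  have "P \<in> Hm \<mu>" using assms sub_Hm by blast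
  from Hm_cases[OF \<mu> this] show thesis
  proof cases
    case 1
    then show thesis by (rule that(1))
  next
    case (2 y z)
    then show thesis using assms by (intro that(2)[of y z]) (auto simp: affine_def)
  qed
qed

abbreviation aff :: "'a \<times> 'a \<Rightarrow> ('a^3) set" where "aff p \<equiv> pt 1 (fst p) (snd p)"

lemma U_eq: "U = insert (pt 0 1 0) (aff ` affine)"
proof
  show "U \<subseteq> insert (pt 0 1 0) (aff ` affine)"
  proof
    fix P assume "P \<in> U"
    then show "P \<in> insert (pt 0 1 0) (aff ` affine)"
    proof (cases rule: point_cases)
      case (2 y z)
      then have "P = aff (y, z)" by simp
      then show ?thesis using 2(2) by blast
    qed simp
  qed
  show "insert (pt 0 1 0) (aff ` affine) \<subseteq> U" using inf_in by (auto simp: affine_def)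
qed

lemma U_filter: "{S \<in> U. \<Phi> S} =
    (if \<Phi> (pt 0 1 0) then {pt 0 1 0} else {}) \<union> aff ` {p \<in> affine. \<Phi> (aff p)}"
proof -
  have "{S \<in> insert a (f ` B). \<Phi> S} = (if \<Phi> a then {a} else {}) \<union> f ` {p \<in> B. \<Phi> (f p)}"
    for a f and B :: "('a \<times> 'a) set" by auto
  then show ?thesis by (subst U_eq)
qed

lemma inf_notin_aff: "pt 0 1 0 \<notin> aff ` B"
  by (simp add: image_iff)

lemma inj_aff: "inj aff"
  by (rule injI) (simp add: prod_eq_iff)

lemma card_aff: "card (aff ` B) = card B"
  by (rule card_image) (rule inj_on_subset[OF inj_aff], simp)

lemma finite_affine: "finite affine"
proof (rule finite_imageD)
  show "finite (aff ` affine)"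
    by (rule finite_subset[of _ U]) (use unital in \<open>auto simp: unital_set_def affine_def\<close>)
qed (rule inj_on_subset[OF inj_aff], simp)

sublocale affine: affine_unital R \<sigma> q \<mu> affine
proof
  show "2 \<le> q" "\<mu> \<notin> R" "finite affine"
    using unital \<mu> finite_affine by (auto simp: unital_set_def)
  have "q^3 + 1 = card U" using unital by (simp add: unital_set_def)
  also have "\<dots> = card (aff ` affine) + 1"
    by (subst U_eq, subst card_insert_disjoint) (use finite_affine inf_notin_aff in auto)
  finally show "card affine = q ^ 3" by (simp add: card_aff)
  show "y - \<mu> * N z \<in> R" if "(y, z) \<in> affine" for y z
    using pt_in_HmD[of 1 y z \<mu>] that sub_Hm by (auto simp: affine_def)
  have line: "card {S \<in> U. col P Q S} = q + 1" if "P \<in> U" "Q \<in> U" "P \<noteq> Q" for P Q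
    using unital that by (simp add: unital_set_def)
  show "card {y'. (y', z) \<in> affine} = q" if "(y, z) \<in> affine" for y z
  proof -
    let ?B = "{p \<in> affine. snd p = z}"
    have "{S \<in> U. col (pt 0 1 0) (pt 1 y z) S} = insert (pt 0 1 0) (aff ` ?B)"
      using col_refl[of UNIV "vector [0, 1, 0]" "vector [1, y, z]"]
      by (simp add: U_filter col_inf_affine)
    moreover have "card (insert (pt 0 1 0) (aff ` ?B)) = card ?B + 1"
    proof (subst card_insert_disjoint[OF _ inf_notin_aff])
      show "finite (aff ` ?B)" by (rule finite_imageI, rule finite_subset[OF _ finite_affine]) auto
      show "Suc (card (aff ` ?B)) = card ?B + 1" by (simp only: card_aff Suc_eq_plus1)
    qed
    moreover have "?B = (\<lambda>y'. (y', z)) ` {y'. (y', z) \<in> affine}" by force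
    then have "card ?B = card {y'. (y', z) \<in> affine}"
      by (simp add: card_image inj_on_def)
    ultimately show ?thesis
      using line[OF inf_in, of "pt 1 y z"] that by (simp add: affine_def)
  qed
  show "card {p \<in> affine. (fst p - y1) * (z2 - z1) = (y2 - y1) * (snd p - z1)} = q + 1"
    if "(y1, z1) \<in> affine" "(y2, z2) \<in> affine" "z1 \<noteq> z2" for y1 z1 y2 z2
  proof -
    have "{S \<in> U. col (pt 1 y1 z1) (pt 1 y2 z2) S} = aff `
        {p \<in> affine. (fst p - y1) * (z2 - z1) = (y2 - y1) * (snd p - z1)}"
      using that(3) by (simp add: U_filter col_affine col_affine_inf)
    then show ?thesis
      using line[of "pt 1 y1 z1" "pt 1 y2 z2"] that by (simp add: affine_def card_aff)
  qed
qed

end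

section \<open>Hua's identity and generation of \<open>SL\<^sub>2\<close>\<close>

lemma inverse_via_harmonic:
  assumes "x \<noteq> 0" "x \<noteq> (1::'c::field)"
  shows "inverse x = 1 - inverse (inverse (x - 1) + inverse 1)"
proof -
  have "x - 1 \<noteq> 0" using assms by simp
  then have "inverse (x - 1) + inverse 1 = x / (x - 1)" by (simp add: field_simps)
  then show ?thesis using assms by (simp add: field_simps)
qed

lemma hua_identity:
  assumes "a \<noteq> 0" "b \<noteq> 0" "a * b \<noteq> (1::'c::field)"
  shows "a * a * b = a - inverse (inverse a + inverse (inverse b - a))"
proof -
  have n: "1 - a * b \<noteq> 0" using assms by simp
  have "inverse b - a = (1 - a * b) / b" using assms by (simp add: field_simps)
  then have "inverse a + inverse (inverse b - a) = 1 / a + b / (1 - a * b)"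
    by (simp add: inverse_eq_divide)
  also have "\<dots> = (1 * (1 - a * b) + b * a) / (a * (1 - a * b))"
    using n assms(1) by (subst add_frac_eq) auto
  also have "\<dots> = 1 / (a * (1 - a * b))" by (simp add: algebra_simps)
  finally show ?thesis using n assms by (simp add: algebra_simps)
qed

lemma square_inj_char2:
  assumes "(2::'c::field) = 0" "a * a = b * (b::'c)"
  shows "a = b"
proof -
  have "(a - b) * (a - b) = a * a + b * b - 2 * (a * b)" by (simp add: algebra_simps)
  also have "\<dots> = 2 * (b * b) - 2 * (a * b)" using assms(2) by simp
  also have "\<dots> = 0" using assms(1) by simp
  finally show ?thesis by simp
qed

text \<open>
  An additive subgroup that contains \<open>1\<close> and whose inverses form an additive subgroup as well is
  closed under inversion, hence under \<open>(a, b) \<mapsto> a\<^sup>2b\<close> by Hua's identity. Products are obtained by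
  polarization, or in characteristic two from the fact that every element of a finite such set is
  a square.
\<close>

lemma hua_subfield:
  fixes G :: "'c::field set"
  assumes fin: "finite G" and 1: "1 \<in> G"
    and add: "\<And>a b. a \<in> G \<Longrightarrow> b \<in> G \<Longrightarrow> a + b \<in> G"
    and minus: "\<And>a. a \<in> G \<Longrightarrow> - a \<in> G"
    and harm: "\<And>a b. a \<in> G \<Longrightarrow> b \<in> G \<Longrightarrow> inverse (inverse a + inverse b) \<in> G"
  shows "is_subfield G"
proof -
  have diff: "a - b \<in> G" if "a \<in> G" "b \<in> G" for a b
    using add[OF that(1) minus[OF that(2)]] by simp
  have 0: "0 \<in> G" using diff[OF 1 1] by simp
  have inv: "inverse x \<in> G" if "x \<in> G" for x
  proof (cases "x = 0 \<or> x = 1")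
    case False
    then show ?thesis
      using inverse_via_harmonic[of x] diff[OF 1 harm[OF diff[OF that 1] 1]] by simp
  qed (use 0 1 in auto)
  have sq_mult: "a * a * b \<in> G" if "a \<in> G" "b \<in> G" for a b
  proof (cases "a = 0 \<or> b = 0 \<or> a * b = 1")
    case True
    then show ?thesis using 0 that by (auto simp: mult.assoc)
  next
    case False
    then show ?thesis
      using hua_identity[of a b] diff[OF that(1) harm[OF that(1) diff[OF inv[OF that(2)] that(1)]]]
      by simp
  qed
  have sq: "a * a \<in> G" if "a \<in> G" for a using sq_mult[OF that 1] by simp
  have mult: "a * b \<in> G" if ab: "a \<in> G" "b \<in> G" for a b
  proof (cases "(2::'c) = 0")
    case True
    have "inj_on (\<lambda>a. a * a) G" using square_inj_char2[OF True] by (auto intro: inj_onI)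
    then have "(\<lambda>a. a * a) ` G = G" by (intro endo_inj_surj[OF fin]) (use sq in auto)
    then obtain c where "c \<in> G" "a = c * c" using ab(1) by auto
    then show ?thesis using sq_mult[of c b] ab(2) by simp
  next
    case False
    have "2 * (a * b) = (a + b) * (a + b) - a * a - b * b" by (simp add: algebra_simps)
    then have "2 * (a * b) \<in> G" using diff sq add ab by simp
    then have "2 * (a * b) + 2 * (a * b) \<in> G" by (intro add)
    moreover have "inverse 2 \<in> G" using inv[OF add[OF 1 1]] by simp
    ultimately have "inverse 2 * inverse 2 * (2 * (a * b) + 2 * (a * b)) \<in> G" by (intro sq_mult)
    moreover have "inverse 2 * inverse 2 * (2 * (a * b) + 2 * (a * b)) = a * b"
    proof -
      have "inverse h * inverse h * (h * (h * x)) = x" if "h \<noteq> 0" for h x :: 'c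
        using that by (simp add: field_simps)
      from this[OF False] show ?thesis by (simp only: mult_2)
    qed
    ultimately show ?thesis by simp
  qed
  show ?thesis using 0 1 add mult minus inv by (simp add: is_subfield_def)
qed

text \<open>
  The same argument for maps: by the formulas used for sets, \<open>\<psi>\<close> commutes with inversion and with
  \<open>(a, b) \<mapsto> a\<^sup>2b\<close>, and products are recovered by polarization or from squares.
\<close>

lemma hua_multiplicative:
  fixes \<psi> :: "'c::field \<Rightarrow> 'd::field"
  assumes F: "is_subfield F" and fin: "finite F"
    and add: "\<And>a b. a \<in> F \<Longrightarrow> b \<in> F \<Longrightarrow> \<psi> (a + b) = \<psi> a + \<psi> b"
    and inj: "inj_on \<psi> F" and 1: "\<psi> 1 = 1"
    and harm: "\<And>a b. a \<in> F \<Longrightarrow> b \<in> F \<Longrightarrow>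
      inverse (\<psi> (inverse (a + b))) = inverse (\<psi> (inverse a)) + inverse (\<psi> (inverse b))"
    and ab: "a \<in> F" "b \<in> F"
  shows "\<psi> (a * b) = \<psi> a * \<psi> b"
proof -
  note F_closed = subfield_closed[OF F]
  have "\<psi> 0 + \<psi> 0 = \<psi> 0 + 0" using add[OF F_closed(1) F_closed(1)] by (simp only: add_0_right)
  then have \<psi>0: "\<psi> 0 = 0" by (simp only: add_left_cancel)
  have minus: "\<psi> (- a) = - \<psi> a" if "a \<in> F" for a
    using add[OF that F_closed(5)[OF that]] \<psi>0 by (simp add: eq_neg_iff_add_eq_0 add.commute)
  have diff: "\<psi> (a - b) = \<psi> a - \<psi> b" if "a \<in> F" "b \<in> F" for a b
    using add[OF that(1) F_closed(5)[OF that(2)]] minus[OF that(2)] by simp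
  have harm': "\<psi> (inverse (inverse a + inverse b)) = inverse (inverse (\<psi> a) + inverse (\<psi> b))"
    if "a \<in> F" "b \<in> F" for a b
    using harm[of "inverse a" "inverse b"] F_closed(7) that by (metis inverse_inverse_eq)
  have eq_iff: "\<psi> a = \<psi> b \<longleftrightarrow> a = b" if "a \<in> F" "b \<in> F" for a b
    using inj that by (auto dest: inj_onD)
  have inv: "\<psi> (inverse x) = inverse (\<psi> x)" if x: "x \<in> F" for x
  proof (cases "x = 0 \<or> x = 1")
    case False
    then have n: "\<psi> x \<noteq> 0" "\<psi> x \<noteq> 1"
      using eq_iff[OF x F_closed(1)] eq_iff[OF x F_closed(2)] \<psi>0 1 by auto
    have m: "x - 1 \<in> F" "inverse (inverse (x - 1) + inverse 1) \<in> F"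
      using x F_closed by simp_all
    have "\<psi> (inverse x) = \<psi> (1 - inverse (inverse (x - 1) + inverse 1))"
      using False inverse_via_harmonic[of x] by simp
    also have "\<dots> = 1 - inverse (inverse (\<psi> x - 1) + inverse 1)"
      by (simp only: diff[OF F_closed(2) m(2)] harm'[OF m(1) F_closed(2)] diff[OF x F_closed(2)] 1)
    finally show ?thesis using inverse_via_harmonic[OF n] by simp
  qed (use \<psi>0 1 in auto)
  have sq_mult: "\<psi> (a * a * b) = \<psi> a * \<psi> a * \<psi> b" if ab: "a \<in> F" "b \<in> F" for a b
  proof (cases "a = 0 \<or> b = 0 \<or> a * b = 1")
    case True
    then consider "a = 0" | "b = 0" | "b = inverse a" "a \<noteq> 0"
      by (metis inverse_unique mult_zero_left zero_neq_one)
    then show ?thesis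
    proof cases
      case 3
      then have "\<psi> a \<noteq> 0" using eq_iff[OF ab(1) F_closed(1)] \<psi>0 by simp
      then show ?thesis using 3 inv[OF ab(1)] by (simp add: mult.assoc)
    qed (simp_all add: \<psi>0)
  next
    case False
    then have n: "\<psi> a \<noteq> 0" "\<psi> b \<noteq> 0"
      using eq_iff[OF ab(1) F_closed(1)] eq_iff[OF ab(2) F_closed(1)] \<psi>0 by auto
    have "\<psi> a * \<psi> b \<noteq> 1"
    proof
      assume "\<psi> a * \<psi> b = 1"
      then have "\<psi> b = \<psi> (inverse a)" using inv[OF ab(1)] by (metis inverse_unique)
      then have "b = inverse a" using eq_iff[OF ab(2) F_closed(7)[OF ab(1)]] by simp
      then show False using False by auto
    qed
    note n = n this
    have m: "inverse b - a \<in> F" "inverse (inverse a + inverse (inverse b - a)) \<in> F"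
      using ab F_closed by simp_all
    have "\<psi> (a * a * b) = \<psi> (a - inverse (inverse a + inverse (inverse b - a)))"
      using False hua_identity[of a b] by simp
    also have "\<dots> = \<psi> a - inverse (inverse (\<psi> a) + inverse (inverse (\<psi> b) - \<psi> a))"
      by (simp only: diff[OF ab(1) m(2)] harm'[OF ab(1) m(1)] diff[OF F_closed(7)[OF ab(2)] ab(1)] inv[OF ab(2)])
    finally show ?thesis using hua_identity[OF n] by simp
  qed
  have sq: "\<psi> (a * a) = \<psi> a * \<psi> a" if "a \<in> F" for a
    using sq_mult[OF that F_closed(2)] 1 by simp
  show ?thesis
  proof (cases "(2::'c) = 0")
    case True
    have "inj_on (\<lambda>a. a * a) F" using square_inj_char2[OF True] by (auto intro: inj_onI)
    then have "(\<lambda>a. a * a) ` F = F" by (intro endo_inj_surj[OF fin]) (use F_closed(4) in auto)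
    then obtain c where c: "c \<in> F" "a = c * c" using ab(1) by auto
    then show ?thesis using sq_mult[OF c(1) ab(2)] sq[OF c(1)] by simp
  next
    case False
    have "\<psi> (1 + 1) = 1 + 1" by (simp only: add[OF F_closed(2,2)] 1)
    then have \<psi>2: "\<psi> 2 = 2" by simp
    have 2: "2 \<in> F" using F_closed(3)[OF F_closed(2,2)] by simp
    have n2: "(2::'d) \<noteq> 0" using eq_iff[OF 2 F_closed(1)] \<psi>0 \<psi>2 False by auto
    have m: "a * b \<in> F" "a * a \<in> F" "b * b \<in> F" "a + b \<in> F" using ab F_closed by simp_all
    have "\<psi> (a * a + (a * b + a * b) + b * b) = \<psi> ((a + b) * (a + b))"
      by (simp add: algebra_simps)
    also have "\<dots> = (\<psi> a + \<psi> b) * (\<psi> a + \<psi> b)" by (simp only: sq[OF m(4)] add[OF ab])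
    moreover have "\<psi> (a * a + (a * b + a * b) + b * b) = \<psi> a * \<psi> a + (\<psi> (a * b) + \<psi> (a * b)) + \<psi> b * \<psi> b"
      by (simp only: add m F_closed(3) sq ab)
    ultimately have "\<psi> a * \<psi> a + (\<psi> (a * b) + \<psi> (a * b)) + \<psi> b * \<psi> b = (\<psi> a + \<psi> b) * (\<psi> a + \<psi> b)"
      by (simp only:)
    then have "2 * \<psi> (a * b) = 2 * (\<psi> a * \<psi> b)" by (simp add: algebra_simps)
    then show ?thesis using n2 by simp
  qed
qed

text \<open>
  Elementary row operations generate \<open>SL\<^sub>2\<close>: a matrix with \<open>c \<noteq> 0\<close> is the product of an upper, a lower
  and an upper elementary matrix, and one with \<open>c = 0\<close> is reduced to this case by adding the first row
  to the second. In the applications \<open>P\<close> is a property of the point \<open>[a + bu, c + du, 1]\<close>.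
\<close>

lemma SL2_row_induct:
  fixes P :: "'c::field \<Rightarrow> 'c \<Rightarrow> 'c \<Rightarrow> 'c \<Rightarrow> bool"
  assumes F: "is_subfield F" and id: "P 1 0 0 1"
    and lower: "\<And>a b c d k. a \<in> F \<Longrightarrow> b \<in> F \<Longrightarrow> c \<in> F \<Longrightarrow> d \<in> F \<Longrightarrow> k \<in> F \<Longrightarrow>
      P a b c d \<Longrightarrow> P a b (c + k * a) (d + k * b)"
    and upper: "\<And>a b c d k. a \<in> F \<Longrightarrow> b \<in> F \<Longrightarrow> c \<in> F \<Longrightarrow> d \<in> F \<Longrightarrow> k \<in> F \<Longrightarrow>
      P a b c d \<Longrightarrow> P (a + k * c) (b + k * d) c d"
    and abcd: "a \<in> F" "b \<in> F" "c \<in> F" "d \<in> F" "a * d - b * c = 1"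
  shows "P a b c d"
proof -
  note F_closed = subfield_closed[OF F]
  have main: "P a b c d"
    if m: "a \<in> F" "b \<in> F" "c \<in> F" "d \<in> F" "a * d - b * c = 1" and c: "c \<noteq> 0" for a b c d
  proof -
    let ?x = "(a - 1) / c" and ?y = "(d - 1) / c"
    have xy: "?x \<in> F" "?y \<in> F" using m F_closed by simp_all
    have "P (1 + ?y * 0) (0 + ?y * 1) 0 1" by (rule upper[OF _ _ _ _ _ id]) (use F_closed xy in auto)
    then have "P 1 ?y 0 1" by simp
    then have "P 1 ?y (0 + c * 1) (1 + c * ?y)"
      by (intro lower) (use F_closed xy m in auto)
    moreover have "1 + c * ?y = d" using c by simp
    ultimately have "P 1 ?y c d" by simp
    then have "P (1 + ?x * c) (?y + ?x * d) c d"
      by (intro upper) (use F_closed xy m in auto)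
    moreover have "1 + ?x * c = a" using c by simp
    moreover have "?y + ?x * d = ((d - 1) + (a - 1) * d) / c" by (simp add: add_divide_distrib)
    moreover have "(d - 1) + (a - 1) * d = b * c" using m(5) by (simp add: algebra_simps)
    ultimately show ?thesis using c by simp
  qed
  show ?thesis
  proof (cases "c = 0")
    case True
    have a: "a \<noteq> 0"
    proof
      assume "a = 0"
      with True abcd(5) show False by simp
    qed
    have "a * (d + b) - b * a = a * d - b * c"
      unfolding True by (simp add: distrib_left mult.commute[of b a])
    also have "\<dots> = 1" by (rule abcd(5))
    finally have "P a b a (d + b)"
      using main[OF abcd(1,2,1) F_closed(3)[OF abcd(4,2)] _ a] by blast
    then have "P a b (a + - 1 * a) (d + b + - 1 * b)"
      using lower[OF abcd(1,2,1) F_closed(3)[OF abcd(4,2)] F_closed(5)[OF F_closed(2)]] by blast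
    then show ?thesis using True by simp
  next
    case False
    then show ?thesis by (rule main[OF abcd])
  qed
qed

lemma SL2_complete_row:
  assumes "is_subfield F" "a \<in> F" "b \<in> F" "a \<noteq> 0 \<or> b \<noteq> 0"
  shows "\<exists>c\<in>F. \<exists>d\<in>F. a * d - b * c = 1"
proof (cases "a = 0")
  case True
  then have "a * 0 - b * (- inverse b) = 1" using assms(4) by simp
  then show ?thesis using subfield_closed(1,5,7)[OF assms(1)] assms(3) by blast
next
  case False
  then have "a * inverse a - b * 0 = 1" by simp
  then show ?thesis using subfield_closed(1,7)[OF assms(1)] assms(2) by blast
qed

section \<open>Unitals in normal position\<close>

text \<open>
  The interchange of \<open>X\<close> and \<open>Y\<close>. It carries what is known about translations at \<open>[0,1,0]\<close> to
  \<open>[1,0,0]\<close>, at the price of replacing \<open>\<mu>\<close> by its conjugate.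
\<close>

definition swap_mat :: "'c::field^3^3" where "swap_mat = mat3 0 1 0 1 0 0 0 0 1"

lemma act_swap [simp]: "act swap_mat (pt x y z) = pt y x z"
  by (simp add: swap_mat_def act_mat3)

lemma invertible_swap: "invertible swap_mat"
  by (simp add: swap_mat_def invertible_mat3)

lemma act_swap_swap: "P \<in> proj_points UNIV \<Longrightarrow> act swap_mat (act swap_mat P) = P"
  by (auto elim!: proj_pointsE)

lemma (in field_conj) swap_Hm:
  assumes "P \<in> Hm \<mu>"
  shows "act swap_mat P \<in> Hm (\<sigma> \<mu>)"
proof -
  obtain x y z where P: "P = pt x y z" "x \<noteq> 0 \<or> y \<noteq> 0 \<or> z \<noteq> 0" "\<sigma> x * y - \<mu> * N z \<in> R"
    using assms by (auto simp: Hm_def)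
  have "\<sigma> y * x - \<sigma> \<mu> * N z = \<sigma> (\<sigma> x * y - \<mu> * N z)"
    by (simp add: conj_diff conj_mult algebra_simps)
  then have "\<sigma> y * x - \<sigma> \<mu> * N z \<in> R" using P(3) conj_in_R_iff by simp
  then have "pt y x z \<in> Hm (\<sigma> \<mu>)" using P(2) by (intro pt_in_HmI) auto
  then show ?thesis using P(1) by simp
qed

locale two_pointed_unital = pointed_unital +
  assumes zero_in: "pt 1 0 0 \<in> U"
begin

lemma shear_y:
  assumes "pt 1 g 0 \<in> U" "pt a b c \<in> U"
  shows "pt a (b + g * a) c \<in> U"
proof (cases "a = 0")
  case False
  have "(b / a + (g - 0), c / a) \<in> affine"
    by (rule affine.translate[of 0 0]) (use assms zero_in pt_affine[OF False, of b c] in \<open>auto simp: affine_def\<close>)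
  moreover have "pt a (b + g * a) c = pt 1 (b / a + g) (c / a)"
    using False by (simp add: pt_affine[of a] add_divide_distrib)
  ultimately show ?thesis by (simp add: affine_def)
qed (use assms in simp)

lemma swap_two_pointed: "two_pointed_unital R \<sigma> q (\<sigma> \<mu>) (act swap_mat ` U)"
proof
  show "unital_set q (act swap_mat ` U)" by (rule unital_set_act[OF invertible_swap unital])
  show "act swap_mat ` U \<subseteq> Hm (\<sigma> \<mu>)" using sub_Hm swap_Hm by blast
  show "\<sigma> \<mu> \<notin> R" using \<mu> by (simp add: conj_in_R_iff)
  show "pt 0 1 0 \<in> act swap_mat ` U" by (rule image_eqI[OF _ zero_in]) simp
  show "pt 1 0 0 \<in> act swap_mat ` U" by (rule image_eqI[OF _ inf_in]) simp
qed

lemma swap_mem: "pt x y z \<in> act swap_mat ` U \<longleftrightarrow> pt y x z \<in> U"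
proof
  assume "pt x y z \<in> act swap_mat ` U"
  then obtain P where P: "P \<in> U" "pt x y z = act swap_mat P" by blast
  then have "P \<in> proj_points UNIV" using unital by (auto simp: unital_set_def)
  then have "P = pt y x z" using act_swap_swap[of P] P(2)[symmetric] by simp
  then show "pt y x z \<in> U" using P(1) by simp
next
  assume "pt y x z \<in> U"
  then show "pt x y z \<in> act swap_mat ` U" by (rule image_eqI[rotated]) simp
qed

lemma shear_x:
  assumes "pt h 1 0 \<in> U" "pt a b c \<in> U"
  shows "pt (a + h * b) b c \<in> U"
proof -
  interpret S: two_pointed_unital R \<sigma> q "\<sigma> \<mu>" "act swap_mat ` U" by (rule swap_two_pointed)
  show ?thesis using S.shear_y[of h b a c] assms by (simp add: swap_mem)
qed

end

text \<open>
  The parameter \<open>\<mu>\<close> can be taken to be the coordinate \<open>u\<close> of the point \<open>[1,u,1]\<close>: that this point lies on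
  the unital means \<open>u - \<mu> \<in> R\<close>, and only the class of \<open>\<mu>\<close> modulo \<open>R\<close> matters.
\<close>

locale normal_unital = field_conj +
  fixes q :: nat and u :: 'a and U :: "('a^3) set set"
  assumes unital': "unital_set q U" and sub_Hm': "U \<subseteq> Hm u" and u: "u \<notin> R"
    and inf': "pt 0 1 0 \<in> U" and zero': "pt 1 0 0 \<in> U"
    and unit_in: "pt 1 1 0 \<in> U" and top_in: "pt 1 u 1 \<in> U"
begin

sublocale two_pointed_unital R \<sigma> q u U
  by unfold_locales (use unital' sub_Hm' u inf' zero' in auto)

definition F :: "'a set" where "F = {f. pt 1 f 0 \<in> U}"

lemma F_iff_inverse: "pt h 1 0 \<in> U \<longleftrightarrow> inverse h \<in> F"
proof (cases "h = 0")
  case False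
  then show ?thesis by (simp add: F_def pt_affine[OF False] inverse_eq_divide)
qed (simp add: F_def inf' zero')

lemma F_sub_R: "F \<subseteq> R"
  using affine.on_unital[of _ 0] by (auto simp: F_def affine_def)

lemma F_eq_fibre: "F = affine.fibre 0"
  unfolding F_def affine.fibre_def by (simp add: affine_def)

lemma finite_F [simp]: "finite F"
  by (simp add: F_eq_fibre)

lemma card_F: "card F = q"
proof -
  have "(0, 0) \<in> affine" using zero' by (simp add: affine_def)
  then have "0 \<in> snd ` affine" by force
  then show ?thesis using affine.card_fibre' by (simp add: F_eq_fibre)
qed

text \<open>
  Translations at \<open>[0,1,0]\<close> make \<open>F\<close> an additive group. In the coordinate \<open>X/Y\<close>, translations at \<open>[1,0,0]\<close>
  do the same for the set of inverses. Hua's argument applies since \<open>[1,1,0] \<in> U\<close>.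
\<close>

lemma subfield_F: "is_subfield F"
proof (rule hua_subfield)
  show add: "a + b \<in> F" if "a \<in> F" "b \<in> F" for a b
    using shear_y[of b 1 a 0] that by (simp add: F_def)
  show "- a \<in> F" if "a \<in> F" for a
    using affine.translate[of a 0 0 0 0] that zero' by (simp add: F_def affine_def)
  show "inverse (inverse a + inverse b) \<in> F" if "a \<in> F" "b \<in> F" for a b
    using shear_x[of "inverse b" "inverse a" 1 0] that F_iff_inverse by simp
qed (use unit_in in \<open>simp_all, simp add: F_def\<close>)

lemmas F_closed = subfield_closed[OF subfield_F]

lemma F_shear_y: "f \<in> F \<Longrightarrow> pt a b c \<in> U \<Longrightarrow> pt a (b + f * a) c \<in> U"
  using shear_y by (simp add: F_def)

lemma F_shear_x: "f \<in> F \<Longrightarrow> pt a b c \<in> U \<Longrightarrow> pt (a + f * b) b c \<in> U"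
  using shear_x F_iff_inverse F_closed(7) by simp

lemma F_u_indep:
  assumes "a \<in> R" "b \<in> R" "a + b * u = 0"
  shows "a = 0 \<and> b = 0"
proof -
  have "u * b = - a" using assms(3) by (simp add: eq_neg_iff_add_eq_0 algebra_simps)
  then have "b = 0" using subfield_multiple_outside[OF R u assms(2)] R_closed(5)[OF assms(1)] by simp
  then show ?thesis using assms(3) by simp
qed

lemma orbit_in:
  assumes "a \<in> F" "b \<in> F" "c \<in> F" "d \<in> F" "a * d - b * c = 1"
  shows "pt (a + b * u) (c + d * u) 1 \<in> U"
proof (rule SL2_row_induct[OF subfield_F, where P = "\<lambda>a b c d. pt (a + b * u) (c + d * u) 1 \<in> U"])
  fix a b c d k assume k: "k \<in> F" and in_U: "pt (a + b * u) (c + d * u) 1 \<in> U"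
  show "pt (a + b * u) (c + k * a + (d + k * b) * u) 1 \<in> U"
    using F_shear_y[OF k in_U] by (simp add: algebra_simps)
  show "pt (a + k * c + (b + k * d) * u) (c + d * u) 1 \<in> U"
    using F_shear_x[OF k in_U] by (simp add: algebra_simps)
qed (use assms top_in in auto)

definition E :: "'a set" where "E = {a + b * u | a b. a \<in> F \<and> b \<in> F}"

lemma card_E: "card E = q^2" and finite_E: "finite E"
proof -
  have E: "E = (\<lambda>(a, b). a + b * u) ` (F \<times> F)" by (auto simp: E_def)
  have "inj_on (\<lambda>(a, b). a + b * u) (F \<times> F)"
  proof (rule inj_onI, clarify)
    fix a b a' b' assume m: "a \<in> F" "b \<in> F" "a' \<in> F" "b' \<in> F" and e: "a + b * u = a' + b' * u"
    have "(a - a') + (b - b') * u = 0" using e by (simp add: algebra_simps)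
    then show "a = a' \<and> b = b'"
      using F_u_indep[of "a - a'" "b - b'"] m F_sub_R R_closed(6) by auto
  qed
  then show "card E = q^2" by (simp add: E card_image card_cartesian_product card_F power2_eq_square)
  show "finite E" by (simp add: E)
qed

text \<open>
  The orbit of \<open>[1,u,1]\<close> meets as many fibres as there are, so every point outside the block \<open>Z = 0\<close>
  belongs to it.
\<close>

lemma fibres_eq: "snd ` affine = inverse ` E"
proof (rule sym, rule card_seteq)
  show "finite (snd ` affine)" using finite_affine by simp
  show "inverse ` E \<subseteq> snd ` affine"
  proof clarify
    fix w assume "w \<in> E"
    then obtain a b where ab: "a \<in> F" "b \<in> F" "w = a + b * u" by (auto simp: E_def)
    show "inverse w \<in> snd ` affine"
    proof (cases "w = 0")
      case True
      have "(0, 0) \<in> affine" using zero' by (simp add: affine_def)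
      then show ?thesis using True by force
    next
      case False
      then have "a \<noteq> 0 \<or> b \<noteq> 0" using ab by auto
      then obtain c d where cd: "c \<in> F" "d \<in> F" "a * d - b * c = 1"
        using SL2_complete_row[OF subfield_F ab(1,2)] by blast
      have "pt w (c + d * u) 1 \<in> U" using orbit_in ab cd by simp
      then have "((c + d * u) / w, inverse w) \<in> affine"
        using False by (simp add: affine_def pt_affine[of w] inverse_eq_divide)
      then show ?thesis by force
    qed
  qed
  have "card (inverse ` E) = card E" by (rule card_image) (simp add: inj_on_def)
  then show "card (snd ` affine) \<le> card (inverse ` E)" by (simp add: affine.card_fibres card_E)
qed

text \<open>
  The orbit contains a point of the fibre over \<open>z\<close>, and the other points of that fibre arise from it by
  translations, which belong to the group.
\<close>

lemma orbit_complete: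
  assumes "(y, z) \<in> affine" "z \<noteq> 0"
  shows "\<exists>a\<in>F. \<exists>b\<in>F. \<exists>c\<in>F. \<exists>d\<in>F. a * d - b * c = 1 \<and> 1 / z = a + b * u \<and> y / z = c + d * u"
proof -
  have "z \<in> inverse ` E" using assms(1) fibres_eq by force
  then have "inverse z \<in> E" by auto
  then obtain a b where ab: "a \<in> F" "b \<in> F" "1 / z = a + b * u"
    by (auto simp: E_def inverse_eq_divide)
  then have "a \<noteq> 0 \<or> b \<noteq> 0" using assms(2) by auto
  then obtain c d where cd: "c \<in> F" "d \<in> F" "a * d - b * c = 1"
    using SL2_complete_row[OF subfield_F ab(1,2)] by blast
  have "pt (1 / z) (c + d * u) 1 \<in> U" using orbit_in[OF ab(1,2) cd] ab(3) by simp
  then have y0: "((c + d * u) * z, z) \<in> affine"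
    using assms(2) by (simp add: affine_def pt_affine[of "1 / z"])
  define f where "f = y - (c + d * u) * z"
  have "(0 + f, 0) \<in> affine"
    unfolding f_def by (rule affine.translate[OF y0 assms(1)]) (use zero' in \<open>simp add: affine_def\<close>)
  then have f: "f \<in> F" by (simp add: F_def affine_def)
  have "y / z = (c + d * u) + f / z"
    using assms(2) by (simp add: f_def field_simps)
  also have "f / z = f * (a + b * u)" by (simp flip: ab(3))
  finally have "y / z = (c + f * a) + (d + f * b) * u" by (simp add: algebra_simps)
  moreover have "a * (d + f * b) - b * (c + f * a) = 1" using cd(3) by (simp add: algebra_simps)
  moreover have "c + f * a \<in> F" "d + f * b \<in> F" using F_closed ab cd f by simp_all
  ultimately show ?thesis using ab by blast
qed

end

lemma quotient_of_relation:
  assumes "d * u^2 + b * u + c = 0" "d \<noteq> (0::'c::field)"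
  shows "u^2 = - (b / d) * u + - (c / d)"
proof -
  have "d * (u^2) = d * (- (b / d) * u + - (c / d))"
    using assms by (simp add: algebra_simps eq_neg_iff_add_eq_0)
  then show ?thesis using assms(2) by (simp only: mult_left_cancel[OF assms(2)])
qed

lemma col_base_line:
  "col (pt 1 u 1) (pt u (u - 1) 1) (pt x y 1) \<longleftrightarrow> (u - 1) * (y - u) + (x - 1) = 0"
proof -
  have "1 * ((u - 1) * 1 - 1 * y) - u * (u * 1 - 1 * x) + 1 * (u * y - (u - 1) * x)
      = (u - 1) * (y - u) + (x - 1)"
    by (simp add: algebra_simps)
  then show ?thesis unfolding col_pt by (simp only:)
qed

text \<open>
  The determinant of the three points, arranged as a quadratic polynomial in \<open>u\<close>.
\<close>

lemma col_base_line_orbit: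
  "col (pt 1 u 1) (pt u (u - 1) 1) (pt (a + b * u) (c + d * u) 1) \<longleftrightarrow>
    (d - 1) * u^2 + (c - d + 1 + b) * u + (a - 1 - c) = 0"
proof -
  have "(u - 1) * (c + d * u - u) + (a + b * u - 1)
      = (d - 1) * u^2 + (c - d + 1 + b) * u + (a - 1 - c)"
    by (simp add: algebra_simps power2_eq_square)
  then show ?thesis unfolding col_base_line by (simp only:)
qed

context normal_unital
begin

lemma point_trichotomy:
  assumes "P \<in> U"
  obtains (inf) "P = pt 0 1 0" | (block) f where "f \<in> F" "P = pt 1 f 0"
    | (orbit) a b c d where "a \<in> F" "b \<in> F" "c \<in> F" "d \<in> F" "a * d - b * c = 1"
      "P = pt (a + b * u) (c + d * u) 1"
  using assms
proof (cases rule: point_cases)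
  case 1
  then show thesis by (rule inf)
next
  case (2 y z)
  show thesis
  proof (cases "z = 0")
    case True
    then show thesis using 2 by (intro block[of y]) (auto simp: F_def affine_def)
  next
    case False
    obtain a b c d where abcd: "a \<in> F" "b \<in> F" "c \<in> F" "d \<in> F" "a * d - b * c = 1"
      "1 / z = a + b * u" "y / z = c + d * u"
      using orbit_complete[OF 2(2) False] by blast
    have "P = pt (1 / z) (y / z) 1"
      using pt_scale[of "1 / z" 1 y z] 2(1) False by simp
    then show thesis using abcd by (intro orbit[of a b c d]) auto
  qed
qed

lemma u_simps: "u \<noteq> 0" "u \<noteq> 1" "u - 1 \<noteq> 0"
  using u R_closed(1,2) by auto

lemma second_in: "pt u (u - 1) 1 \<in> U"
  using orbit_in[of 0 1 "- 1" 1] F_closed by simp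

text \<open>
  The line joining \<open>[1,u,1]\<close> and \<open>[u,u-1,1]\<close> misses the block \<open>Z = 0\<close>, so a third point of \<open>U\<close> on it
  comes from a matrix in \<open>SL\<^sub>2(F)\<close>, and collinearity is a quadratic equation for \<open>u\<close> over \<open>F\<close>. Its
  leading coefficient \<open>d - 1\<close> vanishes only for the two given points.
\<close>

lemma quadratic_witness:
  obtains a b c d where "a \<in> F" "b \<in> F" "c \<in> F" "d \<in> F" "a * d - b * c = 1" "d \<noteq> 1"
    "col (pt 1 u 1) (pt u (u - 1) 1) (pt (a + b * u) (c + d * u) 1)"
proof -
  let ?P1 = "pt 1 u 1" and ?P2 = "pt u (u - 1) 1"
  let ?L = "{S \<in> U. col ?P1 ?P2 S}"
  have "?P1 \<noteq> ?P2" using u_simps by (auto dest: pt_eqD)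
  then have "card ?L = q + 1" using unital top_in second_in unfolding unital_set_def by blast
  then have "card ?L > card {?P1, ?P2}" using affine.q card_insert_le_m1[of 2 "{?P2}" ?P1] by auto
  then have "\<not> ?L \<subseteq> {?P1, ?P2}" using card_mono[of "{?P1, ?P2}" ?L] by auto
  then obtain S where S: "S \<in> U" "col ?P1 ?P2 S" "S \<noteq> ?P1" "S \<noteq> ?P2" by blast
  from S(1) show thesis
  proof (cases rule: point_trichotomy)
    case inf
    then show thesis using S(2) u_simps by (auto simp: col_pt)
  next
    case (block f)
    have "f * (u - 1) + 1 = 0"
      using S(2) unfolding block(2) col_pt by (simp add: algebra_simps)
    then have e: "f * (u - 1) = - 1" by (simp add: eq_neg_iff_add_eq_0)
    then have "f \<noteq> 0" by auto
    then have "u = 1 + (- 1) / f" using e by (simp add: field_simps)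
    moreover have "1 + (- 1) / f \<in> R"
      using block(1) F_sub_R R_closed(2,3,5,8) by blast
    ultimately show thesis using u by simp
  next
    case (orbit a b c d)
    have "d \<noteq> 1"
    proof
      assume d: "d = 1"
      have "(d - 1) * u^2 + (c - d + 1 + b) * u + (a - 1 - c) = 0"
        using S(2) unfolding orbit(6) col_base_line_orbit .
      then have "(a - 1 - c) + (c + b) * u = 0" using d by (simp add: add.commute)
      moreover have "a - 1 - c \<in> F" "c + b \<in> F" using orbit(1-3) F_closed(2,3,6) by simp_all
      ultimately have e: "a - 1 - c = 0 \<and> c + b = 0" using F_u_indep F_sub_R by blast
      have "a = (a - 1 - c) + (1 + c)" "b = (c + b) - c" by simp_all
      then have ab: "a = 1 + c" "b = - c" using e by simp_all
      have "(1 + c) * 1 - (- c) * c = 1" using orbit(5) unfolding ab d .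
      then have "c * (c + 1) = 0" by (simp add: algebra_simps)
      then consider "c = 0" | "c = - 1" by (auto simp: eq_neg_iff_add_eq_0)
      then show False
      proof cases
        case 1
        then show False using S(3) orbit(6) ab d by simp
      next
        case 2
        then show False using S(4) orbit(6) ab d by simp
      qed
    qed
    then show thesis using orbit S(2) by (intro that[of a b c d]) auto
  qed
qed

lemma u_square: "u^2 = (u + \<sigma> u) * u - u * \<sigma> u"
  by (simp add: algebra_simps power2_eq_square)

text \<open>
  Comparing the equation for \<open>u\<close> over \<open>F\<close> with \<open>u\<^sup>2 = (u + u\<^sup>\<sigma>) u - u u\<^sup>\<sigma>\<close>, which has coefficients in
  \<open>R\<close>: as \<open>1\<close> and \<open>u\<close> are independent over \<open>R\<close>, the coefficients agree.
\<close>

lemma trace_u_in_F: "u + \<sigma> u \<in> F" and norm_u_in_F: "u * \<sigma> u \<in> F"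
proof -
  obtain a b c d where w: "a \<in> F" "b \<in> F" "c \<in> F" "d \<in> F" "a * d - b * c = 1" "d \<noteq> 1"
    "col (pt 1 u 1) (pt u (u - 1) 1) (pt (a + b * u) (c + d * u) 1)"
    by (rule quadratic_witness)
  define t e where "t = - ((c - d + 1 + b) / (d - 1))" and "e = (a - 1 - c) / (d - 1)"
  have te: "t \<in> F" "e \<in> F" unfolding t_def e_def using w F_closed by simp_all
  have "u^2 = t * u + - e"
    unfolding t_def e_def using w by (intro quotient_of_relation) (simp_all add: col_base_line_orbit)
  then have "(u * \<sigma> u - e) + (t - (u + \<sigma> u)) * u = 0"
    unfolding u_square by (simp add: algebra_simps)
  moreover have "u * \<sigma> u - e \<in> R" "t - (u + \<sigma> u) \<in> R"
    using te F_sub_R norm_in trace_in R_closed(6) by auto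
  ultimately have "u * \<sigma> u - e = 0 \<and> t - (u + \<sigma> u) = 0" using F_u_indep by blast
  then show "u + \<sigma> u \<in> F" "u * \<sigma> u \<in> F" using te by simp_all
qed

lemma conj_F: "f \<in> F \<Longrightarrow> \<sigma> f = f"
  using F_sub_R conj_fix by blast

lemma E_I: "a \<in> F \<Longrightarrow> b \<in> F \<Longrightarrow> a + b * u \<in> E"
  by (auto simp: E_def)

lemma conj_basis:
  assumes "a \<in> F" "b \<in> F"
  shows "\<sigma> (a + b * u) = (a + b * (u + \<sigma> u)) + (- b) * u"
  using assms by (simp add: conj_add conj_mult conj_F algebra_simps)

lemma norm_basis:
  assumes "a \<in> F" "b \<in> F"
  shows "N (a + b * u) = a * a + a * b * (u + \<sigma> u) + b * b * (u * \<sigma> u)"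
  using assms by (simp add: conj_add conj_mult conj_F algebra_simps)

lemma conj_E:
  assumes "w \<in> E"
  shows "\<sigma> w \<in> E"
proof -
  obtain a b where ab: "a \<in> F" "b \<in> F" "w = a + b * u" using assms by (auto simp: E_def)
  show ?thesis
    unfolding ab(3) conj_basis[OF ab(1,2)] by (intro E_I F_closed(3,4,5) trace_u_in_F ab)
qed

lemma norm_E:
  assumes "w \<in> E"
  shows "N w \<in> F"
proof -
  obtain a b where ab: "a \<in> F" "b \<in> F" "w = a + b * u" using assms by (auto simp: E_def)
  show ?thesis
    unfolding ab(3) norm_basis[OF ab(1,2)]
    using ab F_closed(3,4) trace_u_in_F norm_u_in_F by simp
qed

lemma trace_E:
  assumes "w \<in> E"
  shows "w + \<sigma> w \<in> F"
proof -
  obtain a b where ab: "a \<in> F" "b \<in> F" "w = a + b * u" using assms by (auto simp: E_def)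
  have "w + \<sigma> w = a + a + b * (u + \<sigma> u)"
    unfolding ab(3) conj_basis[OF ab(1,2)] by (simp add: algebra_simps)
  moreover have "a + a + b * (u + \<sigma> u) \<in> F"
    by (intro F_closed(3,4) trace_u_in_F ab)
  ultimately show ?thesis by (simp only:)
qed

lemma F_sub_E: "F \<subseteq> E"
  using E_I[OF _ F_closed(1)] by auto

lemma u_in_E: "u \<in> E"
  using E_I[OF F_closed(1,2)] by simp

lemma mult_basis: "(a + b * u) * (c + d * u) =
    (a * c - b * d * (u * \<sigma> u)) + (a * d + b * c + b * d * (u + \<sigma> u)) * u"
  by (simp add: algebra_simps)

lemma subfield_E: "is_subfield E"
proof -
  have mult: "x * y \<in> E" if xy: "x \<in> E" "y \<in> E" for x y
  proof -
    obtain a b where ab: "a \<in> F" "b \<in> F" "x = a + b * u" using xy by (auto simp: E_def)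
    obtain c d where cd: "c \<in> F" "d \<in> F" "y = c + d * u" using xy by (auto simp: E_def)
    show ?thesis unfolding ab(3) cd(3) mult_basis
      by (rule E_I) (use ab cd F_closed trace_u_in_F norm_u_in_F in simp_all)
  qed
  have add: "x + y \<in> E" if xy: "x \<in> E" "y \<in> E" for x y
  proof -
    obtain a b where ab: "a \<in> F" "b \<in> F" "x = a + b * u" using xy by (auto simp: E_def)
    obtain c d where cd: "c \<in> F" "d \<in> F" "y = c + d * u" using xy by (auto simp: E_def)
    have "x + y = (a + c) + (b + d) * u" using ab cd by (simp add: algebra_simps)
    moreover have "(a + c) + (b + d) * u \<in> E" by (rule E_I) (use ab cd F_closed in simp_all)
    ultimately show ?thesis by (simp only:)
  qed
  have "- x \<in> E" if "x \<in> E" for x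
    using mult[OF subsetD[OF F_sub_E F_closed(5)[OF F_closed(2)]] that] by simp
  moreover have "inverse x \<in> E" if x: "x \<in> E" for x
  proof (cases "x = 0")
    case False
    then have e: "inverse x = \<sigma> x * inverse (N x)" by (simp add: field_simps)
    have "inverse (N x) \<in> E" using norm_E[OF x] F_closed(7) F_sub_E by blast
    then show ?thesis by (subst e) (rule mult[OF conj_E[OF x]])
  qed (use x in simp)
  moreover have "0 \<in> E" "1 \<in> E" using F_sub_E F_closed by auto
  ultimately show ?thesis using add mult by (simp add: is_subfield_def)
qed

lemmas E_closed = subfield_closed[OF subfield_E]

text \<open>
  For \<open>z = 1/w\<close> with \<open>w = a + bu\<close> and \<open>y = (c + du)/w\<close> the claim amounts to \<open>(c + du) w\<^sup>\<sigma> - u \<in> F\<close>.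
  Here the coefficient of \<open>u\<close> is \<open>ad - bc - 1 = 0\<close> once the mixed terms are collected in the trace
  \<open>u + u\<^sup>\<sigma>\<close>.
\<close>

lemma height_in_F:
  assumes "(y, z) \<in> affine"
  shows "y - u * N z \<in> F"
proof (cases "z = 0")
  case True
  then show ?thesis using assms by (simp add: F_def affine_def)
next
  case False
  obtain a b c d where w: "a \<in> F" "b \<in> F" "c \<in> F" "d \<in> F" "a * d - b * c = 1"
    "1 / z = a + b * u" "y / z = c + d * u"
    using orbit_complete[OF assms False] by blast
  let ?w = "a + b * u"
  have w0: "?w \<noteq> 0" using False unfolding w(6)[symmetric] by simp
  have "z = 1 / (1 / z)" by simp
  then have zw: "z = 1 / ?w" "?w \<noteq> 0" using w0 unfolding w(6) by blast+
  have wE: "?w \<in> E" using w E_I by simp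
  have "y = (y / z) * z" using False by simp
  also have "\<dots> = (c + d * u) / ?w" unfolding w(7) by (subst zw(1)) simp
  also have "\<dots> = (c + d * u) * \<sigma> ?w / N ?w" using zw(2) by simp
  finally have y: "y = (c + d * u) * \<sigma> ?w / N ?w" .
  have Nz: "N z = 1 / N ?w" unfolding zw(1) by (simp add: conj_divide)
  have "(c + d * u) * \<sigma> ?w - u = a * c + b * d * (u * \<sigma> u) + b * c * (u + \<sigma> u) + (a * d - b * c - 1) * u"
    using w(1-4) by (simp add: conj_add conj_mult conj_F algebra_simps)
  also have "\<dots> = a * c + b * d * (u * \<sigma> u) + b * c * (u + \<sigma> u)" using w(5) by simp
  finally have "(c + d * u) * \<sigma> ?w - u \<in> F"
    using w F_closed(3,4) trace_u_in_F norm_u_in_F by simp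
  then have "((c + d * u) * \<sigma> ?w - u) / N ?w \<in> F" using norm_E[OF wE] F_closed(8) by blast
  moreover have "y - u * N z = ((c + d * u) * \<sigma> ?w - u) / N ?w"
    unfolding y Nz by (simp add: diff_divide_distrib)
  ultimately show ?thesis by simp
qed

lemma fibres_eq_E: "snd ` affine = E"
proof -
  have "inverse ` E \<subseteq> E" using E_closed(7) by blast
  moreover have "E \<subseteq> inverse ` E"
  proof
    fix x assume "x \<in> E"
    then show "x \<in> inverse ` E" using E_closed(7)[of x] by (intro image_eqI[of _ _ "inverse x"]) auto
  qed
  ultimately show ?thesis using fibres_eq by simp
qed

text \<open>
  So \<open>U\<close> is the hermitian unital of \<open>E|F\<close>, in the form with parameter \<open>u\<close>. Each fibre over \<open>E\<close> contains one
  such point by \<open>height_in_F\<close>, and fibres are cosets of \<open>F\<close>.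
\<close>

lemma affine_iff: "(y, z) \<in> affine \<longleftrightarrow> z \<in> E \<and> y - u * N z \<in> F"
proof
  assume "(y, z) \<in> affine"
  moreover from this have "z \<in> E" using fibres_eq_E by force
  ultimately show "z \<in> E \<and> y - u * N z \<in> F" using height_in_F by blast
next
  assume yz: "z \<in> E \<and> y - u * N z \<in> F"
  then obtain y0 where y0: "(y0, z) \<in> affine" using fibres_eq_E by force
  have "y - y0 = (y - u * N z) - (y0 - u * N z)" by simp
  then have "y - y0 \<in> F" using F_closed(6) height_in_F[OF y0] yz by metis
  then have "pt 1 (y0 + (y - y0) * 1) z \<in> U" using F_shear_y[of "y - y0" 1 y0 z] y0 by (simp add: affine_def)
  then show "(y, z) \<in> affine" by (simp add: affine_def)
qed

lemma u_notin_F: "u \<notin> F"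
  using u F_sub_R by blast

end

section \<open>Isomorphisms between unitals in normal position\<close>

text \<open>
  The geometric form of \<open>translation_conjugate\<close>: an isomorphism fixing \<open>[0,1,0]\<close> maps blocks through this
  point to such blocks, hence induces a map of the affine coordinates that preserves fibres.
\<close>

lemma col_iso_translation:
  assumes P1: "pointed_unital R \<sigma> q \<mu>1 U1" and P2: "pointed_unital R \<sigma> q \<mu>2 U2"
    and iso: "col_iso \<theta> U1 U2" and \<theta>_inf: "\<theta> (pt 0 1 0) = pt 0 1 0"
    and yz: "pt 1 y z \<in> U1" "pt 1 y' z \<in> U1"
  shows "\<exists>g. \<forall>w x v t. pt 1 w x \<in> U1 \<longrightarrow> \<theta> (pt 1 w x) = pt 1 v t \<longrightarrow>
    \<theta> (pt 1 (w + (y' - y)) x) = pt 1 (v + g) t"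
proof -
  interpret P1: pointed_unital R \<sigma> q \<mu>1 U1 by fact
  interpret P2: pointed_unital R \<sigma> q \<mu>2 U2 by fact
  have bij: "bij_betw \<theta> U1 U2" using iso by (simp add: col_iso_def)
  have \<theta>_col: "col (\<theta> P) (\<theta> Q) (\<theta> S) \<longleftrightarrow> col P Q S" if "P \<in> U1" "Q \<in> U1" "S \<in> U1" for P Q S
    using iso that by (simp add: col_iso_def)
  have ex: "\<exists>p'. p' \<in> P2.affine \<and> \<theta> (P1.aff p) = P1.aff p'" if p: "p \<in> P1.affine" for p
  proof -
    have pU: "P1.aff p \<in> U1" using p by (auto simp: P1.affine_def)
    then have "\<theta> (P1.aff p) \<in> U2" using bij by (rule bij_betw_apply[rotated])
    then show ?thesis
    proof (cases rule: P2.point_cases)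
      case 1
      then have "\<theta> (P1.aff p) = \<theta> (pt 0 1 0)" using \<theta>_inf by simp
      then have "P1.aff p = pt 0 1 0"
        using inj_onD[OF bij_betw_imp_inj_on[OF bij]] pU P1.inf_in by blast
      then show ?thesis by simp
    next
      case (2 y z)
      then have "\<theta> (P1.aff p) = P1.aff (y, z)" by simp
      then show ?thesis using 2(2) by blast
    qed
  qed
  define \<phi> where "\<phi> p = (SOME p'. p' \<in> P2.affine \<and> \<theta> (P1.aff p) = P1.aff p')" for p
  have \<phi>: "\<phi> p \<in> P2.affine" "\<theta> (P1.aff p) = P1.aff (\<phi> p)" if "p \<in> P1.affine" for p
    using someI_ex[OF ex[OF that]] unfolding \<phi>_def by auto
  have in1: "P1.aff p \<in> U1" if "p \<in> P1.affine" for p using that by (auto simp: P1.affine_def)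
  have "\<exists>g. \<forall>w x. (w, x) \<in> P1.affine \<longrightarrow>
    \<phi> (w + (y' - y), x) = (fst (\<phi> (w, x)) + g, snd (\<phi> (w, x)))"
  proof (rule translation_conjugate[OF P1.affine.affine_unital_axioms P2.affine.affine_unital_axioms])
    fix p p' assume p: "p \<in> P1.affine" "p' \<in> P1.affine"
    have "col (P1.aff p) (P1.aff p') (pt 0 1 0) \<longleftrightarrow> col (P1.aff (\<phi> p)) (P1.aff (\<phi> p')) (pt 0 1 0)"
      using \<theta>_col[OF in1[OF p(1)] in1[OF p(2)] P1.inf_in] by (simp add: \<phi> p \<theta>_inf)
    then show "snd (\<phi> p) = snd (\<phi> p') \<longleftrightarrow> snd p = snd p'" by (simp add: col_affine_inf)
  next
    fix p1 p2 p3 assume p: "p1 \<in> P1.affine" "p2 \<in> P1.affine" "p3 \<in> P1.affine"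
      and c: "(fst p3 - fst p1) * (snd p2 - snd p1) = (fst p2 - fst p1) * (snd p3 - snd p1)"
    have "col (P1.aff (\<phi> p1)) (P1.aff (\<phi> p2)) (P1.aff (\<phi> p3))"
      using \<theta>_col[OF in1[OF p(1)] in1[OF p(2)] in1[OF p(3)]] c by (simp add: \<phi> p col_affine)
    then show "(fst (\<phi> p3) - fst (\<phi> p1)) * (snd (\<phi> p2) - snd (\<phi> p1)) =
      (fst (\<phi> p2) - fst (\<phi> p1)) * (snd (\<phi> p3) - snd (\<phi> p1))" by (simp add: col_affine)
  qed (use \<phi> yz in \<open>auto simp: P1.affine_def\<close>)
  then obtain g where g: "\<And>w x. (w, x) \<in> P1.affine \<Longrightarrow>
    \<phi> (w + (y' - y), x) = (fst (\<phi> (w, x)) + g, snd (\<phi> (w, x)))" by blast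
  have "\<theta> (pt 1 (w + (y' - y)) x) = pt 1 (v + g) t"
    if w: "pt 1 w x \<in> U1" "\<theta> (pt 1 w x) = pt 1 v t" for w x v t
  proof -
    have wx: "(w, x) \<in> P1.affine" using w by (simp add: P1.affine_def)
    have "(w + (y' - y), x) \<in> P1.affine"
      by (rule P1.affine.translate[OF _ _ wx]) (use yz in \<open>auto simp: P1.affine_def\<close>)
    then have "\<theta> (pt 1 (w + (y' - y)) x) = P1.aff (\<phi> (w + (y' - y), x))" using \<phi>(2) by fastforce
    also have "\<dots> = pt 1 (fst (\<phi> (w, x)) + g) (snd (\<phi> (w, x)))" using g[OF wx] by simp
    also have "\<dots> = pt 1 (v + g) t" using \<phi>(2)[OF wx] w(2) by simp
    finally show ?thesis .
  qed
  then show ?thesis by blast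
qed

text \<open>
  Fixing \<open>[1,0,0]\<close> as well identifies the amount \<open>g\<close> of the conjugated translation as the image of \<open>f\<close> on the
  block \<open>Z = 0\<close>. The homogeneous form includes the fixed point \<open>[0,1,0]\<close>, so that translations at
  \<open>[0,1,0]\<close> and at \<open>[1,0,0]\<close> can be composed without case distinctions.
\<close>

lemma col_iso_shear_y:
  assumes P1: "two_pointed_unital R \<sigma> q \<mu>1 U1" and P2: "two_pointed_unital R \<sigma> q \<mu>2 U2"
    and iso: "col_iso \<theta> U1 U2"
    and \<theta>_inf: "\<theta> (pt 0 1 0) = pt 0 1 0" and \<theta>_zero: "\<theta> (pt 1 0 0) = pt 1 0 0"
    and f: "pt 1 f 0 \<in> U1"
  shows "\<exists>g. \<theta> (pt 1 f 0) = pt 1 g 0 \<and> (\<forall>a b c a' b' c'. pt a b c \<in> U1 \<longrightarrow>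
    \<theta> (pt a b c) = pt a' b' c' \<longrightarrow> \<theta> (pt a (b + f * a) c) = pt a' (b' + g * a') c')"
proof -
  interpret P1: two_pointed_unital R \<sigma> q \<mu>1 U1 by fact
  interpret P2: two_pointed_unital R \<sigma> q \<mu>2 U2 by fact
  have bij: "bij_betw \<theta> U1 U2" using iso by (simp add: col_iso_def)
  obtain g where g: "\<And>w x v t. pt 1 w x \<in> U1 \<Longrightarrow> \<theta> (pt 1 w x) = pt 1 v t \<Longrightarrow>
    \<theta> (pt 1 (w + (f - 0)) x) = pt 1 (v + g) t"
    using col_iso_translation[OF P1.pointed_unital_axioms P2.pointed_unital_axioms iso \<theta>_inf P1.zero_in f]
    by blast
  have "\<theta> (pt a (b + f * a) c) = pt a' (b' + g * a') c'"
    if p: "pt a b c \<in> U1" and \<theta>p: "\<theta> (pt a b c) = pt a' b' c'" for a b c a' b' c'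
  proof (cases "a = 0")
    case True
    have "pt a b c = pt 0 1 0"
      using p
    proof (cases rule: P1.point_cases)
      case (2 y z)
      then show ?thesis using pt_eqD[of 1 y z a b c] True by auto
    qed
    then have "pt a' b' c' = pt 0 1 0" using \<theta>p \<theta>_inf by simp
    then have "a' = 0" by (auto dest: pt_eqD)
    then show ?thesis using \<theta>p True by simp
  next
    case False
    have p1: "pt a b c = pt 1 (b / a) (c / a)" by (rule pt_affine[OF False])
    have "\<theta> (pt a b c) \<in> U2" using bij p by (rule bij_betw_apply)
    then obtain v t where vt: "\<theta> (pt a b c) = pt 1 v t"
    proof (cases rule: P2.point_cases)
      case 1
      then have "\<theta> (pt a b c) = \<theta> (pt 0 1 0)" using \<theta>_inf by simp
      then have "pt a b c = pt 0 1 0"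
        using inj_onD[OF bij_betw_imp_inj_on[OF bij]] p P1.inf_in by blast
      then show ?thesis using p1 by simp
    qed
    then have "pt 1 v t = pt a' b' c'" using \<theta>p by simp
    then obtain k where k: "1 = k * a'" "v = k * b'" "t = k * c'" using pt_eqD by blast
    then have a': "a' \<noteq> 0" by auto
    then have "k = 1 / a'" using k(1) by (simp add: field_simps)
    then have vt': "v = b' / a'" "t = c' / a'" using k by simp_all
    have "\<theta> (pt 1 (b / a + (f - 0)) (c / a)) = pt 1 (v + g) t"
      by (rule g) (use p p1 vt in simp_all)
    moreover have "pt a (b + f * a) c = pt 1 (b / a + (f - 0)) (c / a)"
      using False by (simp add: pt_affine[OF False] add_divide_distrib)
    moreover have "pt a' (b' + g * a') c' = pt 1 (v + g) t"
      using a' by (simp add: pt_affine[OF a'] vt' add_divide_distrib)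
    ultimately show ?thesis by simp
  qed
  moreover have "\<theta> (pt 1 f 0) = pt 1 g 0" using g[OF P1.zero_in \<theta>_zero] by simp
  ultimately show ?thesis by blast
qed

lemma col_iso_shear_x:
  assumes P1: "two_pointed_unital R \<sigma> q \<mu>1 U1" and P2: "two_pointed_unital R \<sigma> q \<mu>2 U2"
    and iso: "col_iso \<theta> U1 U2"
    and \<theta>_inf: "\<theta> (pt 0 1 0) = pt 0 1 0" and \<theta>_zero: "\<theta> (pt 1 0 0) = pt 1 0 0"
    and h: "pt h 1 0 \<in> U1"
  shows "\<exists>g. \<theta> (pt h 1 0) = pt g 1 0 \<and> (\<forall>a b c a' b' c'. pt a b c \<in> U1 \<longrightarrow>
    \<theta> (pt a b c) = pt a' b' c' \<longrightarrow> \<theta> (pt (a + h * b) b c) = pt (a' + g * b') b' c')"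
proof -
  interpret P1: two_pointed_unital R \<sigma> q \<mu>1 U1 by fact
  interpret P2: two_pointed_unital R \<sigma> q \<mu>2 U2 by fact
  let ?s = "act swap_mat :: ('a^3) set \<Rightarrow> ('a^3) set"
  have "?s ` ?s ` U1 = U1"
  proof -
    have "?s (?s P) = P" if "P \<in> U1" for P
      using act_swap_swap that P1.unital by (auto simp: unital_set_def)
    then show ?thesis by (simp add: image_image)
  qed
  then have "col_iso ?s (?s ` U1) U1" using col_iso_act[OF invertible_swap, of "?s ` U1"] by simp
  then have iso': "col_iso (?s \<circ> (\<theta> \<circ> ?s)) (?s ` U1) (?s ` U2)"
    by (intro col_iso_comp[OF col_iso_comp[OF _ iso] col_iso_act[OF invertible_swap]])
  obtain g where g: "(?s \<circ> (\<theta> \<circ> ?s)) (pt 1 h 0) = pt 1 g 0"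
    "\<And>a b c a' b' c'. pt a b c \<in> ?s ` U1 \<Longrightarrow>
    (?s \<circ> (\<theta> \<circ> ?s)) (pt a b c) = pt a' b' c' \<Longrightarrow> (?s \<circ> (\<theta> \<circ> ?s)) (pt a (b + h * a) c) = pt a' (b' + g * a') c'"
    using col_iso_shear_y[OF P1.swap_two_pointed P2.swap_two_pointed iso', of h] h \<theta>_inf \<theta>_zero
    by (auto simp: P1.swap_mem)
  have swap_eq: "P = Q" if "?s P = ?s Q" for P Q
    using that inj_act[OF invertible_swap] by (auto dest: injD)
  have "\<theta> (pt (a + h * b) b c) = pt (a' + g * b') b' c'"
    if "pt a b c \<in> U1" "\<theta> (pt a b c) = pt a' b' c'" for a b c a' b' c'
    by (rule swap_eq) (use g(2)[of b a c b' a' c'] that P1.swap_mem in simp)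
  moreover have "\<theta> (pt h 1 0) = pt g 1 0" by (rule swap_eq) (use g(1) in simp)
  ultimately show ?thesis by blast
qed

locale normal_iso =
  U1: normal_unital R \<sigma> q u1 U1 + U2: normal_unital R \<sigma> q u2 U2
  for R :: "'a::field set" and \<sigma> q u1 U1 u2 U2 +
  fixes \<theta>
  assumes iso: "col_iso \<theta> U1 U2"
    and \<theta>_inf: "\<theta> (pt 0 1 0) = pt 0 1 0" and \<theta>_zero: "\<theta> (pt 1 0 0) = pt 1 0 0"
    and \<theta>_unit: "\<theta> (pt 1 1 0) = pt 1 1 0" and \<theta>_top: "\<theta> (pt 1 u1 1) = pt 1 u2 1"
begin

lemma bij: "bij_betw \<theta> U1 U2"
  using iso by (simp add: col_iso_def)

lemma \<theta>_inj: "P \<in> U1 \<Longrightarrow> Q \<in> U1 \<Longrightarrow> \<theta> P = \<theta> Q \<Longrightarrow> P = Q"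
  by (rule inj_onD[OF bij_betw_imp_inj_on[OF bij]])

text \<open>
  The isomorphism maps \<open>[1,f,0]\<close> to \<open>[1,\<psi> f,0]\<close>, because it fixes the line \<open>Z = 0\<close>; only values on the
  field \<open>F\<close> of the first unital are meaningful.
\<close>

definition \<psi> :: "'a \<Rightarrow> 'a" where "\<psi> f = (SOME g. \<theta> (pt 1 f 0) = pt 1 g 0)"

lemma shear_y_ex:
  assumes "f \<in> U1.F"
  shows "\<exists>g. \<theta> (pt 1 f 0) = pt 1 g 0 \<and> (\<forall>a b c a' b' c'. pt a b c \<in> U1 \<longrightarrow>
    \<theta> (pt a b c) = pt a' b' c' \<longrightarrow> \<theta> (pt a (b + f * a) c) = pt a' (b' + g * a') c')"
  by (rule col_iso_shear_y[OF U1.two_pointed_unital_axioms U2.two_pointed_unital_axioms iso \<theta>_inf \<theta>_zero])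
    (use assms in \<open>simp add: U1.F_def\<close>)

lemma \<theta>_block: "f \<in> U1.F \<Longrightarrow> \<theta> (pt 1 f 0) = pt 1 (\<psi> f) 0"
  unfolding \<psi>_def by (rule someI_ex) (use shear_y_ex in blast)

lemma \<theta>_shear_y:
  assumes "f \<in> U1.F" "pt a b c \<in> U1" "\<theta> (pt a b c) = pt a' b' c'"
  shows "\<theta> (pt a (b + f * a) c) = pt a' (b' + \<psi> f * a') c'"
proof -
  obtain g where g: "\<theta> (pt 1 f 0) = pt 1 g 0" "\<theta> (pt a (b + f * a) c) = pt a' (b' + g * a') c'"
    using shear_y_ex[OF assms(1)] assms(2,3) by blast
  then have "g = \<psi> f" using \<theta>_block[OF assms(1)] by simp
  then show ?thesis using g by simp
qed

lemma \<psi>_in: "f \<in> U1.F \<Longrightarrow> \<psi> f \<in> U2.F"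
  using \<theta>_block[of f] bij_betw_apply[OF bij, of "pt 1 f 0"] by (simp add: U1.F_def U2.F_def)

lemma \<psi>_0: "\<psi> 0 = 0" and \<psi>_1: "\<psi> 1 = 1"
  using \<theta>_block[OF U1.F_closed(1)] \<theta>_block[OF U1.F_closed(2)] \<theta>_zero \<theta>_unit by simp_all

lemma \<psi>_add:
  assumes "a \<in> U1.F" "b \<in> U1.F"
  shows "\<psi> (a + b) = \<psi> a + \<psi> b"
proof -
  have "pt 1 a 0 \<in> U1" using assms(1) by (simp add: U1.F_def)
  from \<theta>_shear_y[OF assms(2) this \<theta>_block[OF assms(1)]]
  show ?thesis using \<theta>_block[OF U1.F_closed(3)[OF assms]] by simp
qed

lemma \<psi>_inj: "inj_on \<psi> U1.F"
proof (rule inj_onI)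
  fix a b assume ab: "a \<in> U1.F" "b \<in> U1.F" "\<psi> a = \<psi> b"
  then have "\<theta> (pt 1 a 0) = \<theta> (pt 1 b 0)" by (simp add: \<theta>_block)
  moreover have "pt 1 a 0 \<in> U1" "pt 1 b 0 \<in> U1" using ab by (simp_all add: U1.F_def)
  ultimately have "pt 1 a 0 = pt 1 b 0" using \<theta>_inj by blast
  then show "a = b" by simp
qed

lemma \<theta>_block_x:
  assumes "h \<in> U1.F"
  shows "\<theta> (pt h 1 0) = pt (inverse (\<psi> (inverse h))) 1 0"
proof (cases "h = 0")
  case True
  then show ?thesis by (simp add: \<theta>_inf \<psi>_0)
next
  case False
  have h: "inverse h \<in> U1.F" by (rule U1.F_closed(7)[OF assms])
  have n: "\<psi> (inverse h) \<noteq> 0"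
    using inj_onD[OF \<psi>_inj, of "inverse h" 0] h U1.F_closed(1) False \<psi>_0 by auto
  have "pt h 1 0 = pt 1 (inverse h) 0" using False by (simp add: pt_affine[OF False] inverse_eq_divide)
  then have "\<theta> (pt h 1 0) = pt 1 (\<psi> (inverse h)) 0" using \<theta>_block[OF h] by simp
  also have "\<dots> = pt (inverse (\<psi> (inverse h))) 1 0"
    using pt_scale[of "\<psi> (inverse h)" "inverse (\<psi> (inverse h))" 1 0] n by simp
  finally show ?thesis .
qed

lemma \<theta>_shear_x_aux:
  assumes "h \<in> U1.F" "pt a b c \<in> U1" "\<theta> (pt a b c) = pt a' b' c'"
  shows "\<theta> (pt (a + h * b) b c) = pt (a' + inverse (\<psi> (inverse h)) * b') b' c'"
proof -
  have "pt h 1 0 \<in> U1" using U1.F_iff_inverse U1.F_closed(7) assms(1) by blast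
  then obtain g where g: "\<theta> (pt h 1 0) = pt g 1 0" "\<theta> (pt (a + h * b) b c) = pt (a' + g * b') b' c'"
    using col_iso_shear_x[OF U1.two_pointed_unital_axioms U2.two_pointed_unital_axioms iso
        \<theta>_inf \<theta>_zero \<open>pt h 1 0 \<in> U1\<close>] assms(2,3) by blast
  then have "pt g 1 0 = pt (inverse (\<psi> (inverse h))) 1 0" using \<theta>_block_x[OF assms(1)] by simp
  then have "g = inverse (\<psi> (inverse h))" by (auto dest!: pt_eqD)
  then show ?thesis using g by simp
qed

text \<open>
  In the coordinate \<open>X/Y\<close> of the block \<open>Z = 0\<close> the isomorphism is \<open>h \<mapsto> 1/\<psi>(1/h)\<close>, and it is additive because
  it conjugates the translations at \<open>[1,0,0]\<close>. This is the hypothesis of \<open>hua_multiplicative\<close>.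
\<close>

lemma \<psi>_mult:
  assumes "a \<in> U1.F" "b \<in> U1.F"
  shows "\<psi> (a * b) = \<psi> a * \<psi> b"
proof (rule hua_multiplicative[OF U1.subfield_F U1.finite_F \<psi>_add \<psi>_inj \<psi>_1 _ assms])
  fix a b assume ab: "a \<in> U1.F" "b \<in> U1.F"
  have "pt a 1 0 \<in> U1" using U1.F_iff_inverse U1.F_closed(7) ab(1) by blast
  from \<theta>_shear_x_aux[OF ab(2) this \<theta>_block_x[OF ab(1)]]
  have "pt (inverse (\<psi> (inverse (a + b)))) 1 0 = pt (inverse (\<psi> (inverse a)) + inverse (\<psi> (inverse b))) 1 0"
    using \<theta>_block_x[OF U1.F_closed(3)[OF ab]] by simp
  then show "inverse (\<psi> (inverse (a + b))) = inverse (\<psi> (inverse a)) + inverse (\<psi> (inverse b))"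
    by (auto dest!: pt_eqD)
qed

lemma \<psi>_minus: "a \<in> U1.F \<Longrightarrow> \<psi> (- a) = - \<psi> a"
  using \<psi>_add[of a "- a"] U1.F_closed(5)[of a] \<psi>_0 by (simp add: eq_neg_iff_add_eq_0 add.commute)

lemma \<psi>_diff: "a \<in> U1.F \<Longrightarrow> b \<in> U1.F \<Longrightarrow> \<psi> (a - b) = \<psi> a - \<psi> b"
  using \<psi>_add[of a "- b"] U1.F_closed(5)[of b] \<psi>_minus[of b] by simp

lemma \<psi>_eq_0_iff: "a \<in> U1.F \<Longrightarrow> \<psi> a = 0 \<longleftrightarrow> a = 0"
  using inj_onD[OF \<psi>_inj, of a 0] U1.F_closed(1) \<psi>_0 by auto

lemma \<psi>_inverse:
  assumes "a \<in> U1.F"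
  shows "\<psi> (inverse a) = inverse (\<psi> a)"
proof (cases "a = 0")
  case False
  then have "\<psi> a * \<psi> (inverse a) = 1"
    using \<psi>_mult[OF assms U1.F_closed(7)[OF assms]] \<psi>_1 by simp
  then show ?thesis by (metis inverse_unique)
qed (simp add: \<psi>_0)

lemma \<theta>_shear_x:
  assumes "h \<in> U1.F" "pt a b c \<in> U1" "\<theta> (pt a b c) = pt a' b' c'"
  shows "\<theta> (pt (a + h * b) b c) = pt (a' + \<psi> h * b') b' c'"
  using \<theta>_shear_x_aux[OF assms] \<psi>_inverse[OF assms(1)] by simp

text \<open>
  The isomorphism intertwines the actions of \<open>SL\<^sub>2(F)\<close> on the two orbits, since it does so for the generating
  translations.
\<close>

lemma \<theta>_orbit:
  assumes "a \<in> U1.F" "b \<in> U1.F" "c \<in> U1.F" "d \<in> U1.F" "a * d - b * c = 1"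
  shows "\<theta> (pt (a + b * u1) (c + d * u1) 1) = pt (\<psi> a + \<psi> b * u2) (\<psi> c + \<psi> d * u2) 1"
proof -
  let ?P = "\<lambda>a b c d. pt (a + b * u1) (c + d * u1) 1 \<in> U1 \<and>
    \<theta> (pt (a + b * u1) (c + d * u1) 1) = pt (\<psi> a + \<psi> b * u2) (\<psi> c + \<psi> d * u2) 1"
  have "?P a b c d"
  proof (rule SL2_row_induct[OF U1.subfield_F, where P = ?P])
    show "?P 1 0 0 1" using U1.top_in \<theta>_top by (simp add: \<psi>_0 \<psi>_1)
  next
    fix a b c d k assume m: "a \<in> U1.F" "b \<in> U1.F" "c \<in> U1.F" "d \<in> U1.F" "k \<in> U1.F" and P: "?P a b c d"
    have e: "c + k * a + (d + k * b) * u1 = c + d * u1 + k * (a + b * u1)"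
      by (simp add: algebra_simps)
    have e': "\<psi> (c + k * a) + \<psi> (d + k * b) * u2 = \<psi> c + \<psi> d * u2 + \<psi> k * (\<psi> a + \<psi> b * u2)"
      using m U1.F_closed(4) by (simp add: \<psi>_add \<psi>_mult algebra_simps)
    show "?P a b (c + k * a) (d + k * b)"
      unfolding e e' using P U1.F_shear_y[OF m(5)] \<theta>_shear_y[OF m(5)] by blast
    have e: "a + k * c + (b + k * d) * u1 = a + b * u1 + k * (c + d * u1)"
      by (simp add: algebra_simps)
    have e': "\<psi> (a + k * c) + \<psi> (b + k * d) * u2 = \<psi> a + \<psi> b * u2 + \<psi> k * (\<psi> c + \<psi> d * u2)"
      using m U1.F_closed(4) by (simp add: \<psi>_add \<psi>_mult algebra_simps)
    show "?P (a + k * c) (b + k * d) c d"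
      unfolding e e' using P U1.F_shear_x[OF m(5)] \<theta>_shear_x[OF m(5)] by blast
  qed (use assms in auto)
  then show ?thesis by blast
qed

text \<open>
  An isomorphism preserves the collinear triple of \<open>quadratic_witness\<close>, so \<open>u\<^sub>2\<close> satisfies the image
  under \<open>\<psi>\<close> of the quadratic equation of \<open>u\<^sub>1\<close>.
\<close>

lemma \<psi>_trace_norm:
  "\<psi> (u1 + \<sigma> u1) = u2 + \<sigma> u2" "\<psi> (u1 * \<sigma> u1) = u2 * \<sigma> u2"
proof -
  obtain a b c d where w: "a \<in> U1.F" "b \<in> U1.F" "c \<in> U1.F" "d \<in> U1.F" "a * d - b * c = 1" "d \<noteq> 1"
    "col (pt 1 u1 1) (pt u1 (u1 - 1) 1) (pt (a + b * u1) (c + d * u1) 1)"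
    by (rule U1.quadratic_witness)
  have \<theta>2: "\<theta> (pt u1 (u1 - 1) 1) = pt u2 (u2 - 1) 1"
    using \<theta>_orbit[of 0 1 "- 1" 1] U1.F_closed by (simp add: \<psi>_0 \<psi>_1 \<psi>_minus)
  have w2: "col (pt 1 u2 1) (pt u2 (u2 - 1) 1) (pt (\<psi> a + \<psi> b * u2) (\<psi> c + \<psi> d * u2) 1)"
    using iso w(7) U1.top_in U1.second_in U1.orbit_in[OF w(1-5)]
    by (simp add: col_iso_def flip: \<theta>2 \<theta>_top \<theta>_orbit[OF w(1-5)])
  define A B C where "A = d - 1" and "B = c - d + 1 + b" and "C = a - 1 - c"
  have ABC: "A \<in> U1.F" "B \<in> U1.F" "C \<in> U1.F" "A \<noteq> 0"
    unfolding A_def B_def C_def using w U1.F_closed by simp_all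
  have r1: "A * u1^2 + B * u1 + C = 0"
    using w(7) unfolding col_base_line_orbit A_def B_def C_def .
  have "\<psi> A = \<psi> d - 1" "\<psi> B = \<psi> c - \<psi> d + 1 + \<psi> b" "\<psi> C = \<psi> a - 1 - \<psi> c"
    unfolding A_def B_def C_def using w(1-4) U1.F_closed by (simp_all add: \<psi>_diff \<psi>_add \<psi>_1)
  then have r2: "\<psi> A * u2^2 + \<psi> B * u2 + \<psi> C = 0"
    using w2 unfolding col_base_line_orbit by simp
  \<comment> \<open>both coefficients with respect to the basis \<open>1, u\<^sub>1\<close> vanish, and likewise for \<open>u\<^sub>2\<close>\<close>
  have "A * u1^2 + B * u1 + C = (C - A * (u1 * \<sigma> u1)) + (B + A * (u1 + \<sigma> u1)) * u1"
    unfolding U1.u_square by (simp add: algebra_simps)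
  then have "(C - A * (u1 * \<sigma> u1)) + (B + A * (u1 + \<sigma> u1)) * u1 = 0" using r1 by simp
  moreover have in_F: "C - A * (u1 * \<sigma> u1) \<in> U1.F" "B + A * (u1 + \<sigma> u1) \<in> U1.F"
    using ABC U1.norm_u_in_F U1.trace_u_in_F U1.F_closed(3,4,6) by simp_all
  ultimately have z1: "C - A * (u1 * \<sigma> u1) = 0" "B + A * (u1 + \<sigma> u1) = 0"
    using U1.F_u_indep U1.F_sub_R by blast+
  have "\<psi> A * u2^2 + \<psi> B * u2 + \<psi> C = (\<psi> C - \<psi> A * (u2 * \<sigma> u2)) + (\<psi> B + \<psi> A * (u2 + \<sigma> u2)) * u2"
    unfolding U2.u_square by (simp add: algebra_simps)
  then have "(\<psi> C - \<psi> A * (u2 * \<sigma> u2)) + (\<psi> B + \<psi> A * (u2 + \<sigma> u2)) * u2 = 0" using r2 by simp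
  moreover have "\<psi> C - \<psi> A * (u2 * \<sigma> u2) \<in> U2.F" "\<psi> B + \<psi> A * (u2 + \<sigma> u2) \<in> U2.F"
    using ABC \<psi>_in U2.norm_u_in_F U2.trace_u_in_F U2.F_closed(3,4,6) by simp_all
  ultimately have z2: "\<psi> C - \<psi> A * (u2 * \<sigma> u2) = 0" "\<psi> B + \<psi> A * (u2 + \<sigma> u2) = 0"
    using U2.F_u_indep U2.F_sub_R by blast+
  have n: "\<psi> A \<noteq> 0" using \<psi>_eq_0_iff ABC by simp
  have "\<psi> (C - A * (u1 * \<sigma> u1)) = 0" "\<psi> (B + A * (u1 + \<sigma> u1)) = 0"
    unfolding z1 by (rule \<psi>_0)+
  then have "\<psi> C - \<psi> A * \<psi> (u1 * \<sigma> u1) = 0" "\<psi> B + \<psi> A * \<psi> (u1 + \<sigma> u1) = 0"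
    using ABC U1.norm_u_in_F U1.trace_u_in_F U1.F_closed(4) by (simp_all add: \<psi>_diff \<psi>_add \<psi>_mult)
  then have e: "\<psi> A * \<psi> (u1 * \<sigma> u1) = \<psi> A * (u2 * \<sigma> u2)" "\<psi> A * \<psi> (u1 + \<sigma> u1) = \<psi> A * (u2 + \<sigma> u2)"
    using z2 by (metis add_left_cancel eq_iff_diff_eq_0)+
  show "\<psi> (u1 + \<sigma> u1) = u2 + \<sigma> u2" using e(2) by (simp only: mult_left_cancel[OF n])
  show "\<psi> (u1 * \<sigma> u1) = u2 * \<sigma> u2" using e(1) by (simp only: mult_left_cancel[OF n])
qed

definition \<eta> :: "'a \<Rightarrow> 'a" where
  "\<eta> w = (SOME w'. \<exists>a\<in>U1.F. \<exists>b\<in>U1.F. w = a + b * u1 \<and> w' = \<psi> a + \<psi> b * u2)"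

lemma \<eta>_basis:
  assumes "a \<in> U1.F" "b \<in> U1.F"
  shows "\<eta> (a + b * u1) = \<psi> a + \<psi> b * u2"
proof -
  have "\<exists>w'. \<exists>a'\<in>U1.F. \<exists>b'\<in>U1.F. a + b * u1 = a' + b' * u1 \<and> w' = \<psi> a' + \<psi> b' * u2"
    using assms by blast
  from someI_ex[OF this] obtain a' b' where ab: "a' \<in> U1.F" "b' \<in> U1.F"
    "a + b * u1 = a' + b' * u1" "\<eta> (a + b * u1) = \<psi> a' + \<psi> b' * u2"
    unfolding \<eta>_def by blast
  have "(a - a') + (b - b') * u1 = 0" using ab(3) by (simp add: algebra_simps)
  moreover have "a - a' \<in> R" "b - b' \<in> R"
    using assms ab U1.F_sub_R U1.R_closed(6) by blast+
  ultimately have "a - a' = 0 \<and> b - b' = 0" using U1.F_u_indep by blast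
  then show ?thesis using ab(4) by simp
qed

lemma \<eta>_F: "f \<in> U1.F \<Longrightarrow> \<eta> f = \<psi> f"
  using \<eta>_basis[of f 0] U1.F_closed(1) by (simp add: \<psi>_0)

lemma \<eta>_add:
  assumes "x \<in> U1.E" "y \<in> U1.E"
  shows "\<eta> (x + y) = \<eta> x + \<eta> y"
proof -
  obtain a b where ab: "a \<in> U1.F" "b \<in> U1.F" "x = a + b * u1" using assms by (auto simp: U1.E_def)
  obtain c d where cd: "c \<in> U1.F" "d \<in> U1.F" "y = c + d * u1" using assms by (auto simp: U1.E_def)
  have "x + y = (a + c) + (b + d) * u1" using ab cd by (simp add: algebra_simps)
  then have "\<eta> (x + y) = \<psi> (a + c) + \<psi> (b + d) * u2"
    using \<eta>_basis[OF U1.F_closed(3)[OF ab(1) cd(1)] U1.F_closed(3)[OF ab(2) cd(2)]] by (simp only:)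
  then show ?thesis unfolding ab(3) cd(3)
    using ab(1,2) cd(1,2) by (simp add: \<eta>_basis \<psi>_add algebra_simps)
qed

lemma \<eta>_mult:
  assumes "x \<in> U1.E" "y \<in> U1.E"
  shows "\<eta> (x * y) = \<eta> x * \<eta> y"
proof -
  obtain a b where ab: "a \<in> U1.F" "b \<in> U1.F" "x = a + b * u1" using assms by (auto simp: U1.E_def)
  obtain c d where cd: "c \<in> U1.F" "d \<in> U1.F" "y = c + d * u1" using assms by (auto simp: U1.E_def)
  note F = U1.F_closed(3,4,6) U1.trace_u_in_F U1.norm_u_in_F
  have m: "a * c - b * d * (u1 * \<sigma> u1) \<in> U1.F" "a * d + b * c + b * d * (u1 + \<sigma> u1) \<in> U1.F"
    using ab cd F by simp_all
  have "\<eta> (x * y) = \<psi> (a * c - b * d * (u1 * \<sigma> u1)) + \<psi> (a * d + b * c + b * d * (u1 + \<sigma> u1)) * u2"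
    unfolding ab(3) cd(3) U1.mult_basis by (rule \<eta>_basis[OF m])
  also have "\<psi> (a * c - b * d * (u1 * \<sigma> u1)) = \<psi> a * \<psi> c - \<psi> b * \<psi> d * (u2 * \<sigma> u2)"
    unfolding \<psi>_trace_norm[symmetric] by (simp only: \<psi>_diff \<psi>_mult ab(1,2) cd(1,2) F)
  also have "\<psi> (a * d + b * c + b * d * (u1 + \<sigma> u1)) = \<psi> a * \<psi> d + \<psi> b * \<psi> c + \<psi> b * \<psi> d * (u2 + \<sigma> u2)"
    unfolding \<psi>_trace_norm[symmetric] by (simp only: \<psi>_add \<psi>_mult ab(1,2) cd(1,2) F)
  finally show ?thesis
    unfolding ab(3) cd(3) \<eta>_basis[OF ab(1,2)] \<eta>_basis[OF cd(1,2)] U2.mult_basis .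
qed

lemma \<eta>_eq_0:
  assumes "x \<in> U1.E" "\<eta> x = 0"
  shows "x = 0"
proof -
  obtain a b where ab: "a \<in> U1.F" "b \<in> U1.F" "x = a + b * u1" using assms by (auto simp: U1.E_def)
  have "\<psi> a + \<psi> b * u2 = 0" using assms(2) unfolding ab(3) \<eta>_basis[OF ab(1,2)] .
  moreover have "\<psi> a \<in> R" "\<psi> b \<in> R" using \<psi>_in ab U2.F_sub_R by blast+
  ultimately have "\<psi> a = 0 \<and> \<psi> b = 0" using U2.F_u_indep by blast
  then show ?thesis using ab \<psi>_eq_0_iff by simp
qed

lemma \<eta>_field_ext_embedding: "field_ext_embedding U1.E U1.F UNIV R \<eta>"
proof -
  have "inj_on \<eta> U1.E"
  proof (rule inj_onI)
    fix x y assume xy: "x \<in> U1.E" "y \<in> U1.E" "\<eta> x = \<eta> y"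
    have "\<eta> x = \<eta> (x - y) + \<eta> y" using \<eta>_add[OF U1.E_closed(6)[OF xy(1,2)] xy(2)] by simp
    then have "\<eta> (x - y) = 0" using xy(3) by simp
    then show "x = y" using \<eta>_eq_0[OF U1.E_closed(6)[OF xy(1,2)]] by simp
  qed
  moreover have "\<eta> ` U1.F \<subseteq> R" using \<eta>_F \<psi>_in U2.F_sub_R by auto
  moreover have "\<eta> 1 = 1" using \<eta>_F U1.F_closed(2) \<psi>_1 by simp
  ultimately show ?thesis using \<eta>_add \<eta>_mult by (simp add: field_ext_embedding_def)
qed

text \<open>
  On the orbit, and on the block \<open>Z = 0\<close>, one representing vector is mapped coordinatewise by \<open>\<eta>\<close>; as \<open>\<eta>\<close> is
  multiplicative, the same holds for all its multiples by elements of \<open>E\<close>.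
\<close>

theorem \<theta>_semilinear:
  assumes E: "x \<in> U1.E" "y \<in> U1.E" "z \<in> U1.E" and nz: "x \<noteq> 0 \<or> y \<noteq> 0 \<or> z \<noteq> 0"
    and in_U: "pt x y z \<in> U1"
  shows "\<theta> (pt x y z) = pt (\<eta> x) (\<eta> y) (\<eta> z)"
proof -
  have \<eta>0: "\<eta> 0 = 0" using \<eta>_F U1.F_closed(1) \<psi>_0 by simp
  show ?thesis
    using in_U
  proof (cases rule: U1.point_trichotomy)
    case inf
    then obtain k where "x = k * 0" "y = k * 1" "z = k * 0" using pt_eqD by blast
    then have xyz: "x = 0" "z = 0" "y \<noteq> 0" using nz by auto
    then have "\<eta> y \<noteq> 0" using \<eta>_eq_0 E by blast
    then show ?thesis using inf \<theta>_inf pt_scale[of "\<eta> y" 0 1 0] xyz \<eta>0 by simp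
  next
    case (block f)
    then obtain k where "x = k * 1" "y = k * f" "z = k * 0" using pt_eqD by blast
    then have xyz: "x \<noteq> 0" "y = x * f" "z = 0" using nz by auto
    then have "\<eta> x \<noteq> 0" using \<eta>_eq_0 E by blast
    then have "pt (\<eta> x) (\<eta> x * \<eta> f) 0 = pt 1 (\<eta> f) 0" using pt_scale[of "\<eta> x" 1 "\<eta> f" 0] by simp
    moreover have "\<eta> y = \<eta> x * \<eta> f" using \<eta>_mult E block(1) U1.F_sub_E xyz by blast
    ultimately show ?thesis using block \<theta>_block \<eta>_F xyz \<eta>0 by simp
  next
    case (orbit a b c d)
    then obtain k where k: "x = k * (a + b * u1)" "y = k * (c + d * u1)" "z = k * 1" using pt_eqD by blast
    then have z: "z \<noteq> 0" using nz by auto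
    have X: "a + b * u1 \<in> U1.E" and Y: "c + d * u1 \<in> U1.E" using U1.E_I orbit by blast+
    have \<eta>z: "\<eta> z \<noteq> 0" using \<eta>_eq_0 E z by blast
    have "\<eta> x = \<eta> z * \<eta> (a + b * u1)" "\<eta> y = \<eta> z * \<eta> (c + d * u1)"
      using \<eta>_mult[OF E(3) X] \<eta>_mult[OF E(3) Y] k by simp_all
    then have "pt (\<eta> x) (\<eta> y) (\<eta> z) = pt (\<eta> (a + b * u1)) (\<eta> (c + d * u1)) 1"
      using pt_scale[OF \<eta>z, of "\<eta> (a + b * u1)" "\<eta> (c + d * u1)" 1] by simp
    also have "\<dots> = \<theta> (pt (a + b * u1) (c + d * u1) 1)"
      using \<theta>_orbit[OF orbit(1-5)] orbit(1-4) by (simp only: \<eta>_basis)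
    finally show ?thesis using orbit(6) by simp
  qed
qed

end

section \<open>Moving points into normal position\<close>

context field_conj
begin

lemma Hm_cong:
  assumes "\<mu> - \<nu> \<in> R"
  shows "Hm \<mu> \<subseteq> Hm \<nu>"
proof
  fix P assume "P \<in> Hm \<mu>"
  then obtain x y z where P: "P = pt x y z" "x \<noteq> 0 \<or> y \<noteq> 0 \<or> z \<noteq> 0" "\<sigma> x * y - \<mu> * N z \<in> R"
    by (auto simp: Hm_def)
  have "\<sigma> x * y - \<nu> * N z = (\<sigma> x * y - \<mu> * N z) + (\<mu> - \<nu>) * N z" by (simp add: algebra_simps)
  also have "\<dots> \<in> R" by (intro R_closed(3,4) P(3) assms norm_in)
  finally show "P \<in> Hm \<nu>" using P(1,2) by (auto intro: pt_in_HmI)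
qed

text \<open>
  The Heisenberg group acts regularly on the points other than \<open>[0,1,0]\<close>. The coefficient
  \<open>(\<mu> - \<sigma>\<mu>) \<sigma>z\<^sub>1\<close> makes the mixed terms of the form a trace.
\<close>

lemma heisenberg_Hm:
  assumes y1: "y1 - \<mu> * N z1 \<in> R" and P: "P \<in> Hm \<mu>"
  shows "act (mat3 1 0 0 y1 1 ((\<mu> - \<sigma> \<mu>) * \<sigma> z1) z1 0 1) P \<in> Hm \<mu>"
proof -
  obtain a b c where abc: "P = pt a b c" "a \<noteq> 0 \<or> b \<noteq> 0 \<or> c \<noteq> 0" "\<sigma> a * b - \<mu> * N c \<in> R"
    using P by (auto simp: Hm_def)
  let ?m = "(\<mu> - \<sigma> \<mu>) * \<sigma> z1" and ?s = "\<mu> * z1 * a * \<sigma> c"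
  have "\<sigma> a * (y1 * a + b + ?m * c) - \<mu> * N (z1 * a + c)
      = (\<sigma> a * b - \<mu> * N c) + N a * (y1 - \<mu> * N z1) - (?s + \<sigma> ?s)"
    by (simp add: conj_add conj_mult algebra_simps)
  also have "\<dots> \<in> R" by (intro R_closed(3,4,6) abc(3) y1 norm_in trace_in)
  finally have "pt a (y1 * a + b + ?m * c) (z1 * a + c) \<in> Hm \<mu>"
    using abc(2) by (intro pt_in_HmI) auto
  then show ?thesis by (simp add: abc(1) act_mat3)
qed

lemma move_to_zero:
  assumes "\<mu> \<notin> R" "P \<in> Hm \<mu>" "P \<noteq> pt 0 1 0"
  shows "\<exists>M. invertible M \<and> (\<forall>S\<in>Hm \<mu>. act M S \<in> Hm \<mu>) \<and> act M P = pt 1 0 0 \<and>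
    act M (pt 0 1 0) = pt 0 1 0"
proof -
  obtain y z where P: "P = pt 1 y z" "y - \<mu> * N z \<in> R"
    using Hm_cases[OF assms(1,2)] assms(3) by metis
  let ?m = "(\<mu> - \<sigma> \<mu>) * \<sigma> (- z)"
  let ?y1 = "- y - ?m * z"
  let ?M = "mat3 1 0 0 ?y1 1 ?m (- z) 0 1"
  have "?y1 - \<mu> * N (- z) = - (y - \<mu> * N z) - (\<mu> + \<sigma> \<mu>) * N z"
    by (simp add: conj_minus algebra_simps)
  also have "\<dots> \<in> R" by (intro R_closed(4,5,6) P(2) trace_in norm_in)
  finally have "\<forall>S\<in>Hm \<mu>. act ?M S \<in> Hm \<mu>" using heisenberg_Hm by blast
  moreover have "invertible ?M" by (simp add: invertible_mat3)
  moreover have "act ?M P = pt 1 0 0" by (simp add: P(1) act_mat3)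
  moreover have "act ?M (pt 0 1 0) = pt 0 1 0" by (simp add: act_mat3)
  ultimately show ?thesis by blast
qed

lemma move_to_inf:
  assumes "\<mu> \<notin> R" "P \<in> Hm \<mu>"
  shows "\<exists>M \<mu>'. invertible M \<and> \<mu>' \<notin> R \<and> (\<forall>S\<in>Hm \<mu>. act M S \<in> Hm \<mu>') \<and> act M P = pt 0 1 0"
proof (cases "P = pt 0 1 0")
  case True
  have "invertible (mat 1 :: 'c^3^3)" by (simp add: invertible_det_nz)
  then show ?thesis using True assms(1) by (intro exI[of _ "mat 1"] exI[of _ \<mu>]) simp
next
  case False
  obtain M where M: "invertible M" "\<forall>S\<in>Hm \<mu>. act M S \<in> Hm \<mu>" "act M P = pt 1 0 0"
    using move_to_zero[OF assms False] by blast
  have "invertible (swap_mat ** M)" by (rule invertible_mult[OF invertible_swap M(1)])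
  moreover have "\<sigma> \<mu> \<notin> R" using assms(1) by (simp add: conj_in_R_iff)
  moreover have "\<forall>S\<in>Hm \<mu>. act (swap_mat ** M) S \<in> Hm (\<sigma> \<mu>)"
    using M(2) swap_Hm by (simp flip: act_act)
  moreover have "act (swap_mat ** M) P = pt 0 1 0" using M(3) by (simp flip: act_act)
  ultimately show ?thesis by blast
qed

text \<open>
  The Heisenberg group and the interchange of \<open>X\<close> and \<open>Y\<close> move \<open>P\<close> to \<open>[0,1,0]\<close> and \<open>Q\<close> to \<open>[1,0,0]\<close>. The remaining
  freedom consists of diagonal matrices: scaling \<open>Y\<close> moves \<open>I\<close> to \<open>[1,1,0]\<close>, and scaling \<open>Z\<close> makes the third
  coordinate of \<open>T\<close> equal to \<open>1\<close>.
\<close>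

lemma normal_position:
  assumes unital: "unital_set q U" and sub: "U \<subseteq> Hm \<mu>" and \<mu>: "\<mu> \<notin> R"
    and in_U: "P \<in> U" "Q \<in> U" "I \<in> U" "T \<in> U"
    and ne: "P \<noteq> Q" "I \<noteq> P" "I \<noteq> Q" and col: "col P Q I" "\<not> col P Q T"
  shows "\<exists>M u. invertible M \<and> normal_unital R \<sigma> q u (act M ` U) \<and> act M P = pt 0 1 0 \<and>
    act M Q = pt 1 0 0 \<and> act M I = pt 1 1 0 \<and> act M T = pt 1 u 1"
proof -
  obtain M1 \<mu>1 where M1: "invertible M1" "\<mu>1 \<notin> R" "\<And>S. S \<in> Hm \<mu> \<Longrightarrow> act M1 S \<in> Hm \<mu>1"
    "act M1 P = pt 0 1 0"
    using move_to_inf[OF \<mu>, of P] sub in_U by blast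
  have inj1: "act M1 S = act M1 S' \<longleftrightarrow> S = S'" for S S' using inj_act[OF M1(1)] by (auto dest: injD)
  have Q': "act M1 Q \<noteq> pt 0 1 0" using inj1[of Q P] M1(4) ne(1) by simp
  have "act M1 Q \<in> Hm \<mu>1" using M1(3) sub in_U by blast
  from move_to_zero[OF M1(2) this Q']
  obtain M2 where M2: "invertible M2" "\<forall>S\<in>Hm \<mu>1. act M2 S \<in> Hm \<mu>1"
    "act M2 (act M1 Q) = pt 1 0 0" "act M2 (pt 0 1 0) = pt 0 1 0"
    by (elim exE conjE) (rule that)
  define M where "M = M2 ** M1"
  have M: "invertible M" unfolding M_def by (rule invertible_mult[OF M2(1) M1(1)])
  have inj: "act M S = act M S' \<longleftrightarrow> S = S'" for S S' using inj_act[OF M] by (auto dest: injD)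
  have MHm: "act M S \<in> Hm \<mu>1" if "S \<in> U" for S
    using that sub M1(3) M2(2) unfolding M_def act_act[symmetric] by blast
  have MP: "act M P = pt 0 1 0" using M1(4) M2(4) by (simp add: M_def flip: act_act)
  have MQ: "act M Q = pt 1 0 0" using M2(3) by (simp add: M_def flip: act_act)
  have "act M I \<noteq> pt 0 1 0" using inj[of I P] MP ne by simp
  then obtain g z where g: "act M I = pt 1 g z" "g - \<mu>1 * N z \<in> R"
    using Hm_cases[OF M1(2) MHm[OF in_U(3)]] by blast
  have "col (pt 0 1 0) (pt 1 0 0) (pt 1 g z)"
    using col(1) act_col[OF M] unfolding MP[symmetric] MQ[symmetric] g(1)[symmetric] by simp
  then have z: "z = 0" by (simp add: col_inf_affine)
  have g0: "g \<noteq> 0" using inj[of I Q] ne MQ g(1) z by auto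
  have gR: "g \<in> R" using g(2) z by simp
  have "act M T \<noteq> pt 0 1 0"
  proof
    assume "act M T = pt 0 1 0"
    then have TP: "T = P" using inj[of T P] MP by simp
    have "P \<in> proj_points UNIV" "Q \<in> proj_points UNIV" using in_U unital by (auto simp: unital_set_def)
    then show False using col(2) TP by (auto simp: proj_points_def col_refl)
  qed
  then obtain y0 z0 where T: "act M T = pt 1 y0 z0" "y0 - \<mu>1 * N z0 \<in> R"
    using Hm_cases[OF M1(2) MHm[OF in_U(4)]] by blast
  have "\<not> col (pt 0 1 0) (pt 1 0 0) (pt 1 y0 z0)"
    using col(2) act_col[OF M] unfolding MP[symmetric] MQ[symmetric] T(1)[symmetric] by simp
  then have z0: "z0 \<noteq> 0" by (simp add: col_inf_affine)
  let ?D = "mat3 1 0 0 0 (1 / g) 0 0 0 (1 / z0)"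
  have D: "invertible ?D" using g0 z0 by (simp add: invertible_mat3)
  let ?u = "y0 / g"
  define \<mu>2 where "\<mu>2 = \<mu>1 * N z0 / g"
  have DHm: "act ?D S \<in> Hm \<mu>2" if S: "S \<in> Hm \<mu>1" for S
  proof -
    obtain x y z where xyz: "S = pt x y z" "x \<noteq> 0 \<or> y \<noteq> 0 \<or> z \<noteq> 0" "\<sigma> x * y - \<mu>1 * N z \<in> R"
      using S by (auto simp: Hm_def)
    have "\<sigma> x * (y / g) - \<mu>2 * N (z / z0) = (\<sigma> x * y - \<mu>1 * N z) / g"
      using z0 by (simp add: \<mu>2_def conj_divide diff_divide_distrib)
    also have "\<dots> \<in> R" by (rule R_closed(8)[OF xyz(3) gR])
    finally have "pt x (y / g) (z / z0) \<in> Hm \<mu>2" using xyz(2) g0 z0 by (intro pt_in_HmI) auto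
    then show ?thesis by (simp add: xyz(1) act_mat3)
  qed
  have u\<mu>: "?u - \<mu>2 = (y0 - \<mu>1 * N z0) / g" by (simp add: \<mu>2_def diff_divide_distrib)
  then have u\<mu>R: "?u - \<mu>2 \<in> R" using R_closed(8)[OF T(2) gR] by simp
  have "N z0 / g \<noteq> 0" using g0 z0 by simp
  moreover have "N z0 / g \<in> R" by (rule R_closed(8)[OF norm_in gR])
  ultimately have \<mu>2: "\<mu>2 \<notin> R"
    using subfield_multiple_outside[OF R M1(2), of "N z0 / g"] by (auto simp: \<mu>2_def)
  have u: "?u \<notin> R"
  proof
    assume "?u \<in> R"
    then have "?u - (?u - \<mu>2) \<in> R" using R_closed(6) u\<mu>R by blast
    then show False using \<mu>2 by simp
  qed
  have "\<mu>2 - ?u = - (?u - \<mu>2)" by simp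
  then have sub_u: "Hm \<mu>2 \<subseteq> Hm ?u" using Hm_cong R_closed(5)[OF u\<mu>R] by metis
  let ?M = "?D ** M"
  have inv: "invertible ?M" by (rule invertible_mult[OF D M])
  have pts: "act ?M P = pt 0 1 0" "act ?M Q = pt 1 0 0" "act ?M I = pt 1 1 0" "act ?M T = pt 1 ?u 1"
    using MP MQ g(1) T(1) z g0 z0 pt_scale[of "1 / g" 0 1 0]
    by (simp_all add: act_mat3 flip: act_act)
  have "normal_unital R \<sigma> q ?u (act ?M ` U)"
  proof
    show "unital_set q (act ?M ` U)" by (rule unital_set_act[OF inv unital])
    show "act ?M ` U \<subseteq> Hm ?u" using MHm DHm sub_u unfolding act_act[symmetric] by blast
    show "?u \<notin> R" by (rule u)
    show "pt 0 1 0 \<in> act ?M ` U" "pt 1 0 0 \<in> act ?M ` U" "pt 1 1 0 \<in> act ?M ` U" "pt 1 ?u 1 \<in> act ?M ` U"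
      using in_U unfolding pts[symmetric] by blast+
  qed
  then show ?thesis using inv pts by blast
qed

end

lemma unital_set_frame:
  assumes "unital_set q U"
  obtains P Q I T where "P \<in> U" "Q \<in> U" "I \<in> U" "T \<in> U" "P \<noteq> Q" "I \<noteq> P" "I \<noteq> Q"
    "col P Q I" "\<not> col P Q T"
proof -
  have q: "q \<ge> 2" "finite U" "card U = q^3 + 1" using assms by (auto simp: unital_set_def)
  have q3: "q < q^3" using power_strict_increasing[of 1 3 q] q(1) by simp
  then have "\<not> card U \<le> 1" using q by simp
  then obtain P Q where PQ: "P \<in> U" "Q \<in> U" "P \<noteq> Q"
    using card_le_Suc0_iff_eq[OF q(2)] by auto
  let ?L = "{S \<in> U. col P Q S}"
  have L: "card ?L = q + 1" using assms PQ unfolding unital_set_def by blast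
  have "card {P, Q} < card ?L" using L q(1) PQ(3) by simp
  then have "\<not> ?L \<subseteq> {P, Q}" using card_mono[of "{P, Q}" ?L] by auto
  then obtain I where I: "I \<in> U" "col P Q I" "I \<noteq> P" "I \<noteq> Q" by blast
  have "?L \<noteq> U" using L q(3) q3 by auto
  then obtain T where "T \<in> U" "\<not> col P Q T" by blast
  then show thesis using PQ I that by blast
qed

section \<open>Quadratic extensions\<close>

text \<open>
  Express \<open>1\<close> and \<open>e\<close> in a given basis. The determinant \<open>D\<close> of their coordinates is nonzero, since otherwise
  \<open>e\<close> would be a quotient of coordinates and thus lie in \<open>F\<close>; so the basis can be expressed by \<open>1\<close> and \<open>e\<close>.
\<close>

lemma quadratic_extension_basis:
  assumes ext: "quadratic_extension K F" and e: "e \<in> K" "e \<notin> F" and z: "z \<in> K"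
  shows "\<exists>x\<in>F. \<exists>y\<in>F. z = x + e * y"
proof -
  have F: "is_subfield F" and K: "is_subfield K" using ext by (auto simp: quadratic_extension_def)
  note F_closed = subfield_closed[OF F]
  have "\<exists>a\<in>K. \<exists>b\<in>K. \<forall>z\<in>K. \<exists>!c. c \<in> F \<times> F \<and> z = fst c * a + snd c * b"
    using ext by (simp only: quadratic_extension_def)
  then obtain a b where ab: "\<forall>z\<in>K. \<exists>!c. c \<in> F \<times> F \<and> z = fst c * a + snd c * b"
    by (elim bexE) (rule that)
  have rep: "\<exists>x\<in>F. \<exists>y\<in>F. z = x * a + y * b" if "z \<in> K" for z
    using ex1_implies_ex[OF bspec[OF ab that]] by auto
  obtain p q where pq: "p \<in> F" "q \<in> F" "1 = p * a + q * b"
    using rep[OF subfield_closed(2)[OF K]] by blast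
  obtain r s where rs: "r \<in> F" "s \<in> F" "e = r * a + s * b" using rep[OF e(1)] by blast
  obtain x y where xy: "x \<in> F" "y \<in> F" "z = x * a + y * b" using rep[OF z] by blast
  define D where "D = p * s - q * r"
  have Da: "D * a = s - q * e" and Db: "D * b = p * e - r"
  proof -
    have "s - q * e = s * 1 - q * e" by simp
    also have "\<dots> = D * a" unfolding pq(3) rs(3) D_def by (simp add: algebra_simps)
    finally show "D * a = s - q * e" by simp
    have "p * e - r = p * e - r * 1" by simp
    also have "\<dots> = D * b" unfolding pq(3) rs(3) D_def by (simp add: algebra_simps)
    finally show "D * b = p * e - r" by simp
  qed
  have D: "D \<noteq> 0"
  proof
    assume "D = 0"
    then have z: "q * e = s" "p * e = r" using Da Db by simp_all
    show False
    proof (cases "p = 0")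
      case False
      then have "e = r / p" using z by (simp add: field_simps)
      then show False using F_closed(8) rs pq e by blast
    next
      case True
      then have "q \<noteq> 0" using pq(3) by auto
      then have "e = s / q" using z by (simp add: field_simps)
      then show False using F_closed(8) rs pq e by blast
    qed
  qed
  have "D * z = x * (D * a) + y * (D * b)" unfolding xy(3) by (simp add: algebra_simps)
  also have "\<dots> = (x * s - y * r) + e * (y * p - x * q)" unfolding Da Db by (simp add: algebra_simps)
  finally have "z = ((x * s - y * r) + e * (y * p - x * q)) / D" using D by (simp add: field_simps)
  then have "z = (x * s - y * r) / D + e * ((y * p - x * q) / D)" by (simp add: add_divide_distrib)
  moreover have "D \<in> F" unfolding D_def using pq rs F_closed by simp
  moreover have "(x * s - y * r) / D \<in> F" "(y * p - x * q) / D \<in> F"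
    using calculation(2) xy pq rs F_closed(4,6,8) by simp_all
  ultimately show ?thesis by blast
qed

lemma quadratic_extensionI:
  assumes K: "is_subfield K" and F: "is_subfield F" and sub: "F \<subseteq> K" and e: "e \<in> K" "e \<notin> F"
    and rep: "\<And>z. z \<in> K \<Longrightarrow> \<exists>x\<in>F. \<exists>y\<in>F. z = x + y * e"
  shows "quadratic_extension K F"
proof -
  have "\<exists>!c. c \<in> F \<times> F \<and> z = fst c * 1 + snd c * e" if "z \<in> K" for z
  proof -
    obtain x y where xy: "x \<in> F" "y \<in> F" "z = x + y * e" using rep \<open>z \<in> K\<close> by blast
    show ?thesis
    proof (rule ex1I[of _ "(x, y)"])
      fix c assume c: "c \<in> F \<times> F \<and> z = fst c * 1 + snd c * e"
      then have "e * (snd c - y) = x - fst c" using xy(3) by (simp add: algebra_simps)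
      moreover have "x - fst c \<in> F" "snd c - y \<in> F" using c xy subfield_closed(6)[OF F] by auto
      ultimately have "snd c - y = 0" using subfield_multiple_outside[OF F e(2)] by metis
      then show "c = (x, y)" using c xy(3) by (simp add: prod_eq_iff)
    qed (use xy in simp)
  qed
  then show ?thesis using assms subfield_closed(2)[OF K] unfolding quadratic_extension_def by blast
qed

text \<open>
  The conjugate of \<open>e\<close> is recognized by having trace and norm in \<open>F\<close>, because \<open>e\<^sup>2 - (e + s) e + es = 0\<close> and the
  coefficients of such an equation are unique.
\<close>

lemma ext_conj_eq:
  assumes F: "is_subfield F" and e: "e \<notin> F" and s: "e + s \<in> F" "e * s \<in> F"
    and xy: "x \<in> F" "y \<in> F"
  shows "ext_conj F e (x + e * y) = x + s * y"
proof -
  note F_closed = subfield_closed[OF F]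
  have uniq: "x = x' \<and> y = y'" if "x \<in> F" "y \<in> F" "x' \<in> F" "y' \<in> F" "x + e * y = x' + e * y'" for x y x' y'
  proof -
    have e1: "e * (y - y') = x' - x" using that(5) by (simp add: algebra_simps)
    have "x' - x \<in> F" "y - y' \<in> F" using that F_closed(6) by auto
    then have "y - y' = 0" using subfield_multiple_outside[OF F e] e1 by metis
    then show ?thesis using that(5) by simp
  qed
  have t: "ext_t F e = e + s"
    unfolding ext_t_def
  proof (rule the_equality)
    have "e\<^sup>2 - (e + s) * e + e * s = 0" by (simp add: algebra_simps power2_eq_square)
    then show "e + s \<in> F \<and> (\<exists>d\<in>F. e\<^sup>2 - (e + s) * e + d = 0)" using s by blast
    fix t assume "t \<in> F \<and> (\<exists>d\<in>F. e\<^sup>2 - t * e + d = 0)"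
    then obtain d where d: "t \<in> F" "d \<in> F" "e\<^sup>2 - t * e + d = 0" by blast
    have "d + e * (e + s) = (e\<^sup>2 - t * e + d) + (e * s + e * t)"
      by (simp add: algebra_simps power2_eq_square)
    then have "d + e * (e + s) = e * s + e * t" using d(3) by simp
    then show "t = e + s" using uniq[OF d(2) s(1) s(2) d(1)] by simp
  qed
  show ?thesis
    unfolding ext_conj_def t
  proof (rule the_equality)
    have "x + s * y = x + (e + s) * y - e * y" by (simp add: algebra_simps)
    then show "\<exists>x'\<in>F. \<exists>y'\<in>F. x + e * y = x' + e * y' \<and> x + s * y = x' + (e + s) * y' - e * y'"
      using xy by blast
    fix w assume "\<exists>x'\<in>F. \<exists>y'\<in>F. x + e * y = x' + e * y' \<and> w = x' + (e + s) * y' - e * y'"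
    then obtain x' y' where xy': "x' \<in> F" "y' \<in> F" "x + e * y = x' + e * y'" "w = x' + (e + s) * y' - e * y'"
      by blast
    have "x = x' \<and> y = y'" by (rule uniq) (use xy xy' in auto)
    then show "w = x + s * y" using xy'(4) by (simp add: algebra_simps)
  qed
qed

text \<open>
  With \<open>\<epsilon>\<^sup>2 = m + t \<epsilon>\<close>, the element \<open>s = t - \<epsilon>\<close> is the other root of the same equation, so
  \<open>x + \<epsilon>y \<mapsto> x + sy\<close> is multiplicative. In the inseparable case \<open>s = \<epsilon>\<close>.
\<close>

lemma field_conj_ext_conj:
  assumes ext: "quadratic_extension (UNIV :: 'c::field set) R" and \<epsilon>: "\<epsilon> \<notin> R"
  shows "field_conj R (ext_conj R \<epsilon>)"
proof -
  have R: "is_subfield R" using ext by (simp add: quadratic_extension_def)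
  note R_closed = subfield_closed[OF R]
  have rep: "\<exists>x\<in>R. \<exists>y\<in>R. z = x + \<epsilon> * y" for z
    by (rule quadratic_extension_basis[OF ext _ \<epsilon>]) simp_all
  obtain m t where mt: "m \<in> R" "t \<in> R" "\<epsilon> * \<epsilon> = m + \<epsilon> * t" using rep by blast
  define s where "s = t - \<epsilon>"
  have s1: "\<epsilon> + s = t" by (simp add: s_def)
  have "\<epsilon> * s = \<epsilon> * t - \<epsilon> * \<epsilon>" by (simp add: s_def algebra_simps)
  then have s2: "\<epsilon> * s = - m" using mt(3) by simp
  have s_in: "\<epsilon> + s \<in> R" "\<epsilon> * s \<in> R" using s1 s2 mt R_closed(5) by simp_all
  have c: "ext_conj R \<epsilon> (x + \<epsilon> * y) = x + s * y" if "x \<in> R" "y \<in> R" for x y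
    by (rule ext_conj_eq[OF R \<epsilon> s_in that])
  have ss: "s * s = m + s * t"
    using mt(3) by (simp add: s_def algebra_simps)
  show ?thesis
  proof
    show "is_subfield R" by (rule R)
  next
    fix z w
    obtain x y where z: "x \<in> R" "y \<in> R" "z = x + \<epsilon> * y" using rep by blast
    obtain x' y' where w: "x' \<in> R" "y' \<in> R" "w = x' + \<epsilon> * y'" using rep by blast
    have cz: "ext_conj R \<epsilon> z = x + s * y" unfolding z(3) by (rule c[OF z(1,2)])
    have cw: "ext_conj R \<epsilon> w = x' + s * y'" unfolding w(3) by (rule c[OF w(1,2)])
    have e: "z + w = (x + x') + \<epsilon> * (y + y')" using z w by (simp add: algebra_simps)
    have "ext_conj R \<epsilon> (z + w) = (x + x') + s * (y + y')"
      unfolding e by (rule c) (use R_closed(3) z w in simp_all)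
    then show "ext_conj R \<epsilon> (z + w) = ext_conj R \<epsilon> z + ext_conj R \<epsilon> w"
      unfolding cz cw by (simp add: algebra_simps)
    have "z * w = (x * x') + \<epsilon> * (x * y' + y * x') + (\<epsilon> * \<epsilon>) * (y * y')"
      using z w by (simp add: algebra_simps)
    also have "\<dots> = (x * x' + m * (y * y')) + \<epsilon> * (x * y' + y * x' + t * (y * y'))"
      unfolding mt(3) by (simp add: algebra_simps)
    finally have e: "z * w = (x * x' + m * (y * y')) + \<epsilon> * (x * y' + y * x' + t * (y * y'))" .
    have "ext_conj R \<epsilon> (z * w) = (x * x' + m * (y * y')) + s * (x * y' + y * x' + t * (y * y'))"
      unfolding e by (rule c) (use R_closed(3,4) z w mt(1,2) in simp_all)
    also have "\<dots> = (x * x') + s * (x * y' + y * x') + (s * s) * (y * y')"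
      unfolding ss by (simp add: algebra_simps)
    also have "\<dots> = (x + s * y) * (x' + s * y')" by (simp add: algebra_simps)
    finally show "ext_conj R \<epsilon> (z * w) = ext_conj R \<epsilon> z * ext_conj R \<epsilon> w"
      unfolding cz cw .
  next
    fix z
    obtain x y where z: "x \<in> R" "y \<in> R" "z = x + \<epsilon> * y" using rep by blast
    have cz: "ext_conj R \<epsilon> z = x + s * y" using c z by simp
    have e: "x + s * y = (x + t * y) + \<epsilon> * (- y)" by (simp add: s_def algebra_simps)
    have "ext_conj R \<epsilon> (x + s * y) = (x + t * y) + s * (- y)"
      unfolding e by (rule c) (use R_closed(3,4,5) z mt(2) in simp_all)
    then show "ext_conj R \<epsilon> (ext_conj R \<epsilon> z) = z"
      unfolding cz by (simp add: z(3) s_def algebra_simps)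
    have "z + ext_conj R \<epsilon> z = (x + x) + t * y"
      unfolding cz by (simp add: z(3) s_def algebra_simps)
    moreover have "(x + x) + t * y \<in> R" by (intro R_closed(3,4) z mt)
    ultimately show "z + ext_conj R \<epsilon> z \<in> R" by (simp only:)
    have "z * ext_conj R \<epsilon> z = x * x + x * y * (\<epsilon> + s) + y * y * (\<epsilon> * s)"
      unfolding cz by (simp add: z(3) algebra_simps)
    moreover have "x * x + x * y * (\<epsilon> + s) + y * y * (\<epsilon> * s) \<in> R" by (intro R_closed(3,4) z s_in)
    ultimately show "z * ext_conj R \<epsilon> z \<in> R" by (simp only:)
  next
    fix r assume r: "r \<in> R"
    show "ext_conj R \<epsilon> r = r" using c[OF r R_closed(1)] by simp
  qed
qed

text \<open>
  Every \<open>z = x + yu\<close> is a root of a quadratic polynomial whose other root is \<open>z' = x + y(t - u)\<close>. If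
  \<open>y \<noteq> 0\<close>, its discriminant \<open>(z - z')\<^sup>2\<close> does not vanish.
\<close>

lemma separable_extensionI:
  assumes F: "is_subfield F" and td: "t \<in> F" "d \<in> F" and u: "u\<^sup>2 = t * u - d" "u \<noteq> t - u"
    and rep: "\<And>z. z \<in> K \<Longrightarrow> \<exists>x\<in>F. \<exists>y\<in>F. z = x + y * u"
  shows "separable_extension K F"
  unfolding separable_extension_def
proof
  fix z assume "z \<in> K"
  then obtain x y where xy: "x \<in> F" "y \<in> F" "z = x + y * u" using rep by blast
  note F_closed = subfield_closed[OF F]
  show "\<exists>p. (\<forall>i. coeff p i \<in> F) \<and> poly p z = 0 \<and> coprime p (pderiv p)"
  proof (cases "y = 0")
    case True
    have "coeff [:- z, 1:] i \<in> F" for i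
      using xy True F_closed by (auto simp: coeff_pCons split: nat.split)
    moreover have "pderiv [:- z, 1:] = 1" by (simp add: pderiv_pCons)
    ultimately show ?thesis by (intro exI[of _ "[:- z, 1:]"]) simp
  next
    case False
    define z' where "z' = x + y * (t - u)"
    let ?p = "[:z * z', - (z + z'), 1:]"
    have "z * z' = x * x + x * y * t + y * y * (t * u - u\<^sup>2)"
      by (simp add: xy(3) z'_def algebra_simps power2_eq_square)
    then have "z * z' = x * x + x * y * t + y * y * d" using u(1) by simp
    moreover have "x * x + x * y * t + y * y * d \<in> F" by (intro F_closed(3,4) xy td)
    ultimately have n: "z * z' \<in> F" by (simp only:)
    have "z + z' = x + x + y * t" by (simp add: xy(3) z'_def algebra_simps)
    moreover have "x + x + y * t \<in> F" by (intro F_closed(3,4) xy td)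
    ultimately have s: "z + z' \<in> F" by (simp only:)
    have "- (z + z') \<in> F" by (rule F_closed(5)[OF s])
    then have "coeff ?p i \<in> F" for i
      using n F_closed(1,2) by (auto simp: coeff_pCons split: nat.split simp del: minus_add_distrib)
    moreover have "poly ?p z = 0" by (simp add: algebra_simps)
    moreover have "coprime ?p (pderiv ?p)"
    proof (rule coprimeI)
      fix g assume g: "g dvd ?p" "g dvd pderiv ?p"
      \<comment> \<open>the discriminant as a combination of the polynomial and its derivative\<close>
      have "pderiv ?p * pderiv ?p - [:4:] * ?p = [:(z - z') * (z - z'):]"
        by (simp add: pderiv_pCons algebra_simps)
      then have "g dvd [:(z - z') * (z - z'):]" using g by (metis dvd_diff dvd_mult dvd_mult2)
      moreover have "z - z' = y * (u - (t - u))" by (simp add: xy(3) z'_def algebra_simps)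
      then have "z - z' \<noteq> 0" using False u(2) by simp
      then have "is_unit [:(z - z') * (z - z'):]" by (simp add: is_unit_const_poly_iff dvd_field_iff)
      ultimately show "is_unit g" by (rule dvd_trans)
    qed
    ultimately show ?thesis by blast
  qed
qed

context normal_unital
begin

text \<open>
  Otherwise \<open>2u\<close> and \<open>u\<^sup>2\<close> would lie in \<open>F\<close>. If \<open>2 \<noteq> 0\<close>, this gives \<open>u \<in> F\<close>; if \<open>2 = 0\<close>, then
  \<open>u\<close> is the square root of an element of the finite, hence perfect, field \<open>F\<close>.
\<close>

lemma u_neq_conj: "u \<noteq> \<sigma> u"
proof
  assume e: "u = \<sigma> u"
  have 2: "2 * u \<in> F" using trace_u_in_F unfolding e[symmetric] by (simp only: mult_2)
  have usq: "u * u \<in> F" using norm_u_in_F unfolding e[symmetric] .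
  show False
  proof (cases "(2::'a) = 0")
    case False
    have "u = (2 * u) / 2" using False by simp
    moreover have "(2::'a) \<in> F" using F_closed(3)[OF F_closed(2,2)] by simp
    ultimately have "u \<in> F" using 2 F_closed(8) by metis
    then show False using u_notin_F by simp
  next
    case True
    have "inj_on (\<lambda>a. a * a) F" using square_inj_char2[OF True] by (auto intro: inj_onI)
    then have "(\<lambda>a. a * a) ` F = F" by (intro endo_inj_surj) (use F_closed(4) in auto)
    then obtain f where f: "f \<in> F" "u * u = f * f" using usq by auto
    then have "u = f" using square_inj_char2[OF True] by blast
    then show False using f u_notin_F by simp
  qed
qed

lemma quadratic_E: "quadratic_extension E F"
  by (rule quadratic_extensionI[OF subfield_E subfield_F F_sub_E u_in_E u_notin_F]) (auto simp: E_def)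

lemma separable_E: "separable_extension E F"
  by (rule separable_extensionI[OF subfield_F trace_u_in_F norm_u_in_F u_square])
    (use u_neq_conj in \<open>auto simp: E_def\<close>)

lemma separable_UNIV:
  assumes "quadratic_extension UNIV R"
  shows "separable_extension UNIV R"
proof (rule separable_extensionI[OF R trace_in norm_in u_square])
  show "u \<noteq> u + \<sigma> u - u" using u_neq_conj by simp
  show "\<exists>x\<in>R. \<exists>y\<in>R. z = x + y * u" for z
    using quadratic_extension_basis[OF assms _ u, of z] by (simp add: mult.commute)
qed

lemma ext_conj_E:
  assumes e: "e \<in> E - F" and z: "z \<in> E"
  shows "ext_conj F e z = \<sigma> z"
proof -
  obtain x y where xy: "x \<in> F" "y \<in> F" "z = x + e * y"
    using quadratic_extension_basis[OF quadratic_E, of e z] e z by blast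
  have "ext_conj F e z = x + \<sigma> e * y"
    unfolding xy(3) using ext_conj_eq[OF subfield_F _ trace_E norm_E xy(1,2), of e] e by blast
  also have "\<dots> = \<sigma> z" using xy conj_F by (simp add: conj_add conj_mult)
  finally show ?thesis .
qed

text \<open>
  \<open>affine_iff\<close> in homogeneous coordinates, multiplied by \<open>N(x) \<in> F\<close>.
\<close>

lemma mem_U_iff:
  assumes xyz: "x \<in> E" "y \<in> E" "z \<in> E" "x \<noteq> 0 \<or> y \<noteq> 0 \<or> z \<noteq> 0"
  shows "pt x y z \<in> U \<longleftrightarrow> \<sigma> x * y - u * N z \<in> F"
proof (cases "x = 0")
  case True
  have "pt 0 y z \<in> U \<longleftrightarrow> z = 0"
  proof
    assume "pt 0 y z \<in> U"
    then show "z = 0"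
    proof (cases rule: point_cases)
      case 1
      then show ?thesis by (auto dest: pt_eqD)
    next
      case (2 y' z')
      then show ?thesis by (auto dest: pt_eqD)
    qed
  next
    assume "z = 0"
    then have "y \<noteq> 0" using xyz True by simp
    then show "pt 0 y z \<in> U" using pt_scale[of y 0 1 0] inf_in \<open>z = 0\<close> by simp
  qed
  moreover have "\<sigma> x * y - u * N z \<in> F \<longleftrightarrow> z = 0"
  proof
    assume "\<sigma> x * y - u * N z \<in> F"
    then have "u * (- N z) \<in> F" using True by simp
    moreover have "- N z \<in> F" using norm_E[OF xyz(3)] F_closed(5) by blast
    ultimately have "- N z = 0" using subfield_multiple_outside[OF subfield_F u_notin_F] by blast
    then show "z = 0" by simp
  qed (use True F_closed in simp)
  ultimately show ?thesis using True by simp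
next
  case False
  have "pt x y z \<in> U \<longleftrightarrow> (y / x, z / x) \<in> affine" by (simp add: pt_affine[OF False] affine_def)
  also have "\<dots> \<longleftrightarrow> y / x - u * N (z / x) \<in> F" using E_closed(8) xyz affine_iff by blast
  also have "y / x - u * N (z / x) = (\<sigma> x * y - u * N z) / N x"
    using False by (simp add: conj_divide diff_divide_distrib)
  also have "\<dots> \<in> F \<longleftrightarrow> \<sigma> x * y - u * N z \<in> F"
  proof
    assume "(\<sigma> x * y - u * N z) / N x \<in> F"
    then have "(\<sigma> x * y - u * N z) / N x * N x \<in> F" using F_closed(4) norm_E[OF xyz(1)] by blast
    then show "\<sigma> x * y - u * N z \<in> F" using False by simp
  qed (use F_closed(8) norm_E[OF xyz(1)] in blast)
  finally show ?thesis .
qed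

end

section \<open>Blocks and collinearity\<close>

text \<open>
  Cramer's rule for the first two coordinates; the vanishing determinant carries the solution over to the
  third.
\<close>

lemma cramer_scalar:
  fixes p1 :: "'c::field"
  assumes m: "p1 * q2 - p2 * q1 \<noteq> 0"
    and det: "p1 * (q2 * r3 - q3 * r2) - p2 * (q1 * r3 - q3 * r1) + p3 * (q1 * r2 - q2 * r1) = 0"
  shows "r1 = (r1 * q2 - r2 * q1) / (p1 * q2 - p2 * q1) * p1 + (p1 * r2 - p2 * r1) / (p1 * q2 - p2 * q1) * q1"
    and "r2 = (r1 * q2 - r2 * q1) / (p1 * q2 - p2 * q1) * p2 + (p1 * r2 - p2 * r1) / (p1 * q2 - p2 * q1) * q2"
    and "r3 = (r1 * q2 - r2 * q1) / (p1 * q2 - p2 * q1) * p3 + (p1 * r2 - p2 * r1) / (p1 * q2 - p2 * q1) * q3"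
proof -
  let ?m = "p1 * q2 - p2 * q1"
  have combine': "r = x / n * p + y / n * q" if "n \<noteq> 0" "r * n = x * p + y * q" for n r x y p q :: 'c
    using that by (simp add: field_simps)
  note combine = combine'[OF m]
  show "r1 = (r1 * q2 - r2 * q1) / ?m * p1 + (p1 * r2 - p2 * r1) / ?m * q1"
    by (rule combine) (simp add: algebra_simps)
  show "r2 = (r1 * q2 - r2 * q1) / ?m * p2 + (p1 * r2 - p2 * r1) / ?m * q2"
    by (rule combine) (simp add: algebra_simps)
  show "r3 = (r1 * q2 - r2 * q1) / ?m * p3 + (p1 * r2 - p2 * r1) / ?m * q3"
  proof (rule combine)
    have "r3 * ?m - ((r1 * q2 - r2 * q1) * p3 + (p1 * r2 - p2 * r1) * q3)
        = p1 * (q2 * r3 - q3 * r2) - p2 * (q1 * r3 - q3 * r1) + p3 * (q1 * r2 - q2 * r1)"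
      by (simp add: algebra_simps)
    then show "r3 * ?m = (r1 * q2 - r2 * q1) * p3 + (p1 * r2 - p2 * r1) * q3" using det by simp
  qed
qed

lemma distinct_points_indep:
  assumes K: "is_subfield K" and pq: "p \<noteq> 0" "q \<noteq> 0" "proj_point K p \<noteq> proj_point K q"
  shows "lin_indep2 K p q"
  unfolding lin_indep2_def
proof (intro ballI impI)
  fix a b assume ab: "a \<in> K" "b \<in> K" "a *s p + b *s q = 0"
  have b0: "a = 0" if "b = 0"
    using ab(3) that pq(1) by (auto simp: vec3_eq_iff)
  have "b = 0"
  proof (rule ccontr)
    assume b: "b \<noteq> 0"
    have a: "a \<noteq> 0" using ab(3) b pq(2) by (auto simp: vec3_eq_iff)
    have "- (a / b) * p $ i = q $ i" for i
    proof -
      have "a * p $ i + b * q $ i = 0" using arg_cong[OF ab(3), of "\<lambda>v. v $ i"] by simp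
      then have e: "b * q $ i = - (a * p $ i)" by (simp add: eq_neg_iff_add_eq_0 add.commute)
      have "q $ i = (b * q $ i) / b" using b by simp
      also have "\<dots> = - (a / b) * p $ i" unfolding e by simp
      finally show ?thesis by simp
    qed
    then have q: "q = (- (a / b)) *s p" by (simp add: vec_eq_iff)
    have "proj_point K q = proj_point K p"
      unfolding q by (rule proj_point_scale[OF K]) (use a b ab subfield_closed(5,8)[OF K] in auto)
    then show False using pq(3) by simp
  qed
  then show "a = 0 \<and> b = 0" using b0 by simp
qed

text \<open>
  The coefficients are quotients of minors, so they stay in the subfield \<open>K\<close>. This makes collinearity over \<open>K\<close>
  the same as collinearity over the ambient field.
\<close>

lemma span_of_collinear:
  assumes K: "is_subfield K" and v: "p \<in> vecs3 K" "q \<in> vecs3 K" "r \<in> vecs3 K"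
    and ne: "p \<noteq> 0" "q \<noteq> 0" "proj_point K p \<noteq> proj_point K q" and det: "det3 p q r = 0"
  shows "\<exists>a\<in>K. \<exists>b\<in>K. r = a *s p + b *s q"
proof -
  note K_closed = subfield_closed[OF K]
  have in_K: "p $ i \<in> K" "q $ i \<in> K" "r $ i \<in> K" for i using v by (auto simp: vecs3_def)
  have det': "p$1 * (q$2 * r$3 - q$3 * r$2) - p$2 * (q$1 * r$3 - q$3 * r$1)
      + p$3 * (q$1 * r$2 - q$2 * r$1) = 0"
    using det by (simp add: det3_def)
  have key: "\<exists>a\<in>K. \<exists>b\<in>K. r = a *s p + b *s q"
    if m: "p$i * q$j - p$j * q$i \<noteq> 0"
      and d: "p$i * (q$j * r$k - q$k * r$j) - p$j * (q$i * r$k - q$k * r$i) + p$k * (q$i * r$j - q$j * r$i) = 0"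
      and ijk: "\<And>l. l = i \<or> l = j \<or> l = k" for i j k :: 3
  proof -
    let ?m = "p$i * q$j - p$j * q$i"
    let ?a = "(r$i * q$j - r$j * q$i) / ?m" and ?b = "(p$i * r$j - p$j * r$i) / ?m"
    have comp: "r $ l = ?a * p $ l + ?b * q $ l" for l
      using ijk[of l]
    proof (elim disjE)
      show ?thesis if "l = i" unfolding that by (rule cramer_scalar(1)[OF m d])
      show ?thesis if "l = j" unfolding that by (rule cramer_scalar(2)[OF m d])
      show ?thesis if "l = k" unfolding that by (rule cramer_scalar(3)[OF m d])
    qed
    have "r = ?a *s p + ?b *s q"
      unfolding vec_eq_iff vector_add_component vector_smult_component using comp by (rule allI)
    moreover have "?a \<in> K" "?b \<in> K" by (intro K_closed(4,6,8) in_K)+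
    ultimately show ?thesis by blast
  qed
  have all: "l = 1 \<or> l = 2 \<or> l = 3" for l :: 3 by (rule exhaust_3)
  consider "p$1 * q$2 - p$2 * q$1 \<noteq> 0" | "p$2 * q$3 - p$3 * q$2 \<noteq> 0" | "p$1 * q$3 - p$3 * q$1 \<noteq> 0"
    | "p$1 * q$2 - p$2 * q$1 = 0" "p$2 * q$3 - p$3 * q$2 = 0" "p$1 * q$3 - p$3 * q$1 = 0" by blast
  then show ?thesis
  proof cases
    case 1
    then show ?thesis by (rule key[OF _ det' all])
  next
    case 2
    have d: "p$2 * (q$3 * r$1 - q$1 * r$3) - p$3 * (q$2 * r$1 - q$1 * r$2) + p$1 * (q$2 * r$3 - q$3 * r$2) = 0"
      using det' by (simp add: algebra_simps)
    show ?thesis by (rule key[OF 2 d]) (use all in blast)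
  next
    case 3
    have "p$1 * (q$3 * r$2 - q$2 * r$3) - p$3 * (q$1 * r$2 - q$2 * r$1) + p$2 * (q$1 * r$3 - q$3 * r$1)
        = - (p$1 * (q$2 * r$3 - q$3 * r$2) - p$2 * (q$1 * r$3 - q$3 * r$1)
      + p$3 * (q$1 * r$2 - q$2 * r$1))"
      by (simp add: algebra_simps)
    then have d: "p$1 * (q$3 * r$2 - q$2 * r$3) - p$3 * (q$1 * r$2 - q$2 * r$1) + p$2 * (q$1 * r$3 - q$3 * r$1) = 0"
      using det' by simp
    show ?thesis by (rule key[OF 3 d]) (use all in blast)
  next
    case 4
    \<comment> \<open>all minors vanish, so the vectors are proportional\<close>
    have minor: "p$i * q$j = p$j * q$i" for i j :: 3
      using 4 all[of i] all[of j] by (elim disjE) (simp_all add: mult.commute)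
    obtain i where i: "p $ i \<noteq> 0" using ne(1) by (auto simp: vec_eq_iff)
    have "q $ i *s p + (- p $ i) *s q = 0"
      using minor[of i] by (simp add: vec_eq_iff mult.commute)
    moreover have "q $ i \<in> K" "- p $ i \<in> K" using in_K K_closed(5) by simp_all
    ultimately have "- p $ i = 0"
      using distinct_points_indep[OF K ne] unfolding lin_indep2_def by blast
    then show ?thesis using i by simp
  qed
qed

lemma det3_plane: "det3 (a *s u + b *s w) (c *s u + d *s w) (e *s u + f *s w) = 0"
  by (simp add: det3_def algebra_simps)

lemma line_col:
  assumes "L \<in> proj_lines K" "P \<in> L" "Q \<in> L" "S \<in> L"
  shows "col P Q S"
proof -
  obtain u w where L: "\<And>P v. P \<in> L \<Longrightarrow> v \<in> P \<Longrightarrow> \<exists>a b. v = a *s u + b *s w"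
    using assms(1) unfolding proj_lines_def by blast
  show ?thesis
    unfolding col_def
  proof (intro ballI)
    fix x y z assume "x \<in> P" "y \<in> Q" "z \<in> S"
    then obtain a b c d e f where "x = a *s u + b *s w" "y = c *s u + d *s w" "z = e *s u + f *s w"
      using L assms(2-4) by meson
    then show "det3 x y z = 0" by (simp only: det3_plane)
  qed
qed

lemma vector_in_point:
  assumes "is_subfield K"
  shows "v \<in> proj_point K v"
proof -
  have "v = 1 *s v" by (simp add: vec_eq_iff)
  then show ?thesis unfolding proj_point_def using subfield_closed(2)[OF assms] by blast
qed

lemma line_mem:
  assumes K: "is_subfield K" and L: "L \<in> proj_lines K" "P \<in> L" "Q \<in> L" "P \<noteq> Q"
    and S: "S \<in> proj_points K" "col P Q S"
  shows "S \<in> L"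
proof -
  note K_closed = subfield_closed[OF K]
  obtain u w where uw: "L = {P \<in> proj_points K. P \<subseteq> {a *s u + b *s w | a b. a \<in> K \<and> b \<in> K}}"
    using L(1) unfolding proj_lines_def by blast
  have "P \<in> proj_points K" "Q \<in> proj_points K" using L uw by auto
  then obtain p q where pq: "P = proj_point K p" "p \<in> vecs3 K" "p \<noteq> 0" "Q = proj_point K q" "q \<in> vecs3 K" "q \<noteq> 0"
    by (auto simp: proj_points_def)
  obtain r where r: "S = proj_point K r" "r \<in> vecs3 K" "r \<noteq> 0" using S(1) by (auto simp: proj_points_def)
  have "p \<in> P" "q \<in> Q" using vector_in_point[OF K] pq by simp_all
  then have "p \<in> {a *s u + b *s w | a b. a \<in> K \<and> b \<in> K}" "q \<in> {a *s u + b *s w | a b. a \<in> K \<and> b \<in> K}"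
    using L(2,3) uw by blast+
  then obtain a b c d where ab: "a \<in> K" "b \<in> K" "p = a *s u + b *s w" "c \<in> K" "d \<in> K" "q = c *s u + d *s w"
    by blast
  have "det3 p q r = 0" using S(2) pq(1,4) r(1) by (simp add: col_proj_point[OF K])
  then obtain x y where xy: "x \<in> K" "y \<in> K" "r = x *s p + y *s q"
    using span_of_collinear[OF K pq(2,5) r(2) pq(3,6)] L(4) pq(1,4) by auto
  have "k *s r = (k * (x * a + y * c)) *s u + (k * (x * b + y * d)) *s w" for k
    unfolding xy(3) ab(3,6) by (simp add: vec_eq_iff algebra_simps)
  moreover have "k * (x * a + y * c) \<in> K" "k * (x * b + y * d) \<in> K" if "k \<in> K" for k
    by (intro K_closed(3,4) that xy ab)+
  ultimately have "S \<subseteq> {a *s u + b *s w | a b. a \<in> K \<and> b \<in> K}"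
    unfolding r(1) proj_point_def by blast
  then show ?thesis using S(1) unfolding uw by simp
qed

lemma line_ex:
  assumes K: "is_subfield K" and PQ: "P \<in> proj_points K" "Q \<in> proj_points K" "P \<noteq> Q"
  shows "\<exists>L\<in>proj_lines K. P \<in> L \<and> Q \<in> L"
proof -
  note K_closed = subfield_closed[OF K]
  obtain p q where pq: "P = proj_point K p" "p \<in> vecs3 K" "p \<noteq> 0" "Q = proj_point K q" "q \<in> vecs3 K" "q \<noteq> 0"
    using PQ by (auto simp: proj_points_def)
  have ind: "lin_indep2 K p q" using distinct_points_indep[OF K pq(3,6)] PQ(3) pq(1,4) by simp
  let ?S = "{a *s p + b *s q | a b. a \<in> K \<and> b \<in> K}"
  have "{P \<in> proj_points K. P \<subseteq> ?S} \<in> proj_lines K"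
    unfolding proj_lines_def using pq(2,5) ind by blast
  moreover have S: "k *s p \<in> ?S" "k *s q \<in> ?S" if "k \<in> K" for k
  proof -
    have "k *s p = k *s p + 0 *s q" "k *s q = 0 *s p + k *s q" by (simp_all add: vec_eq_iff)
    then show "k *s p \<in> ?S" "k *s q \<in> ?S" using that K_closed(1) by blast+
  qed
  have "P \<subseteq> ?S"
  proof
    fix v assume "v \<in> P"
    then obtain k where "k \<in> K" "v = k *s p" unfolding pq(1) proj_point_def by blast
    then show "v \<in> ?S" using S(1) by simp
  qed
  moreover have "Q \<subseteq> ?S"
  proof
    fix v assume "v \<in> Q"
    then obtain k where "k \<in> K" "v = k *s q" unfolding pq(4) proj_point_def by blast
    then show "v \<in> ?S" using S(2) by simp
  qed
  ultimately have "P \<in> {P \<in> proj_points K. P \<subseteq> ?S}" "Q \<in> {P \<in> proj_points K. P \<subseteq> ?S}"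
    using PQ(1,2) by simp_all
  then show ?thesis using \<open>{P \<in> proj_points K. P \<subseteq> ?S} \<in> proj_lines K\<close> by (intro bexI conjI)
qed

text \<open>
  The incidence structures whose blocks are the sets of collinear points; for them isomorphisms
  amount to bijections of the points which preserve collinearity.
\<close>

locale collinearity_space =
  fixes T :: "(('c::field^3) set, 'b) incidence_structure"
  assumes col_diag: "P \<in> inc_points T \<Longrightarrow> S \<in> inc_points T \<Longrightarrow> col P P S"
    and two_points: "b \<in> inc_blocks T \<Longrightarrow>
      \<exists>P\<in>inc_points T. \<exists>Q\<in>inc_points T. P \<noteq> Q \<and> incident T P b \<and> incident T Q b"
    and joining: "P \<in> inc_points T \<Longrightarrow> Q \<in> inc_points T \<Longrightarrow> P \<noteq> Q \<Longrightarrow>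
      \<exists>b\<in>inc_blocks T. incident T P b \<and> incident T Q b"
    and incident_iff: "b \<in> inc_blocks T \<Longrightarrow> P \<in> inc_points T \<Longrightarrow> Q \<in> inc_points T \<Longrightarrow> S \<in> inc_points T \<Longrightarrow>
      P \<noteq> Q \<Longrightarrow> incident T P b \<Longrightarrow> incident T Q b \<Longrightarrow> incident T S b \<longleftrightarrow> col P Q S"
    and block_eqI: "b \<in> inc_blocks T \<Longrightarrow> b' \<in> inc_blocks T \<Longrightarrow>
      (\<And>P. P \<in> inc_points T \<Longrightarrow> incident T P b \<longleftrightarrow> incident T P b') \<Longrightarrow> b = b'"

lemma inc_isomorphism_col_iso:
  assumes T1: "collinearity_space T1" and T2: "collinearity_space T2"
    and iso: "inc_isomorphism \<alpha> \<beta> T1 T2"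
  shows "col_iso \<alpha> (inc_points T1) (inc_points T2)"
proof -
  have bij: "bij_betw \<alpha> (inc_points T1) (inc_points T2)" "bij_betw \<beta> (inc_blocks T1) (inc_blocks T2)"
    and inc: "\<And>x b. x \<in> inc_points T1 \<Longrightarrow> b \<in> inc_blocks T1 \<Longrightarrow> incident T1 x b \<longleftrightarrow> incident T2 (\<alpha> x) (\<beta> b)"
    using iso by (auto simp: inc_isomorphism_def)
  have "col (\<alpha> P) (\<alpha> Q) (\<alpha> S) \<longleftrightarrow> col P Q S"
    if P: "P \<in> inc_points T1" and Q: "Q \<in> inc_points T1" and S: "S \<in> inc_points T1" for P Q S
  proof (cases "P = Q")
    case True
    then show ?thesis
      using collinearity_space.col_diag[OF T1 P S]
        collinearity_space.col_diag[OF T2 bij_betw_apply[OF bij(1) P] bij_betw_apply[OF bij(1) S]] by simp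
  next
    case False
    obtain b where b: "b \<in> inc_blocks T1" "incident T1 P b" "incident T1 Q b"
      using collinearity_space.joining[OF T1 P Q False] by blast
    have ne: "\<alpha> P \<noteq> \<alpha> Q" using inj_onD[OF bij_betw_imp_inj_on[OF bij(1)] _ P Q] False by blast
    have "col P Q S \<longleftrightarrow> incident T1 S b"
      using collinearity_space.incident_iff[OF T1 b(1) P Q S False b(2,3)] by simp
    also have "\<dots> \<longleftrightarrow> incident T2 (\<alpha> S) (\<beta> b)" by (rule inc[OF S b(1)])
    also have "\<dots> \<longleftrightarrow> col (\<alpha> P) (\<alpha> Q) (\<alpha> S)"
      by (rule collinearity_space.incident_iff[OF T2 bij_betw_apply[OF bij(2) b(1)] bij_betw_apply[OF bij(1) P]
            bij_betw_apply[OF bij(1) Q] bij_betw_apply[OF bij(1) S] ne])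
        (use inc P Q b in blast)+
    finally show ?thesis by simp
  qed
  then show ?thesis using bij(1) by (simp add: col_iso_def)
qed

lemma col_iso_inc_isomorphism:
  assumes T1: "collinearity_space T1" and T2: "collinearity_space T2"
    and iso: "col_iso \<alpha> (inc_points T1) (inc_points T2)"
  shows "\<exists>\<beta>. inc_isomorphism \<alpha> \<beta> T1 T2"
proof -
  have bij: "bij_betw \<alpha> (inc_points T1) (inc_points T2)" using iso by (simp add: col_iso_def)
  have \<alpha>_in: "\<alpha> P \<in> inc_points T2" if "P \<in> inc_points T1" for P using bij that by (rule bij_betw_apply)
  have \<alpha>_ne: "\<alpha> P \<noteq> \<alpha> Q" if "P \<in> inc_points T1" "Q \<in> inc_points T1" "P \<noteq> Q" for P Q
    using inj_onD[OF bij_betw_imp_inj_on[OF bij] _ that(1,2)] that(3) by blast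
  have \<alpha>_col: "col (\<alpha> P) (\<alpha> Q) (\<alpha> S) \<longleftrightarrow> col P Q S"
    if "P \<in> inc_points T1" "Q \<in> inc_points T1" "S \<in> inc_points T1" for P Q S
    using iso that by (simp add: col_iso_def)
  have match: "incident T1 S b \<longleftrightarrow> incident T2 (\<alpha> S) c"
    if b: "b \<in> inc_blocks T1" "c \<in> inc_blocks T2" and P: "P \<in> inc_points T1" "Q \<in> inc_points T1" "P \<noteq> Q"
      and inc: "incident T1 P b" "incident T1 Q b" "incident T2 (\<alpha> P) c" "incident T2 (\<alpha> Q) c"
      and S: "S \<in> inc_points T1" for b c P Q S
    using collinearity_space.incident_iff[OF T1 b(1) P(1,2) S P(3) inc(1,2)]
      collinearity_space.incident_iff[OF T2 b(2) \<alpha>_in[OF P(1)] \<alpha>_in[OF P(2)] \<alpha>_in[OF S] \<alpha>_ne[OF P] inc(3,4)]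
      \<alpha>_col[OF P(1,2) S] by simp
  define \<beta> where "\<beta> b = (SOME c. c \<in> inc_blocks T2 \<and>
    (\<forall>S\<in>inc_points T1. incident T1 S b \<longleftrightarrow> incident T2 (\<alpha> S) c))" for b
  have \<beta>: "\<beta> b \<in> inc_blocks T2 \<and> (\<forall>S\<in>inc_points T1. incident T1 S b \<longleftrightarrow> incident T2 (\<alpha> S) (\<beta> b))"
    if b: "b \<in> inc_blocks T1" for b
  proof -
    obtain P Q where P: "P \<in> inc_points T1" "Q \<in> inc_points T1" "P \<noteq> Q" "incident T1 P b" "incident T1 Q b"
      using collinearity_space.two_points[OF T1 b] by blast
    obtain c where c: "c \<in> inc_blocks T2" "incident T2 (\<alpha> P) c" "incident T2 (\<alpha> Q) c"
      using collinearity_space.joining[OF T2 \<alpha>_in[OF P(1)] \<alpha>_in[OF P(2)] \<alpha>_ne[OF P(1-3)]] by blast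
    have "\<exists>c. c \<in> inc_blocks T2 \<and> (\<forall>S\<in>inc_points T1. incident T1 S b \<longleftrightarrow> incident T2 (\<alpha> S) c)"
      using match[OF b c(1) P(1-5) c(2,3)] c(1) by blast
    then show ?thesis unfolding \<beta>_def by (rule someI_ex)
  qed
  have "inj_on \<beta> (inc_blocks T1)"
  proof (rule inj_onI)
    fix b b' assume b: "b \<in> inc_blocks T1" "b' \<in> inc_blocks T1" "\<beta> b = \<beta> b'"
    show "b = b'"
    proof (rule collinearity_space.block_eqI[OF T1 b(1,2)])
      fix S assume S: "S \<in> inc_points T1"
      have "incident T1 S b \<longleftrightarrow> incident T2 (\<alpha> S) (\<beta> b)" using \<beta>[OF b(1)] S by blast
      also have "\<dots> \<longleftrightarrow> incident T1 S b'" unfolding b(3) using \<beta>[OF b(2)] S by blast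
      finally show "incident T1 S b \<longleftrightarrow> incident T1 S b'" .
    qed
  qed
  moreover have "\<beta> ` inc_blocks T1 = inc_blocks T2"
  proof
    show "\<beta> ` inc_blocks T1 \<subseteq> inc_blocks T2" using \<beta> by blast
    show "inc_blocks T2 \<subseteq> \<beta> ` inc_blocks T1"
    proof
      fix c assume c: "c \<in> inc_blocks T2"
      obtain P' Q' where P': "P' \<in> inc_points T2" "Q' \<in> inc_points T2" "P' \<noteq> Q'" "incident T2 P' c" "incident T2 Q' c"
        using collinearity_space.two_points[OF T2 c] by blast
      have surj: "\<alpha> ` inc_points T1 = inc_points T2" by (rule bij_betw_imp_surj_on[OF bij])
      obtain P where P: "P \<in> inc_points T1" "P' = \<alpha> P" using P'(1) surj by blast
      obtain Q where Q: "Q \<in> inc_points T1" "Q' = \<alpha> Q" using P'(2) surj by blast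
      have PQ: "P \<noteq> Q" using P'(3) P(2) Q(2) by blast
      obtain b where b: "b \<in> inc_blocks T1" "incident T1 P b" "incident T1 Q b"
        using collinearity_space.joining[OF T1 P(1) Q(1) PQ] by blast
      have "\<beta> b = c"
      proof (rule collinearity_space.block_eqI[OF T2 _ c])
        show "\<beta> b \<in> inc_blocks T2" using \<beta>[OF b(1)] by blast
        fix S' assume "S' \<in> inc_points T2"
        then obtain S where S: "S \<in> inc_points T1" "S' = \<alpha> S" using surj by blast
        have "incident T2 S' (\<beta> b) \<longleftrightarrow> incident T1 S b" using \<beta>[OF b(1)] S by blast
        also have "\<dots> \<longleftrightarrow> incident T2 S' c"
          unfolding S(2) by (rule match[OF b(1) c P(1) Q(1) PQ b(2,3)]) (use P' P Q S in auto)
        finally show "incident T2 S' (\<beta> b) \<longleftrightarrow> incident T2 S' c" .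
      qed
      then show "c \<in> \<beta> ` inc_blocks T1" using b(1) by blast
    qed
  qed
  ultimately have "bij_betw \<beta> (inc_blocks T1) (inc_blocks T2)" by (simp add: bij_betw_def)
  then have "inc_isomorphism \<alpha> \<beta> T1 T2" using bij \<beta> by (simp add: inc_isomorphism_def)
  then show ?thesis by blast
qed

lemma herm_points_proj: "herm_points K F e \<subseteq> proj_points K"
  by (auto simp: herm_points_def proj_points_def)

lemma col_same:
  assumes "P \<in> proj_points K"
  shows "col P P S"
proof -
  obtain v where "P = proj_point K v" using assms by (auto simp: proj_points_def)
  then show ?thesis by (auto simp: col_def proj_point_def) (simp add: det3_def algebra_simps)
qed

lemma collinearity_space_gen_hermitian_unital:
  assumes K: "is_subfield K"
  shows "collinearity_space (gen_hermitian_unital K F e)"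
proof -
  let ?X = "herm_points K F e"
  let ?B = "inc_blocks (gen_hermitian_unital K F e)"
  have B: "\<exists>L\<in>proj_lines K. b = ?X \<inter> L \<and> (\<exists>P Q. P \<in> b \<and> Q \<in> b \<and> P \<noteq> Q)" if "b \<in> ?B" for b
    using that by (auto simp: gen_hermitian_unital_def)
  have BI: "?X \<inter> L \<in> ?B" if "L \<in> proj_lines K" "P \<in> ?X \<inter> L" "Q \<in> ?X \<inter> L" "P \<noteq> Q" for L P Q
    using that by (auto simp: gen_hermitian_unital_def)
  have points: "inc_points (gen_hermitian_unital K F e) = ?X"
    and inc: "incident (gen_hermitian_unital K F e) = (\<in>)"
    by (simp_all add: gen_hermitian_unital_def)
  show ?thesis
  proof (rule collinearity_space.intro, unfold points inc)
    fix P S assume "P \<in> ?X"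
    then show "col P P S" using col_same herm_points_proj by blast
  next
    fix b assume "b \<in> ?B"
    then show "\<exists>P\<in>?X. \<exists>Q\<in>?X. P \<noteq> Q \<and> P \<in> b \<and> Q \<in> b" using B by blast
  next
    fix P Q assume PQ: "P \<in> ?X" "Q \<in> ?X" "P \<noteq> Q"
    have pp: "P \<in> proj_points K" "Q \<in> proj_points K" using PQ(1,2) herm_points_proj by blast+
    obtain L where L: "L \<in> proj_lines K" "P \<in> L" "Q \<in> L" using line_ex[OF K pp PQ(3)] by blast
    have PL: "P \<in> ?X \<inter> L" "Q \<in> ?X \<inter> L" using L PQ by simp_all
    show "\<exists>b\<in>?B. P \<in> b \<and> Q \<in> b"
      by (rule bexI[OF _ BI[OF L(1) PL PQ(3)]]) (use PL in simp)
  next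
    fix b P Q S assume h: "b \<in> ?B" "P \<in> ?X" "Q \<in> ?X" "S \<in> ?X" "P \<noteq> Q" "P \<in> b" "Q \<in> b"
    obtain L where L: "L \<in> proj_lines K" "b = ?X \<inter> L" using B[OF h(1)] by blast
    have PQ: "P \<in> L" "Q \<in> L" using h(6,7) unfolding L(2) by simp_all
    show "S \<in> b \<longleftrightarrow> col P Q S"
    proof
      assume "S \<in> b"
      then show "col P Q S" using line_col[OF L(1) PQ] L(2) by simp
    next
      assume "col P Q S"
      moreover have "S \<in> proj_points K" using h(4) herm_points_proj by blast
      ultimately have "S \<in> L" by (intro line_mem[OF K L(1) PQ h(5)])
      then show "S \<in> b" using L(2) h(4) by simp
    qed
  next
    fix b b' assume h: "b \<in> ?B" "b' \<in> ?B" "\<And>P. P \<in> ?X \<Longrightarrow> P \<in> b \<longleftrightarrow> P \<in> b'"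
    have "b \<subseteq> ?X" "b' \<subseteq> ?X" using B[OF h(1)] B[OF h(2)] by blast+
    then show "b = b'" using h(3) by blast
  qed
qed

text \<open>
  The blocks of a subunital are identified with blocks of the big unital, that is, with lines; so its incidence
  is collinearity, and its design parameters count collinear points.
\<close>

lemma subunital_unital_set:
  assumes S: "finite_unital S" and sub: "subunital S (gen_hermitian_unital UNIV R \<epsilon>)"
  shows "\<exists>q. unital_set q (inc_points S)" and "collinearity_space S"
proof -
  let ?H = "gen_hermitian_unital UNIV R \<epsilon>"
  obtain q where q: "unital_of_order q S" using S by (auto simp: finite_unital_def)
  then have q2: "q \<ge> 2" and design: "two_design (q^3 + 1) (q + 1) 1 S" by (simp_all add: unital_of_order_def)
  have fin: "finite (inc_points S)" and card: "card (inc_points S) = q^3 + 1"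
    and block: "\<And>b. b \<in> inc_blocks S \<Longrightarrow> card {x \<in> inc_points S. incident S x b} = q + 1"
    and pair: "\<And>x y. x \<in> inc_points S \<Longrightarrow> y \<in> inc_points S \<Longrightarrow> x \<noteq> y \<Longrightarrow>
      card {b \<in> inc_blocks S. incident S x b \<and> incident S y b} = 1"
    using design unfolding two_design_def by blast+
  have pts: "inc_points S \<subseteq> inc_points ?H" and blk: "inc_blocks S \<subseteq> inc_blocks ?H"
    and inc: "\<And>x b. x \<in> inc_points S \<Longrightarrow> b \<in> inc_blocks S \<Longrightarrow> incident S x b \<longleftrightarrow> incident ?H x b"
    using sub by (auto simp: subunital_def inc_embedding_def)
  have H: "collinearity_space ?H" by (rule collinearity_space_gen_hermitian_unital) simp
  have mem: "incident S T b \<longleftrightarrow> col P Q T"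
    if h: "b \<in> inc_blocks S" "P \<in> inc_points S" "Q \<in> inc_points S" "T \<in> inc_points S" "P \<noteq> Q"
      "incident S P b" "incident S Q b" for b P Q T
    using collinearity_space.incident_iff[OF H, of b P Q T] h pts blk inc by blast
  have join: "\<exists>b\<in>inc_blocks S. incident S P b \<and> incident S Q b"
    if "P \<in> inc_points S" "Q \<in> inc_points S" "P \<noteq> Q" for P Q
  proof -
    have "{b \<in> inc_blocks S. incident S P b \<and> incident S Q b} \<noteq> {}"
      using pair[OF that] by (metis card.empty zero_neq_one)
    then show ?thesis by blast
  qed
  have two: "\<exists>P\<in>inc_points S. \<exists>Q\<in>inc_points S. P \<noteq> Q \<and> incident S P b \<and> incident S Q b"
    if "b \<in> inc_blocks S" for b
  proof -
    have "finite {x \<in> inc_points S. incident S x b}" using fin by simp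
    moreover have "\<not> card {x \<in> inc_points S. incident S x b} \<le> Suc 0" using block[OF that] q2 by simp
    ultimately obtain P Q where "P \<in> {x \<in> inc_points S. incident S x b}"
      "Q \<in> {x \<in> inc_points S. incident S x b}" "P \<noteq> Q"
      using card_le_Suc0_iff_eq by blast
    then show ?thesis by blast
  qed
  show "collinearity_space S"
  proof (rule collinearity_space.intro)
    fix P T assume "P \<in> inc_points S" "T \<in> inc_points S"
    then show "col P P T" using collinearity_space.col_diag[OF H] pts by blast
  next
    fix b b' assume b: "b \<in> inc_blocks S" "b' \<in> inc_blocks S"
      and eq: "\<And>P. P \<in> inc_points S \<Longrightarrow> incident S P b \<longleftrightarrow> incident S P b'"
    obtain P Q where P: "P \<in> inc_points S" "Q \<in> inc_points S" "P \<noteq> Q" "incident S P b" "incident S Q b"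
      using two[OF b(1)] by blast
    have bH: "b \<in> inc_blocks ?H" "b' \<in> inc_blocks ?H" using b blk by blast+
    have PH: "P \<in> inc_points ?H" "Q \<in> inc_points ?H" using P pts by blast+
    have i: "incident ?H P b" "incident ?H Q b" "incident ?H P b'" "incident ?H Q b'"
      using P eq inc b by blast+
    show "b = b'"
    proof (rule collinearity_space.block_eqI[OF H bH])
      fix T assume T: "T \<in> inc_points ?H"
      show "incident ?H T b \<longleftrightarrow> incident ?H T b'"
        using collinearity_space.incident_iff[OF H bH(1) PH T P(3) i(1,2)]
          collinearity_space.incident_iff[OF H bH(2) PH T P(3) i(3,4)] by simp
    qed
  next
    fix b assume "b \<in> inc_blocks S"
    then show "\<exists>P\<in>inc_points S. \<exists>Q\<in>inc_points S. P \<noteq> Q \<and> incident S P b \<and> incident S Q b" by (rule two)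
  next
    fix P Q assume "P \<in> inc_points S" "Q \<in> inc_points S" "P \<noteq> Q"
    then show "\<exists>b\<in>inc_blocks S. incident S P b \<and> incident S Q b" by (rule join)
  next
    fix b P Q T assume "b \<in> inc_blocks S" "P \<in> inc_points S" "Q \<in> inc_points S" "T \<in> inc_points S"
      "P \<noteq> Q" "incident S P b" "incident S Q b"
    then show "incident S T b \<longleftrightarrow> col P Q T" by (rule mem)
  qed
  have "card {T \<in> inc_points S. col P Q T} = q + 1"
    if P: "P \<in> inc_points S" "Q \<in> inc_points S" "P \<noteq> Q" for P Q
  proof -
    obtain b where b: "b \<in> inc_blocks S" "incident S P b" "incident S Q b" using join[OF P] by blast
    have "{T \<in> inc_points S. col P Q T} = {x \<in> inc_points S. incident S x b}"
      using mem[OF b(1) P(1,2) _ P(3) b(2,3)] by blast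
    then show ?thesis using block[OF b(1)] by simp
  qed
  moreover have "inc_points S \<subseteq> proj_points UNIV"
    using pts herm_points_proj[of UNIV R \<epsilon>] by (auto simp: gen_hermitian_unital_def)
  ultimately show "\<exists>q. unital_set q (inc_points S)"
    using q2 fin card unfolding unital_set_def by blast
qed

section \<open>The standard model of a subunital\<close>

text \<open>
  For a point of the plane over a subfield, the point of the plane over the ambient field that it spans.
\<close>

definition extend_scalars :: "('c::field^3) set \<Rightarrow> ('c^3) set" where
  "extend_scalars P = {c *s v | c v. v \<in> P}"

lemma extend_scalars_proj_point:
  assumes "is_subfield K"
  shows "extend_scalars (proj_point K v) = proj_point UNIV v"
proof
  show "extend_scalars (proj_point K v) \<subseteq> proj_point UNIV v"
  proof
    fix x assume "x \<in> extend_scalars (proj_point K v)"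
    then obtain c k where "x = c *s (k *s v)"
      unfolding extend_scalars_def proj_point_def by blast
    then have "x = (c * k) *s v" by (simp add: vector_smult_assoc)
    then show "x \<in> proj_point UNIV v" by (auto simp: proj_point_def)
  qed
  show "proj_point UNIV v \<subseteq> extend_scalars (proj_point K v)"
    using vector_in_point[OF assms, of v] by (auto simp: extend_scalars_def proj_point_def)
qed

lemma col_iso_inv:
  assumes "col_iso \<theta> U U'"
  shows "col_iso (inv_into U \<theta>) U' U"
proof -
  have bij: "bij_betw \<theta> U U'" using assms by (simp add: col_iso_def)
  have bij': "bij_betw (inv_into U \<theta>) U' U" by (rule bij_betw_inv_into[OF bij])
  have "col (inv_into U \<theta> P) (inv_into U \<theta> Q) (inv_into U \<theta> S) \<longleftrightarrow> col P Q S"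
    if "P \<in> U'" "Q \<in> U'" "S \<in> U'" for P Q S
  proof -
    have "inv_into U \<theta> P \<in> U" "inv_into U \<theta> Q \<in> U" "inv_into U \<theta> S \<in> U"
      using bij_betw_apply[OF bij'] that by simp_all
    then show ?thesis
      using assms bij_betw_inv_into_right[OF bij] that unfolding col_iso_def by metis
  qed
  then show ?thesis using bij' by (simp add: col_iso_def)
qed

context normal_unital
begin

text \<open>
  The form \<open>X\<^sup>\<sigma>Y - u N(Z) \<in> F\<close> of the normal position is turned into \<open>X\<^sup>\<sigma>Y + N(Z) \<in> eF\<close> by a
  factor of \<open>Y\<close> in \<open>e\<^sup>-\<^sup>1F\<close> that is congruent to \<open>-u\<close> modulo \<open>F\<close>.
\<close>

lemma scaling_factor:
  assumes e: "e \<in> E - F"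
  obtains k where "k \<in> E" "k \<noteq> 0" "k + u \<in> F" "k * e \<in> F"
proof -
  have e0: "e \<noteq> 0" using e F_closed(1) by auto
  have "1 / e \<in> E" using E_closed(2,8) e by simp
  then obtain p q where pq: "p \<in> F" "q \<in> F" "1 / e = p + q * u" by (auto simp: E_def)
  have q0: "q \<noteq> 0"
  proof
    assume "q = 0"
    then have "1 / (1 / e) \<in> F" using pq F_closed(2,8) by simp
    then show False using e by simp
  qed
  \<comment> \<open>by \<open>1/e = p + qu\<close>, the element \<open>u\<close> is a multiple of \<open>1/e\<close> modulo \<open>F\<close>\<close>
  define k where "k = - ((1 / e) / q)"
  have "k \<in> E" unfolding k_def
    using E_closed(5)[OF E_closed(8)[OF \<open>1 / e \<in> E\<close>]] pq(2) F_sub_E by blast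
  moreover have "k \<noteq> 0" using e0 q0 by (simp add: k_def)
  moreover have "k + u = - (p / q)" unfolding k_def pq(3) using q0 by (simp add: add_divide_distrib)
  then have "k + u \<in> F" using F_closed(5,8) pq by simp
  moreover have "k * e = - (1 / q)" using e0 by (simp add: k_def)
  then have "k * e \<in> F" using F_closed(2,5,8) pq by simp
  ultimately show thesis by (rule that)
qed

lemma hermitian_form_iff:
  assumes e: "e \<in> E - F" and k: "k \<in> E" "k \<noteq> 0" "k + u \<in> F" "k * e \<in> F"
    and xyz: "x \<in> E" "y \<in> E" "z \<in> E" "x \<noteq> 0 \<or> y \<noteq> 0 \<or> z \<noteq> 0"
  shows "ext_conj F e x * y + ext_conj F e z * z \<in> {e * r | r. r \<in> F} \<longleftrightarrow> pt x (k * y) z \<in> U"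
proof -
  have e0: "e \<noteq> 0" using e F_closed(1) by auto
  let ?w = "\<sigma> x * y + \<sigma> z * z"
  have "pt x (k * y) z \<in> U \<longleftrightarrow> \<sigma> x * (k * y) - u * N z \<in> F"
    by (rule mem_U_iff) (use xyz k E_closed(4) in auto)
  also have "\<sigma> x * (k * y) - u * N z = k * ?w - (k + u) * N z" by (simp add: algebra_simps)
  also have "\<dots> \<in> F \<longleftrightarrow> k * ?w \<in> F"
  proof -
    have m: "(k + u) * N z \<in> F" using F_closed(4) k(3) norm_E[OF xyz(3)] by blast
    have "k * ?w = (k * ?w - (k + u) * N z) + (k + u) * N z" by simp
    then show ?thesis using F_closed(3,6) m by metis
  qed
  also have "\<dots> \<longleftrightarrow> ?w \<in> {e * r | r. r \<in> F}"
  proof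
    assume "k * ?w \<in> F"
    then have "k * ?w / (k * e) \<in> F" using F_closed(8) k(4) by blast
    moreover have "?w = e * (k * ?w / (k * e))" using k(2) e0 by simp
    ultimately show "?w \<in> {e * r | r. r \<in> F}" by blast
  next
    assume "?w \<in> {e * r | r. r \<in> F}"
    then obtain r where r: "r \<in> F" "?w = e * r" by blast
    have eq: "k * ?w = (k * e) * r" unfolding r(2) by (simp only: mult.assoc)
    show "k * ?w \<in> F" unfolding eq by (rule F_closed(4)[OF k(4) r(1)])
  qed
  finally show ?thesis using ext_conj_E[OF e] xyz by simp
qed

text \<open>
  Extension of scalars embeds the plane over \<open>E\<close> into the big plane and preserves collinearity, and scaling \<open>Y\<close>
  by \<open>k\<close> turns one form into the other.
\<close>

lemma model_col_iso:
  assumes e: "e \<in> E - F" and k: "k \<in> E" "k \<noteq> 0" "k + u \<in> F" "k * e \<in> F"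
  defines "j \<equiv> \<lambda>P. act (mat3 1 0 0 0 k 0 0 0 1) (extend_scalars P)"
  shows "col_iso j (herm_points E F e) U"
    and "\<And>v. j (proj_point E v) = pt (v$1) (k * v$2) (v$3)"
proof -
  let ?X = "herm_points E F e" and ?D = "mat3 1 0 0 0 k 0 0 0 1 :: 'a^3^3"
  have D: "invertible ?D" using k(2) by (simp add: invertible_mat3)
  show j: "j (proj_point E v) = pt (v$1) (k * v$2) (v$3)" for v
    by (simp add: j_def extend_scalars_proj_point[OF subfield_E] act_proj_point mat3_mult_vec)
  have j': "j (proj_point E v) = act ?D (proj_point UNIV v)" for v
    by (simp add: j_def extend_scalars_proj_point[OF subfield_E])
  have inX: "\<exists>v\<in>vecs3 E. v \<noteq> 0 \<and> P = proj_point E v" if "P \<in> ?X" for P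
    using that unfolding herm_points_def by blast
  have nz: "v$1 \<noteq> 0 \<or> v$2 \<noteq> 0 \<or> v$3 \<noteq> 0" if "v \<noteq> 0" for v :: "'a^3"
    using that by (simp add: vec3_eq_iff)
  have "inj_on j ?X"
  proof (rule inj_onI)
    fix P Q assume PQ: "P \<in> ?X" "Q \<in> ?X" "j P = j Q"
    obtain v where v: "v \<in> vecs3 E" "v \<noteq> 0" "P = proj_point E v" using inX[OF PQ(1)] by blast
    obtain w where w: "w \<in> vecs3 E" "w \<noteq> 0" "Q = proj_point E w" using inX[OF PQ(2)] by blast
    have "act ?D (proj_point UNIV v) = act ?D (proj_point UNIV w)" using PQ(3) v w j' by simp
    then have "proj_point UNIV v = proj_point UNIV w" by (rule injD[OF inj_act[OF D]])
    then obtain c where c: "v = c *s w" using proj_point_eqD[OF subfield_UNIV] by blast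
    have c0: "c \<noteq> 0" using c v(2) by auto
    obtain i where i: "w $ i \<noteq> 0" using w(2) by (auto simp: vec_eq_iff)
    have "c = v $ i / w $ i" using c i by simp
    moreover have "v $ i \<in> E" "w $ i \<in> E" using v(1) w(1) by (simp_all add: vecs3_def)
    ultimately have "c \<in> E" using E_closed(8) by simp
    then show "P = Q" unfolding v(3) w(3) c by (rule proj_point_scale[OF subfield_E _ c0])
  qed
  moreover have "j ` ?X = U"
  proof
    show "j ` ?X \<subseteq> U"
    proof clarify
      fix P assume "P \<in> ?X"
      then obtain v where v: "v \<in> vecs3 E" "v \<noteq> 0" "P = proj_point E v"
        "ext_conj F e (v $ 1) * v $ 2 + ext_conj F e (v $ 3) * v $ 3 \<in> {e * r | r. r \<in> F}"
        unfolding herm_points_def by blast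
      have "v$1 \<in> E" "v$2 \<in> E" "v$3 \<in> E" using v(1) by (simp_all add: vecs3_def)
      from hermitian_form_iff[OF e k this nz[OF v(2)]] show "j P \<in> U"
        using v(4) unfolding v(3) j by blast
    qed
    have XI: "P \<in> j ` ?X" if xyz: "x \<in> E" "y \<in> E" "z \<in> E" "x \<noteq> 0 \<or> y \<noteq> 0 \<or> z \<noteq> 0"
      and P: "P \<in> U" "P = pt x (k * y) z" for P x y z
    proof -
      have "ext_conj F e x * y + ext_conj F e z * z \<in> {e * r | r. r \<in> F}"
        using hermitian_form_iff[OF e k xyz] P by simp
      moreover have "vector [x, y, z] \<in> vecs3 E" using xyz by (simp add: vecs3_def forall_3)
      moreover have "(vector [x, y, z] :: 'a^3) \<noteq> 0" using xyz(4) by (simp add: vec3_eq_iff)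
      ultimately have "proj_point E (vector [x, y, z]) \<in> ?X"
        unfolding herm_points_def by (intro CollectI exI[of _ "vector [x, y, z]"]) simp
      moreover have "j (proj_point E (vector [x, y, z])) = P" using j P(2) by simp
      ultimately show ?thesis by blast
    qed
    show "U \<subseteq> j ` ?X"
    proof
      fix P assume P: "P \<in> U"
      then show "P \<in> j ` ?X"
      proof (cases rule: point_cases)
        case 1
        have "pt 0 1 0 = pt 0 (k * 1) 0" using pt_scale[OF k(2), of 0 1 0] by simp
        then show ?thesis using 1 P XI[of 0 1 0 P] E_closed(1,2) by simp
      next
        case (2 y z)
        have "z \<in> E" "y - u * N z \<in> F" using 2(2) affine_iff by blast+
        moreover have "u * N z \<in> E" using E_closed(4) u_in_E norm_E[OF \<open>z \<in> E\<close>] F_sub_E by blast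
        moreover have "y = (y - u * N z) + u * N z" by simp
        ultimately have "y \<in> E" using E_closed(3) F_sub_E by (metis subsetD)
        then show ?thesis using XI[of 1 "y / k" z P] E_closed(2,8) \<open>z \<in> E\<close> k(1,2) P 2(1) by simp
      qed
    qed
  qed
  moreover have "col (j P) (j Q) (j S) \<longleftrightarrow> col P Q S" if PQS: "P \<in> ?X" "Q \<in> ?X" "S \<in> ?X" for P Q S
  proof -
    obtain v where v: "P = proj_point E v" using inX[OF PQS(1)] by blast
    obtain w where w: "Q = proj_point E w" using inX[OF PQS(2)] by blast
    obtain x where x: "S = proj_point E x" using inX[OF PQS(3)] by blast
    show ?thesis
      unfolding v w x j' act_col[OF D] col_proj_point[OF subfield_E] col_proj_point[OF subfield_UNIV] ..
  qed
  ultimately show "col_iso j ?X U" by (simp add: col_iso_def bij_betw_def)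
qed

end

theorem theorem2p2:
  fixes R :: "'c::field set" and \<epsilon> :: 'c
    and S :: "(('c^3) set, ('c^3) set set) incidence_structure"
  assumes "quadratic_extension UNIV R" and "\<epsilon> \<notin> R"
    and "finite_unital S"
    and "subunital S (gen_hermitian_unital UNIV R \<epsilon>)"
  shows "(\<exists>(E :: 'c set) F. quadratic_extension E F \<and> finite E \<and>
            (\<forall>e \<in> E - F. hermitian_unital E F e S \<and>
               (\<forall>\<alpha> \<beta>. inc_isomorphism \<alpha> \<beta> (gen_hermitian_unital E F e) S \<longrightarrow>
                  standard_embedding E F e UNIV R \<epsilon> \<alpha> \<beta>))) \<and>
         separable_extension UNIV R \<and>
         hermitian_unital UNIV R \<epsilon> (gen_hermitian_unital UNIV R \<epsilon>)"
proof -
  let ?H = "gen_hermitian_unital UNIV R \<epsilon>"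
  define \<sigma> where "\<sigma> = ext_conj R \<epsilon>"
  interpret field_conj R \<sigma> unfolding \<sigma>_def by (rule field_conj_ext_conj[OF assms(1,2)])
  have \<epsilon>0: "\<epsilon> \<noteq> 0" using assms(2) R_closed(1) by auto
  obtain q where q: "unital_set q (inc_points S)" using subunital_unital_set(1)[OF assms(3,4)] by blast
  have S: "collinearity_space S" by (rule subunital_unital_set(2)[OF assms(3,4)])
  have sub: "inc_points S \<subseteq> herm_points UNIV R \<epsilon>"
    using assms(4) by (auto simp: subunital_def inc_embedding_def gen_hermitian_unital_def)
  \<comment> \<open>dividing \<open>Y\<close> by \<open>\<epsilon>\<close> gives the form with parameter \<open>-1/\<epsilon>\<close>\<close>
  let ?D0 = "mat3 1 0 0 0 (1 / \<epsilon>) 0 0 0 1"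
  have D0: "invertible ?D0" using \<epsilon>0 by (simp add: invertible_mat3)
  have D0_Hm: "act ?D0 P \<in> Hm (- (1 / \<epsilon>))" if P: "P \<in> herm_points UNIV R \<epsilon>" for P
  proof -
    obtain v r where v: "P = proj_point UNIV v" "v \<noteq> 0" "r \<in> R" "\<sigma> (v $ 1) * v $ 2 + \<sigma> (v $ 3) * v $ 3 = \<epsilon> * r"
      using P unfolding herm_points_def \<sigma>_def by blast
    have "\<sigma> (v $ 1) * (v $ 2 / \<epsilon>) - - (1 / \<epsilon>) * N (v $ 3) = (\<sigma> (v $ 1) * v $ 2 + \<sigma> (v $ 3) * v $ 3) / \<epsilon>"
      by (simp add: add_divide_distrib mult.commute)
    also have "\<dots> = r" unfolding v(4) using \<epsilon>0 by simp
    finally have "\<sigma> (v $ 1) * (v $ 2 / \<epsilon>) - - (1 / \<epsilon>) * N (v $ 3) \<in> R" using v(3) by simp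
    moreover have "v $ 1 \<noteq> 0 \<or> v $ 2 / \<epsilon> \<noteq> 0 \<or> v $ 3 \<noteq> 0" using v(2) \<epsilon>0 by (simp add: vec3_eq_iff)
    ultimately have "pt (v $ 1) (v $ 2 / \<epsilon>) (v $ 3) \<in> Hm (- (1 / \<epsilon>))" by (intro pt_in_HmI)
    then show ?thesis by (simp add: v(1) act_proj_point mat3_mult_vec)
  qed
  have \<epsilon>': "- (1 / \<epsilon>) \<notin> R"
  proof
    assume "- (1 / \<epsilon>) \<in> R"
    then have "1 / - (- (1 / \<epsilon>)) \<in> R" using R_closed(2,5,8) by blast
    then show False using assms(2) by simp
  qed
  have frame: "\<exists>M u. invertible M \<and> normal_unital R \<sigma> q u (act M ` inc_points S) \<and> act M P = pt 0 1 0 \<and>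
      act M Q = pt 1 0 0 \<and> act M I = pt 1 1 0 \<and> act M T = pt 1 u 1"
    if PQIT: "P \<in> inc_points S" "Q \<in> inc_points S" "I \<in> inc_points S" "T \<in> inc_points S"
      and ne: "P \<noteq> Q" "I \<noteq> P" "I \<noteq> Q" and c: "col P Q I" "\<not> col P Q T" for P Q I T
  proof -
    have inj: "act ?D0 A = act ?D0 B \<longleftrightarrow> A = B" for A B using inj_act[OF D0] by (auto dest: injD)
    have "unital_set q (act ?D0 ` inc_points S)" by (rule unital_set_act[OF D0 q])
    moreover have "act ?D0 ` inc_points S \<subseteq> Hm (- (1 / \<epsilon>))" using D0_Hm sub by blast
    ultimately obtain M u where M: "invertible M" "normal_unital R \<sigma> q u (act M ` act ?D0 ` inc_points S)"
      "act M (act ?D0 P) = pt 0 1 0" "act M (act ?D0 Q) = pt 1 0 0" "act M (act ?D0 I) = pt 1 1 0"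
      "act M (act ?D0 T) = pt 1 u 1"
      using normal_position[OF _ _ \<epsilon>' imageI[OF PQIT(1)] imageI[OF PQIT(2)] imageI[OF PQIT(3)] imageI[OF PQIT(4)]]
        ne c inj act_col[OF D0] by metis
    show ?thesis
      using M invertible_mult[OF M(1) D0]
      by (intro exI[of _ "M ** ?D0"] exI[of _ u]) (simp add: image_image flip: act_act)
  qed
  obtain P Q I T where "P \<in> inc_points S" "Q \<in> inc_points S" "I \<in> inc_points S" "T \<in> inc_points S"
    "P \<noteq> Q" "I \<noteq> P" "I \<noteq> Q" "col P Q I" "\<not> col P Q T"
    by (rule unital_set_frame[OF q])
  from frame[OF this] obtain M u where M: "invertible M" "normal_unital R \<sigma> q u (act M ` inc_points S)" by blast
  define U where "U = act M ` inc_points S"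
  interpret U: normal_unital R \<sigma> q u U unfolding U_def by (rule M(2))
  have U_back: "act (matrix_inv M) ` U = inc_points S"
    unfolding U_def by (simp add: image_image act_inv[OF M(1)])
  have main: "hermitian_unital U.E U.F e S \<and>
      (\<forall>\<alpha> \<beta>. inc_isomorphism \<alpha> \<beta> (gen_hermitian_unital U.E U.F e) S \<longrightarrow>
        standard_embedding U.E U.F e UNIV R \<epsilon> \<alpha> \<beta>)"
    if e: "e \<in> U.E - U.F" for e
  proof -
    let ?HE = "gen_hermitian_unital U.E U.F e" and ?X = "herm_points U.E U.F e"
    have X: "inc_points ?HE = ?X" by (simp add: gen_hermitian_unital_def)
    have HE: "collinearity_space ?HE" by (rule collinearity_space_gen_hermitian_unital[OF U.subfield_E])
    obtain k where k: "k \<in> U.E" "k \<noteq> 0" "k + u \<in> U.F" "k * e \<in> U.F" by (rule U.scaling_factor[OF e])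
    define j where "j = (\<lambda>P. act (mat3 1 0 0 0 k 0 0 0 1) (extend_scalars P))"
    have j_iso: "col_iso j ?X U" and j: "\<And>v. j (proj_point U.E v) = pt (v$1) (k * v$2) (v$3)"
      unfolding j_def by (rule U.model_col_iso[OF e k])+
    have "col_iso (act (matrix_inv M)) U (inc_points S)"
      using col_iso_act[OF invertible_matrix_inv(1)[OF M(1)], of U] by (simp add: U_back)
    from col_iso_comp[OF j_iso this]
    obtain \<beta>0 where "inc_isomorphism (act (matrix_inv M) \<circ> j) \<beta>0 ?HE S"
      using col_iso_inc_isomorphism[OF HE S] by (auto simp: X)
    then have herm: "hermitian_unital U.E U.F e S"
      unfolding hermitian_unital_def using U.quadratic_E U.separable_E e by blast
    have "standard_embedding U.E U.F e UNIV R \<epsilon> \<alpha> \<beta>" if iso: "inc_isomorphism \<alpha> \<beta> ?HE S" for \<alpha> \<beta>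
    proof -
      have emb: "inc_embedding \<alpha> \<beta> ?HE ?H"
      proof -
        have b: "bij_betw \<alpha> (inc_points ?HE) (inc_points S)" "bij_betw \<beta> (inc_blocks ?HE) (inc_blocks S)"
          and i: "\<And>x b. x \<in> inc_points ?HE \<Longrightarrow> b \<in> inc_blocks ?HE \<Longrightarrow> incident ?HE x b \<longleftrightarrow> incident S (\<alpha> x) (\<beta> b)"
          using iso by (auto simp: inc_isomorphism_def)
        have s: "inc_points S \<subseteq> inc_points ?H" "inc_blocks S \<subseteq> inc_blocks ?H"
          "\<And>x b. x \<in> inc_points S \<Longrightarrow> b \<in> inc_blocks S \<Longrightarrow> incident S x b \<longleftrightarrow> incident ?H x b"
          using assms(4) by (auto simp: subunital_def inc_embedding_def)
        show ?thesis
          unfolding inc_embedding_def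
        proof (intro conjI ballI)
          show "inj_on \<alpha> (inc_points ?HE)" "inj_on \<beta> (inc_blocks ?HE)"
            using b by (simp_all add: bij_betw_def)
          show "\<alpha> ` inc_points ?HE \<subseteq> inc_points ?H" "\<beta> ` inc_blocks ?HE \<subseteq> inc_blocks ?H"
            using b s(1,2) by (simp_all add: bij_betw_def)
          fix x y assume xy: "x \<in> inc_points ?HE" "y \<in> inc_blocks ?HE"
          show "incident ?HE x y \<longleftrightarrow> incident ?H (\<alpha> x) (\<beta> y)"
            using i[OF xy] s(3)[OF bij_betw_apply[OF b(1) xy(1)] bij_betw_apply[OF b(2) xy(2)]] by simp
        qed
      qed
      have \<alpha>: "col_iso \<alpha> ?X (inc_points S)" using inc_isomorphism_col_iso[OF HE S iso] by (simp add: X)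
      \<comment> \<open>\<open>\<alpha>\<close>, read on the model \<open>U\<close>; a frame of \<open>S\<close> is taken to be the image of the standard frame of \<open>U\<close>\<close>
      define \<theta> where "\<theta> = \<alpha> \<circ> inv_into ?X j"
      have \<theta>: "col_iso \<theta> U (inc_points S)" unfolding \<theta>_def by (rule col_iso_comp[OF col_iso_inv[OF j_iso] \<alpha>])
      have \<theta>_bij: "bij_betw \<theta> U (inc_points S)" using \<theta> by (simp add: col_iso_def)
      have \<theta>_in: "\<theta> P \<in> inc_points S" if "P \<in> U" for P using \<theta>_bij that by (rule bij_betw_apply)
      have \<theta>_ne: "\<theta> P \<noteq> \<theta> Q" if "P \<in> U" "Q \<in> U" "P \<noteq> Q" for P Q
        using inj_onD[OF bij_betw_imp_inj_on[OF \<theta>_bij] _ that(1,2)] that(3) by blast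
      have \<theta>_col: "col (\<theta> P) (\<theta> Q) (\<theta> T) \<longleftrightarrow> col P Q T" if "P \<in> U" "Q \<in> U" "T \<in> U" for P Q T
        using \<theta> that by (simp add: col_iso_def)
      have c: "col (pt 0 1 0) (pt 1 0 0) (pt 1 1 0)" "\<not> col (pt 0 1 0) (pt 1 0 0) (pt 1 u 1)"
        by (simp_all add: col_inf_affine)
      have "\<exists>M2 u2. invertible M2 \<and> normal_unital R \<sigma> q u2 (act M2 ` inc_points S) \<and>
        act M2 (\<theta> (pt 0 1 0)) = pt 0 1 0 \<and> act M2 (\<theta> (pt 1 0 0)) = pt 1 0 0 \<and>
        act M2 (\<theta> (pt 1 1 0)) = pt 1 1 0 \<and> act M2 (\<theta> (pt 1 u 1)) = pt 1 u2 1"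
      proof (rule frame)
        show "\<theta> (pt 0 1 0) \<in> inc_points S" "\<theta> (pt 1 0 0) \<in> inc_points S" "\<theta> (pt 1 1 0) \<in> inc_points S"
          "\<theta> (pt 1 u 1) \<in> inc_points S"
          using \<theta>_in U.inf_in U.zero_in U.unit_in U.top_in by simp_all
        show "\<theta> (pt 0 1 0) \<noteq> \<theta> (pt 1 0 0)" "\<theta> (pt 1 1 0) \<noteq> \<theta> (pt 0 1 0)" "\<theta> (pt 1 1 0) \<noteq> \<theta> (pt 1 0 0)"
          by (rule \<theta>_ne; simp add: U.inf_in U.zero_in U.unit_in)+
        show "col (\<theta> (pt 0 1 0)) (\<theta> (pt 1 0 0)) (\<theta> (pt 1 1 0))"
          "\<not> col (\<theta> (pt 0 1 0)) (\<theta> (pt 1 0 0)) (\<theta> (pt 1 u 1))"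
          using c \<theta>_col U.inf_in U.zero_in U.unit_in U.top_in by simp_all
      qed
      then obtain M2 u2 where M2: "invertible M2" "normal_unital R \<sigma> q u2 (act M2 ` inc_points S)"
        "act M2 (\<theta> (pt 0 1 0)) = pt 0 1 0" "act M2 (\<theta> (pt 1 0 0)) = pt 1 0 0"
        "act M2 (\<theta> (pt 1 1 0)) = pt 1 1 0" "act M2 (\<theta> (pt 1 u 1)) = pt 1 u2 1" by blast
      interpret I: normal_iso R \<sigma> q u U u2 "act M2 ` inc_points S" "act M2 \<circ> \<theta>"
      proof (intro normal_iso.intro normal_iso_axioms.intro)
        show "normal_unital R \<sigma> q u U" by (rule U.normal_unital_axioms)
        show "normal_unital R \<sigma> q u2 (act M2 ` inc_points S)" by (rule M2(2))
        show "col_iso (act M2 \<circ> \<theta>) U (act M2 ` inc_points S)"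
          by (rule col_iso_comp[OF \<theta> col_iso_act[OF M2(1)]])
      qed (use M2 in simp_all)
      let ?\<eta> = I.\<eta>
      have \<eta>: "field_ext_embedding U.E U.F UNIV R ?\<eta>" by (rule I.\<eta>_field_ext_embedding)
      have "?\<eta> k \<noteq> 0" using I.\<eta>_eq_0 k(1,2) by blast
      let ?D = "mat3 1 0 0 0 (?\<eta> k) 0 0 0 1"
      have D: "invertible ?D" using \<open>?\<eta> k \<noteq> 0\<close> by (simp add: invertible_mat3)
      \<comment> \<open>scaling \<open>Y\<close> by \<open>k\<close> before applying \<open>\<eta>\<close> is scaling by \<open>\<eta> k\<close> afterwards\<close>
      define A where "A = matrix_inv M2 ** ?D"
      have A: "invertible A" unfolding A_def by (rule invertible_mult[OF invertible_matrix_inv(1)[OF M2(1)] D])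
      have "\<alpha> (proj_point U.E v) = (\<lambda>w. A *v w) ` proj_point UNIV (\<chi> i. ?\<eta> (v $ i))"
        if v: "v \<in> vecs3 U.E" "v \<noteq> 0" "proj_point U.E v \<in> ?X" for v
      proof -
        have vE: "v$1 \<in> U.E" "v$2 \<in> U.E" "v$3 \<in> U.E" using v(1) by (simp_all add: vecs3_def)
        have j_bij: "bij_betw j ?X U" using j_iso by (simp add: col_iso_def)
        have "j (proj_point U.E v) \<in> U" by (rule bij_betw_apply[OF j_bij v(3)])
        then have in_U: "pt (v$1) (k * v$2) (v$3) \<in> U" unfolding j .
        have nz: "v$1 \<noteq> 0 \<or> k * v$2 \<noteq> 0 \<or> v$3 \<noteq> 0" using v(2) k(2) by (simp add: vec3_eq_iff)
        have "\<theta> (j (proj_point U.E v)) = \<alpha> (proj_point U.E v)"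
          unfolding \<theta>_def by (simp add: bij_betw_inv_into_left[OF j_bij v(3)])
        then have "act M2 (\<alpha> (proj_point U.E v)) = (act M2 \<circ> \<theta>) (pt (v$1) (k * v$2) (v$3))"
          by (simp add: j)
        also have "\<dots> = pt (?\<eta> (v$1)) (?\<eta> (k * v$2)) (?\<eta> (v$3))"
          by (rule I.\<theta>_semilinear[OF vE(1) U.E_closed(4)[OF k(1) vE(2)] vE(3) nz in_U])
        also have "\<dots> = act ?D (pt (?\<eta> (v$1)) (?\<eta> (v$2)) (?\<eta> (v$3)))"
          by (simp add: act_mat3 I.\<eta>_mult[OF k(1) vE(2)])
        finally have "act (matrix_inv M2) (act M2 (\<alpha> (proj_point U.E v))) =
            act A (pt (?\<eta> (v$1)) (?\<eta> (v$2)) (?\<eta> (v$3)))"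
          by (simp add: A_def act_act)
        moreover have "vector [?\<eta> (v$1), ?\<eta> (v$2), ?\<eta> (v$3)] = (\<chi> i. ?\<eta> (v $ i))"
          by (simp add: vec3_eq_iff)
        ultimately show ?thesis unfolding act_def[symmetric] by (simp add: act_inv(2)[OF M2(1)])
      qed
      then show ?thesis
        unfolding standard_embedding_def X using emb \<eta> A by blast
    qed
    then show ?thesis using herm by blast
  qed
  have sep: "separable_extension UNIV R" by (rule U.separable_UNIV[OF assms(1)])
  have "inc_isomorphism id id ?H ?H" by (simp add: inc_isomorphism_def)
  then have "hermitian_unital UNIV R \<epsilon> ?H"
    unfolding hermitian_unital_def using assms(1,2) sep by blast
  then show ?thesis using U.quadratic_E U.finite_E main sep by blast
qed

end
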